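(* Let $N\in\{5,8\}$ and let $p=5$ if $N=5$, $p=2$ if $N=8$. Let $t$ be the Hauptmodul of $\Gamma_1(N)$ and $t_0$ the Hauptmodul of $\Gamma_0(N)$. For positive integers $m,n$ let $H_{m,n}$ (resp. $h_{m,n}$) denote the coefficient of $q^m$ in the Faber polynomial $X_n(t)$ (resp. $X_n(t_0)$). Let $a,b,c,d$ be positive integers with $ab=cd$ and $\gcd(a,b)=\gcd(c,d)$, and let $k\ge 0$ be such that $p^k$ exactly divides $\gcd(a,b)$. Then $$\psi(a,b)\,(2H_{a,b}-h_{a,b})=\psi(c,d)\,(2H_{c,d}-h_{c,d}),$$ where for positive integers $x,y$ with $p^k\,\|\,\gcd(x,y)$ we put $\psi(x,y)=1$ if $x/p^k\equiv\pm1 \pmod N$ or $y/p^k\equiv \pm 1\pmod N$, and $\psi(x,y)=-1$ otherwise.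
   Context: $\mathfrak H$ is the complex upper half plane, $q=e^{2\pi i z}$, $z\in\mathfrak H$. $\Gamma_0(N)=\{\left(\begin{smallmatrix}a&b\\c&d\end{smallmatrix}\right)\in SL_2(\mathbb Z): c\equiv 0 \bmod N\}$ and $\Gamma_1(N)=\{\left(\begin{smallmatrix}a&b\\c&d\end{smallmatrix}\right)\in\Gamma_0(N): a\equiv d\equiv 1\bmod N\}$. For a discrete group $\Gamma$ containing $z\mapsto z+1$ whose modular curve $\Gamma\backslash(\mathfrak H\cup\mathbb P^1(\mathbb Q))$ has genus zero, the Hauptmodul is the unique generator of its function field whose $q$-expansion has the form $q^{-1}+0+\sum_{m\ge1}c_mq^m$; for $N=5,8$ both $\Gamma_1(N)$ and $\Gamma_0(N)$ have genus zero. For a series $u=q^{-1}+\sum_{m\ge1}c_mq^m$ and $n\ge1$, the Faber polynomial $X_n(u)$ is the unique polynomial in $u$ such that $X_n(u)-\frac1n q^{-n}\in q\mathbb C[[q]]$. *)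

theory Defs
  imports "HOL-Complex_Analysis.Complex_Analysis" "HOL-Number_Theory.Cong"
begin

definition upper_half_plane :: "complex set" where
  "upper_half_plane = {z. Im z > 0}"

definition SL2Z :: "(int^2^2) set" where
  "SL2Z = {A. det A = 1}"

definition Gamma0 :: "nat \<Rightarrow> (int^2^2) set" where
  "Gamma0 N = {A \<in> SL2Z. [A$2$1 = 0] (mod int N)}"

definition Gamma1 :: "nat \<Rightarrow> (int^2^2) set" where
  "Gamma1 N = {A \<in> Gamma0 N. [A$1$1 = 1] (mod int N) \<and> [A$2$2 = 1] (mod int N)}"

definition act :: "int^2^2 \<Rightarrow> complex \<Rightarrow> complex" where
  "act A = moebius (of_int (A$1$1)) (of_int (A$1$2)) (of_int (A$2$1)) (of_int (A$2$2))"

text \<open>\<open>f\<close> has the Laurent expansion \<open>F\<close> in the local parameter \<open>exp (2 \<pi> i z / w)\<close>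
  at the cusp at infinity.\<close>

definition has_q_expansion :: "(complex \<Rightarrow> complex) \<Rightarrow> nat \<Rightarrow> complex fls \<Rightarrow> bool" where
  "has_q_expansion f w F \<longleftrightarrow> fls_conv_radius F > 0 \<and>
     (\<exists>Y. \<forall>z. Im z > Y \<longrightarrow> f z = eval_fls F (exp (2 * of_real pi * \<i> * z / of_nat w)))"

definition q_expansion :: "(complex \<Rightarrow> complex) \<Rightarrow> complex fls" where
  "q_expansion f = (THE F. has_q_expansion f 1 F)"

text \<open>Elements of the function field of the compactified modular curve of \<open>\<Gamma>\<close> (a subgroup of
  finite index in \<open>SL2Z\<close>), pulled back to the upper half plane. A meromorphic function is
  represented by its unique \<^const>\<open>nicely_meromorphic_on\<close> version, which has the value 0 at each
  pole. Since \<open>SL2Z\<close> acts transitively on the rational projective line, every cusp is of the form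
  \<open>A \<infinity>\<close>, and meromorphy there is meromorphy of \<open>f \<circ> act A\<close> at infinity, with the cusp
  width as \<open>w\<close>.\<close>

definition modular_function :: "(int^2^2) set \<Rightarrow> (complex \<Rightarrow> complex) \<Rightarrow> bool" where
  "modular_function \<Gamma> f \<longleftrightarrow>
     f nicely_meromorphic_on upper_half_plane \<and>
     (\<forall>A\<in>\<Gamma>. \<forall>z\<in>upper_half_plane. f (act A z) = f z) \<and>
     (\<forall>A\<in>SL2Z. \<exists>w>0. \<exists>F. has_q_expansion (f \<circ> act A) w F)"

text \<open>The identity \<open>g = P(f) / Q(f)\<close> is one of meromorphic functions, so it is only required away
  from a discrete set (the poles of \<open>f\<close> and the zeros of \<open>Q(f)\<close>).\<close>

definition generates_function_field :: "(int^2^2) set \<Rightarrow> (complex \<Rightarrow> complex) \<Rightarrow> bool" where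
  "generates_function_field \<Gamma> f \<longleftrightarrow>
     modular_function \<Gamma> f \<and>
     (\<forall>g. modular_function \<Gamma> g \<longrightarrow>
        (\<exists>P Q. Q \<noteq> 0 \<and> (\<forall>\<^sub>\<approx>z\<in>upper_half_plane. g z = poly P (f z) / poly Q (f z))))"

definition is_hauptmodul :: "(int^2^2) set \<Rightarrow> (complex \<Rightarrow> complex) \<Rightarrow> bool" where
  "is_hauptmodul \<Gamma> t \<longleftrightarrow>
     generates_function_field \<Gamma> t \<and>
     (\<exists>F. has_q_expansion t 1 F \<and>
        fls_nth F (-1) = 1 \<and> fls_nth F 0 = 0 \<and> (\<forall>k. k < -1 \<longrightarrow> fls_nth F k = 0))"

definition fls_poly :: "complex poly \<Rightarrow> complex fls \<Rightarrow> complex fls" where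
  "fls_poly P u = poly (map_poly fls_const P) u"

definition faber_poly :: "complex fls \<Rightarrow> nat \<Rightarrow> complex poly" where
  "faber_poly u n =
     (THE P. \<forall>k\<le>0. fls_nth (fls_poly P u - fls_const (1 / of_nat n) * fls_X_inv ^ n) k = 0)"

text \<open>The coefficient of \<open>q\<^sup>m\<close> in \<open>X\<^sub>n(t)\<close>.\<close>

definition faber_coeff :: "(complex \<Rightarrow> complex) \<Rightarrow> nat \<Rightarrow> nat \<Rightarrow> complex" where
  "faber_coeff t m n =
     fls_nth (fls_poly (faber_poly (q_expansion t) n) (q_expansion t)) (int m)"

text \<open>Only used when \<open>p ^ k\<close> exactly divides \<open>gcd x y\<close>, so both divisions are exact.\<close>

definition psi :: "nat \<Rightarrow> nat \<Rightarrow> nat \<Rightarrow> nat \<Rightarrow> nat \<Rightarrow> complex" where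
  "psi N p k x y =
     (if [int (x div p ^ k) = 1] (mod int N) \<or> [int (x div p ^ k) = -1] (mod int N) \<or>
         [int (y div p ^ k) = 1] (mod int N) \<or> [int (y div p ^ k) = -1] (mod int N)
      then 1 else -1)"

end

theory Submission
  imports Defs
begin

text \<open>Eisenstein series over the coprime pairs that are not bottom rows of \<open>\<plusminus>\<Gamma>\<close> vanish at infinity
  and at no inequivalent cusp, and at a given point of the upper half plane one of them is nonzero.
  Dividing them by level one Eisenstein series gives enough elements of the function field to see that
  a Hauptmodul has no pole besides the one at infinity.

  Let \<open>\<sigma>\<close> represent the nontrivial coset of \<open>\<plusminus>\<Gamma>\<^sub>1(N)\<close> in \<open>\<Gamma>\<^sub>0(N)\<close>, and \<open>\<chi>\<close> the quadratic character
  with kernel \<open>\<plusminus>1\<close>. By Liouville's theorem on the modular curve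
  \<open>X\<^sub>n(t) + X\<^sub>n(t) \<circ> \<sigma> - X\<^sub>n(t\<^sub>0)\<close> is constant, so \<open>2 H\<^bsub>m,n\<^esub> - h\<^bsub>m,n\<^esub>\<close> is the coefficient of \<open>q\<^sup>m\<close>
  in \<open>f\<^sub>n = X\<^sub>n(t) - X\<^sub>n(t) \<circ> \<sigma>\<close>, which transforms under \<open>\<Gamma>\<^sub>0(N)\<close> by \<open>\<chi>\<close> and has only the
  polar term \<open>q\<^bsup>-n\<^esup> / n\<close>. For \<open>n\<close> prime to \<open>N M\<close> the twisted Hecke operator \<open>T\<^sub>n\<close> takes \<open>f\<^sub>M\<close> to a
  function with the same poles as \<open>\<chi>(n) f\<^bsub>M n\<^esub>\<close>, so both agree up to a constant. With \<open>M = p\<^sup>k\<close> this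
  expresses \<open>\<chi>(n)\<close> times the coefficient at \<open>(p\<^sup>k m, p\<^sup>k n)\<close> by \<open>m n\<close> and \<open>gcd m n\<close> alone. By the
  symmetry of the Grunsky coefficients the same holds with \<open>\<chi>(m)\<close>; hence the coefficient vanishes if
  \<open>\<chi>(m) \<noteq> \<chi>(n)\<close>.\<close>

text \<open>The definition of a Hauptmodul speaks of the function field and of the expansion at
  infinity, while Liouville's theorem must know that there is no other pole. The Eisenstein series
  bridge this gap: if \<open>t\<close> had a second pole, every function vanishing at infinity,
  being rational in \<open>t\<close>, would vanish there too. The levels 5 and 8 have in common that
  the units modulo N, taken up to sign, form a group of order two, so that the class of +-1 is the
  kernel of a quadratic character. Hecke operators respect the level for n prime to N, that is, not
  divisible by p. Therefore the common power p^k goes into the fixed index M; of the two remaining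
  cofactors at least one is prime to p, and by symmetry it can be taken as the index of the
  operator. The sign psi is chi of that cofactor. If both cofactors are prime to p and their
  characters differ, the coefficient is zero and either sign will do.\<close>

no_notation fps_nth (infixl \<open>$\<close> 75)

section \<open>Integer matrices and the upper half plane\<close>

definition mat2 :: "int \<Rightarrow> int \<Rightarrow> int \<Rightarrow> int \<Rightarrow> int^2^2" where
  "mat2 a b c d = vector [vector [a, b], vector [c, d]]"

lemma mat2_sel [simp]:
  "mat2 a b c d $ 1 $ 1 = a" "mat2 a b c d $ 1 $ 2 = b"
  "mat2 a b c d $ 2 $ 1 = c" "mat2 a b c d $ 2 $ 2 = d"
  by (simp_all add: mat2_def vector_2)

lemma mat_eq_iff: "(A :: int^2^2) = B \<longleftrightarrow>
   A$1$1 = B$1$1 \<and> A$1$2 = B$1$2 \<and> A$2$1 = B$2$1 \<and> A$2$2 = B$2$2"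
  by (simp only: vec_eq_iff forall_2) blast

lemma mat_mult_sel [simp]:
  fixes A B :: "int^2^2"
  shows "(A ** B) $ i $ j = A$i$1 * B$1$j + A$i$2 * B$2$j"
  by (simp only: matrix_matrix_mult_def sum_2 vec_lambda_beta)

lemma mat1_sel [simp]:
  "(mat 1 :: int^2^2) $ 1 $ 1 = 1" "(mat 1 :: int^2^2) $ 1 $ 2 = 0"
  "(mat 1 :: int^2^2) $ 2 $ 1 = 0" "(mat 1 :: int^2^2) $ 2 $ 2 = 1"
  by (simp_all add: mat_def)

lemma det_mat2 [simp]: "det (mat2 a b c d) = a * d - b * c"
  by (simp add: det_2)

text \<open>The inverse on \<open>SL2Z\<close>, with integer entries by construction.\<close>

definition adj :: "int^2^2 \<Rightarrow> int^2^2" where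
  "adj A = mat2 (A$2$2) (- (A$1$2)) (- (A$2$1)) (A$1$1)"

lemma adj_sel [simp]:
  "adj A $ 1 $ 1 = A$2$2" "adj A $ 1 $ 2 = - (A$1$2)"
  "adj A $ 2 $ 1 = - (A$2$1)" "adj A $ 2 $ 2 = A$1$1"
  by (simp_all add: adj_def)

lemma SL2Z_iff: "A \<in> SL2Z \<longleftrightarrow> A$1$1 * A$2$2 - A$1$2 * A$2$1 = 1"
  by (simp add: SL2Z_def det_2)

lemma SL2Z_det: "A \<in> SL2Z \<Longrightarrow> det A = 1"
  by (simp add: SL2Z_def)

lemma SL2Z_mult: "A \<in> SL2Z \<Longrightarrow> B \<in> SL2Z \<Longrightarrow> A ** B \<in> SL2Z"
  by (simp add: SL2Z_def det_mul)

lemma SL2Z_adj: "A \<in> SL2Z \<Longrightarrow> adj A \<in> SL2Z"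
  by (simp add: SL2Z_iff algebra_simps)

lemma SL2Z_one: "mat 1 \<in> SL2Z"
  by (simp add: SL2Z_iff)

lemma adj_right: "A \<in> SL2Z \<Longrightarrow> A ** adj A = mat 1"
  by (auto simp: mat_eq_iff SL2Z_iff algebra_simps)

lemma adj_left: "A \<in> SL2Z \<Longrightarrow> adj A ** A = mat 1"
  by (auto simp: mat_eq_iff SL2Z_iff algebra_simps)

lemma adj_adj [simp]: "adj (adj A) = A"
  by (auto simp: mat_eq_iff)

lemma SL2Z_coprime:
  assumes "A \<in> SL2Z" shows "coprime (A$2$1) (A$2$2)" "coprime (A$1$1) (A$2$1)"
proof -
  have *: "A$2$1 * (- (A$1$2)) + A$2$2 * A$1$1 = 1" "A$1$1 * A$2$2 + A$2$1 * (- (A$1$2)) = 1"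
    using assms by (simp_all add: SL2Z_iff algebra_simps)
  show "coprime (A$2$1) (A$2$2)"
    by (rule coprimeI) (metis *(1) dvd_add dvd_mult2)
  show "coprime (A$1$1) (A$2$1)"
    by (rule coprimeI) (metis *(2) dvd_add dvd_mult2)
qed

lemma SL2Z_bottom_row:
  assumes "coprime (c::int) d"
  obtains A where "A \<in> SL2Z" "A$2$1 = c" "A$2$2 = d"
proof -
  obtain u v where "u * c + v * d = 1"
    using assms bezout_int[of c d] by auto
  then have "mat2 v (-u) c d \<in> SL2Z" by (simp add: SL2Z_iff algebra_simps)
  then show ?thesis using that by fastforce
qed

section \<open>Factors of automorphy and the action on the upper half plane\<close>

definition aut :: "int^2^2 \<Rightarrow> complex \<Rightarrow> complex" where
  "aut A z = of_int (A$2$1) * z + of_int (A$2$2)"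

lemma UHP_iff [simp]: "z \<in> upper_half_plane \<longleftrightarrow> Im z > 0"
  by (simp add: upper_half_plane_def)

lemma linear_form_nonzero:
  assumes "Im z > 0" "c \<noteq> 0 \<or> d \<noteq> 0"
  shows "of_int c * z + of_int d \<noteq> (0::complex)"
proof
  assume *: "of_int c * z + of_int d = (0::complex)"
  then have "Im (of_int c * z + of_int d) = 0" by simp
  then have "c = 0" using assms by simp
  then show False using * assms by simp
qed

lemma aut_nonzero: "Im z > 0 \<Longrightarrow> det A \<noteq> 0 \<Longrightarrow> aut A z \<noteq> 0"
  unfolding aut_def by (rule linear_form_nonzero) (auto simp: det_2)

lemma Im_act:
  assumes "Im z > 0" "det A \<noteq> 0"
  shows "Im (act A z) = of_int (det A) * Im z / (norm (aut A z))\<^sup>2"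
proof -
  let ?w = "aut A z"
  have nz: "?w \<noteq> 0" using aut_nonzero[OF assms] .
  have "act A z = (of_int (A$1$1) * z + of_int (A$1$2)) / ?w"
    by (simp add: act_def moebius_def aut_def)
  also have "\<dots> = (of_int (A$1$1) * z + of_int (A$1$2)) * cnj ?w / of_real ((norm ?w)\<^sup>2)"
    using nz complex_div_cnj by simp
  also have "Im \<dots> = Im ((of_int (A$1$1) * z + of_int (A$1$2)) * cnj ?w) / (norm ?w)\<^sup>2"
    by (simp only: Im_divide_of_real)
  also have "Im ((of_int (A$1$1) * z + of_int (A$1$2)) * cnj ?w) = of_int (det A) * Im z"
    by (simp add: aut_def det_2 algebra_simps)
  finally show ?thesis .
qed

lemma Im_act_pos: "Im z > 0 \<Longrightarrow> det A > 0 \<Longrightarrow> Im (act A z) > 0"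
  using aut_nonzero[of z A] by (simp add: Im_act)

lemma aut_mult:
  assumes "Im z > 0" "det B \<noteq> 0"
  shows "aut (A ** B) z = aut A (act B z) * aut B z"
proof -
  have "act B z = (of_int (B$1$1) * z + of_int (B$1$2)) / aut B z"
    by (simp add: act_def moebius_def aut_def)
  then have "act B z * aut B z = of_int (B$1$1) * z + of_int (B$1$2)"
    using aut_nonzero[OF assms] by simp
  then show ?thesis
    by (simp add: aut_def[of A] aut_def[of "A ** B"] distrib_right mult.assoc)
      (simp add: aut_def algebra_simps)
qed

lemma act_mult:
  assumes "Im z > 0" "det A > 0" "det B > 0"
  shows "act (A ** B) z = act A (act B z)"
proof -
  have nz: "aut B z \<noteq> 0" "aut (A**B) z \<noteq> 0" "aut A (act B z) \<noteq> 0"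
    using assms by (intro aut_nonzero Im_act_pos; simp add: det_mul)+
  have B: "act B z * aut B z = of_int (B$1$1) * z + of_int (B$1$2)"
    using nz by (simp add: act_def moebius_def aut_def)
  have "act A (act B z) = (of_int (A$1$1) * act B z + of_int (A$1$2)) / aut A (act B z)"
    by (simp add: act_def moebius_def aut_def)
  also have "\<dots> = (of_int (A$1$1) * (act B z * aut B z) + of_int (A$1$2) * aut B z) / aut (A**B) z"
    using nz assms by (simp add: aut_mult field_simps)
  also have "\<dots> = act (A ** B) z"
    unfolding B by (simp add: act_def moebius_def aut_def algebra_simps)
  finally show ?thesis ..
qed

lemma act_one [simp]: "act (mat 1) z = z"
  by (simp add: act_def moebius_def)

lemma act_adj:
  assumes "A \<in> SL2Z" "Im z > 0"
  shows "act A (act (adj A) z) = z" "act (adj A) (act A z) = z"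
  using act_mult[of z A "adj A"] act_mult[of z "adj A" A] assms
  by (simp_all add: SL2Z_det SL2Z_adj adj_left adj_right)

lemma act_holomorphic: "det A \<noteq> 0 \<Longrightarrow> act A holomorphic_on {z. Im z > 0}"
  unfolding act_def moebius_def
  by (intro holomorphic_intros) (use aut_nonzero[of _ A] in \<open>auto simp: aut_def\<close>)

lemma act_translation: "act (mat2 1 n 0 1) z = z + of_int n"
  by (simp add: act_def moebius_def)

section \<open>Minima of linear forms and reduction theory\<close>

lemma linear_form_bound:
  assumes "y > 0" "b \<ge> 0"
  obtains \<delta> where "\<delta> > 0"
    "\<And>z m n. Im z \<ge> y \<Longrightarrow> \<bar>Re z\<bar> \<le> b \<Longrightarrow> norm (of_int m * z + of_int n :: complex) \<ge> \<delta> * (\<bar>of_int m\<bar> + \<bar>of_int n\<bar>)"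
proof
  \<comment> \<open>With w the linear form, the imaginary part gives \<open>y\<close> |m| <= |w| and
    the real part |n| <= |w| + |m| \<open>b\<close>. Adding the first to \<open>y\<close> times the
    second yields \<open>y\<close> (|m| + |n|) <= (1 + \<open>y\<close> + \<open>b\<close>)
    |w|.\<close>
  define \<delta> where "\<delta> = y / (1 + y + b)"
  show "\<delta> > 0" using assms by (simp add: \<delta>_def)
  fix z and m n :: int assume z: "Im z \<ge> y" "\<bar>Re z\<bar> \<le> b"
  let ?w = "of_int m * z + of_int n :: complex"
  have "\<bar>of_int m * Im z\<bar> \<le> norm ?w" using abs_Im_le_cmod[of ?w] by simp
  moreover have "\<bar>of_int m * Im z\<bar> \<ge> \<bar>of_int m\<bar> * y"
    using z assms by (simp add: abs_mult mult_left_mono)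
  ultimately have 1: "\<bar>of_int m\<bar> * y \<le> norm ?w" by simp
  have "\<bar>of_int m * Re z + of_int n\<bar> \<le> norm ?w" using abs_Re_le_cmod[of ?w] by simp
  moreover have "\<bar>of_int m * Re z\<bar> \<le> \<bar>of_int m\<bar> * b" using z by (simp add: abs_mult mult_left_mono)
  ultimately have 2: "\<bar>of_int n\<bar> \<le> norm ?w + \<bar>of_int m\<bar> * b" by linarith
  have "y * (\<bar>of_int m\<bar> + \<bar>of_int n\<bar>) \<le> norm ?w + y * norm ?w + (\<bar>of_int m\<bar> * y) * b"
    using 1 mult_left_mono[OF 2, of y] assms by (simp add: algebra_simps)
  also have "\<dots> \<le> norm ?w + y * norm ?w + norm ?w * b"
    using mult_right_mono[OF 1, of b] assms by simp
  finally have "y * (\<bar>of_int m\<bar> + \<bar>of_int n\<bar>) \<le> (1 + y + b) * norm ?w" by (simp add: algebra_simps)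
  then show "\<delta> * (\<bar>of_int m\<bar> + \<bar>of_int n\<bar>) \<le> norm ?w"
    using assms by (simp add: \<delta>_def field_simps)
qed

text \<open>By \<open>linear_form_bound\<close> the pairs whose value does not exceed that of one
  chosen pair lie in a finite box, so the infimum is attained.\<close>

lemma linear_form_minimum:
  fixes S :: "(int \<times> int) set"
  assumes z: "Im z > 0" and S: "S \<noteq> {}"
  obtains c d where "(c, d) \<in> S"
    "\<And>m n. (m, n) \<in> S \<Longrightarrow> norm (of_int c * z + of_int d :: complex) \<le> norm (of_int m * z + of_int n)"
proof -
  obtain c0 d0 where cd0: "(c0, d0) \<in> S" using S by auto
  define f where "f = (\<lambda>(m,n). norm (of_int m * z + of_int n :: complex))"
  obtain \<delta> where \<delta>: "\<delta> > 0"
    "\<And>m n. norm (of_int m * z + of_int n :: complex) \<ge> \<delta> * (\<bar>of_int m\<bar> + \<bar>of_int n\<bar>)"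
    using linear_form_bound[of "Im z" "\<bar>Re z\<bar>"] z by (metis abs_ge_zero order_refl)
  define B where "B = \<lceil>f (c0, d0) / \<delta>\<rceil>"
  define K where "K = {v \<in> S. f v \<le> f (c0, d0)}"
  have "K \<subseteq> {-B..B} \<times> {-B..B}"
  proof
    fix v assume v: "v \<in> K"
    obtain m n where [simp]: "v = (m, n)" by (cases v)
    have "\<delta> * (\<bar>of_int m\<bar> + \<bar>of_int n\<bar>) \<le> f (c0, d0)"
      using \<delta>(2)[of m n] v by (simp add: K_def f_def)
    then have "\<bar>of_int m\<bar> + \<bar>of_int n\<bar> \<le> f (c0, d0) / \<delta>" using \<delta>(1) by (simp add: field_simps)
    then have "\<bar>of_int m\<bar> + \<bar>of_int n\<bar> \<le> real_of_int B" unfolding B_def by linarith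
    then have "\<bar>m\<bar> + \<bar>n\<bar> \<le> B" by linarith
    then show "v \<in> {-B..B} \<times> {-B..B}" by auto
  qed
  then have fin: "finite K" by (rule finite_subset) auto
  have ne: "K \<noteq> {}" using cd0 by (auto simp: K_def)
  have "finite (f ` K)" "f ` K \<noteq> {}" using fin ne by auto
  from Min_in[OF this] obtain v where v: "v \<in> K" "f v = Min (f ` K)" by auto
  have "f v \<le> f u" if "u \<in> S" for u
  proof (cases "u \<in> K")
    case True then show ?thesis using v fin by auto
  next
    case False then show ?thesis using v(1) that by (auto simp: K_def)
  qed
  then show ?thesis using that[of "fst v" "snd v"] v(1) by (auto simp: K_def f_def split: prod.splits)
qed

text \<open>A bottom row minimising |cz + d| makes the image w of z as high as possible. Minimality
  forces |w + k| >= 1, and with |Re w + k| <= 1/2 this gives (Im w)^2 >= 3/4; the rounder bound 1/2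
  suffices below.\<close>

lemma SL2Z_reduction:
  assumes z: "Im z > 0"
  obtains A where "A \<in> SL2Z" "Im (act A z) \<ge> 1/2"
proof -
  define L where "L = (\<lambda>m n. of_int m * z + of_int n :: complex)"
  obtain c d where cd: "(c,d) \<noteq> (0,0)" and min: "\<And>m n. (m,n) \<noteq> (0,0) \<Longrightarrow> norm (L c d) \<le> norm (L m n)"
  proof -
    have "(1, 0) \<in> - {(0::int, 0::int)}" by simp
    then have "- {(0::int, 0::int)} \<noteq> {}" by blast
    then show ?thesis
    proof (rule linear_form_minimum[OF z])
      fix c d :: int
      assume "(c, d) \<in> - {(0, 0)}"
        "\<And>m n. (m, n) \<in> - {(0, 0)} \<Longrightarrow>
          norm (of_int c * z + of_int d :: complex) \<le> norm (of_int m * z + of_int n)"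
      then show ?thesis by (intro that[of c d]) (auto simp: L_def)
    qed
  qed
  define g where "g = gcd c d"
  have g: "g > 0" using cd by (auto simp: g_def)
  obtain c' d' where c': "c = g * c'" "d = g * d'" and cop: "coprime c' d'"
  proof -
    have "gcd c d \<noteq> 0" using g by (simp add: g_def)
    from gcd_coprime_exists[OF this] show ?thesis
      using that unfolding g_def by (metis mult.commute)
  qed
  obtain B where B: "B \<in> SL2Z" "B$2$1 = c'" "B$2$2 = d'"
    using SL2Z_bottom_row[OF cop] .
  \<comment> \<open>Dividing the minimal pair by its gcd cannot increase the value, so the primitive
    pair is minimal as well.\<close>
  have minB: "norm (aut B z) \<le> norm (L m n)" if "(m,n) \<noteq> (0,0)" for m n
  proof -
    have "L c d = of_int g * aut B z" by (simp add: L_def c' aut_def B algebra_simps)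
    then have "norm (L c d) = of_int g * norm (aut B z)" using g by (simp add: norm_mult)
    moreover have "norm (aut B z) \<le> of_int g * norm (aut B z)"
      using g mult_right_mono[of 1 "of_int g" "norm (aut B z)"] by simp
    ultimately show ?thesis using min[OF that] by simp
  qed
  define w where "w = act B z"
  define k where "k = - round (Re w)"
  \<comment> \<open>Translation by \<open>k\<close> followed by inversion: its factor of automorphy
    at \<open>w\<close> is \<open>w + k\<close>, which minimality bounds from below.\<close>
  define S where "S = mat2 0 (-1) 1 k"
  have imw: "Im w > 0" unfolding w_def using B z by (auto intro!: Im_act_pos simp: SL2Z_det)
  have S: "S \<in> SL2Z" by (simp add: S_def SL2Z_iff)
  have "aut (S ** B) z = aut S w * aut B z"
    unfolding w_def using z B by (intro aut_mult) (auto simp: SL2Z_det)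
  moreover have "aut (S ** B) z = L (B$1$1 + k * c') (B$1$2 + k * d')"
    by (simp add: L_def aut_def S_def B algebra_simps)
  moreover have "aut (S ** B) z \<noteq> 0"
    using z S B by (intro aut_nonzero) (auto simp: SL2Z_det SL2Z_mult)
  moreover have "L 0 0 = 0" by (simp add: L_def)
  ultimately have "(B$1$1 + k * c', B$1$2 + k * d') \<noteq> (0, 0)"
    and eq: "aut S w * aut B z = L (B$1$1 + k * c') (B$1$2 + k * d')" by auto
  have "norm (aut B z) \<le> norm (aut S w * aut B z)" unfolding eq by (rule minB) fact
  moreover have "norm (aut B z) > 0" using z B aut_nonzero[of z B] by (simp add: SL2Z_det)
  ultimately have "1 \<le> norm (aut S w)" by (simp add: norm_mult)
  moreover have "aut S w = w + of_int k" by (simp add: aut_def S_def)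
  ultimately have "1 \<le> norm (w + of_int k)" by simp
  then have "1 \<le> (norm (w + of_int k))\<^sup>2" by simp
  then have "1 \<le> (Re w + of_int k)\<^sup>2 + (Im w)\<^sup>2" by (simp add: cmod_power2)
  moreover have "\<bar>Re w + of_int k\<bar> \<le> 1/2"
    unfolding k_def using of_int_round_abs_le[of "Re w"] by (simp add: abs_minus_commute)
  then have "(Re w + of_int k)\<^sup>2 \<le> (1/2)\<^sup>2"
    using abs_le_square_iff[of "Re w + of_int k" "1/2"] by simp
  ultimately have "(Im w)\<^sup>2 \<ge> (1/2)\<^sup>2" by (simp add: power2_eq_square)
  then have "Im w \<ge> 1/2" using imw by (intro power2_le_imp_le[of "1/2"]) auto
  then show ?thesis using that B(1) by (simp add: w_def)
qed

section \<open>Functions of the local parameter\<close>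

definition qpar :: "nat \<Rightarrow> complex \<Rightarrow> complex" where
  "qpar w z = exp (2 * of_real pi * \<i> * z / of_nat w)"

lemma qpar_nonzero [simp]: "qpar w z \<noteq> 0"
  by (simp add: qpar_def)

lemma norm_qpar: "norm (qpar w z) = exp (- (2 * pi * Im z / w))"
  by (simp add: qpar_def Im_divide_of_nat)

lemma norm_qpar_less_iff:
  assumes "w > 0" "r > 0"
  shows "norm (qpar w z) < r \<longleftrightarrow> Im z > - (w * ln r / (2 * pi))"
proof -
  have "norm (qpar w z) < exp (ln r) \<longleftrightarrow> - (2 * pi * Im z / w) < ln r"
    by (simp only: norm_qpar exp_less_cancel_iff)
  also have "\<dots> \<longleftrightarrow> Im z > - (w * ln r / (2 * pi))"
    using assms by (simp add: field_simps) linarith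
  finally show ?thesis using assms by simp
qed

lemma norm_qpar_less_1: "w > 0 \<Longrightarrow> norm (qpar w z) < 1 \<longleftrightarrow> Im z > 0"
  using norm_qpar_less_iff[of w 1 z] by simp

lemma qpar_surj:
  assumes "w > 0" "q \<noteq> 0"
  shows "qpar w (of_nat w * Ln q / (2 * of_real pi * \<i>)) = q"
  using assms by (simp add: qpar_def)

lemma qpar_small: assumes "w > 0" "r > 0" obtains Y where "Y > 0" "\<And>z. Im z > Y \<Longrightarrow> norm (qpar w z) < r"
proof (rule that)
  show "max 1 (- (w * ln r / (2 * pi))) > 0" by simp
qed (use assms in \<open>simp add: norm_qpar_less_iff\<close>)

lemma qpar_large: 
  assumes "w > 0" obtains r where "r > 0" "r \<le> 1" "\<And>z. norm (qpar w z) < r \<Longrightarrow> Im z > Y"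
proof (rule that)
  let ?r = "exp (- (2 * pi * max 0 Y / w))"
  show "?r > 0" "?r \<le> 1" by auto
  fix z assume "norm (qpar w z) < ?r"
  then have "Im z > max 0 Y" using assms by (simp add: norm_qpar field_simps)
  then show "Im z > Y" by simp
qed

text \<open>Only the height matters, so limits along this filter are uniform in the real part; under
  \<open>qpar\<close> it corresponds to the punctured neighbourhoods of 0.\<close>

definition at_cusp :: "complex filter" where
  "at_cusp = filtercomap Im at_top"

lemma eventually_at_cusp: "eventually P at_cusp \<longleftrightarrow> (\<exists>Y. \<forall>z. Im z > Y \<longrightarrow> P z)"
  unfolding at_cusp_def eventually_filtercomap_at_top_dense by simp

lemma at_cusp_nontrivial [simp]: "at_cusp \<noteq> bot"
  unfolding trivial_limit_def eventually_at_cusp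
  by (metis complex.sel(2) gt_ex)

lemma eventually_at_cusp_gt: "eventually (\<lambda>z. Im z > Y) at_cusp"
  unfolding eventually_at_cusp by blast

lemma filterlim_qpar:
  assumes "w > 0"
  shows "filterlim (qpar w) (at 0) at_cusp"
  unfolding filterlim_at
proof
  show "(qpar w \<longlongrightarrow> 0) at_cusp"
  proof (rule tendstoI)
    fix e :: real assume "e > 0"
    then obtain Y where "\<And>z. Im z > Y \<Longrightarrow> norm (qpar w z) < e" using qpar_small assms by metis
    then show "eventually (\<lambda>z. dist (qpar w z) 0 < e) at_cusp"
      unfolding eventually_at_cusp by auto
  qed
qed auto

text \<open>Takes the place of holomorphy at the cusp: for periodic holomorphic functions the
  singularity at q = 0 is then removable (\<open>qpar_function\<close>).\<close>

definition bdd_at_cusp :: "(complex \<Rightarrow> complex) \<Rightarrow> bool" where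
  "bdd_at_cusp f \<longleftrightarrow> (\<exists>Y C. \<forall>z. Im z > Y \<longrightarrow> norm (f z) \<le> C)"

lemma bdd_at_cuspI: "(\<And>z. Im z > Y \<Longrightarrow> norm (f z) \<le> C) \<Longrightarrow> bdd_at_cusp f"
  unfolding bdd_at_cusp_def by blast

lemma bdd_at_cuspD:
  assumes "bdd_at_cusp f"
  shows "\<exists>Y>0. \<exists>C>0. \<forall>z. Im z > Y \<longrightarrow> norm (f z) \<le> C"
proof -
  from assms obtain Y C where *: "\<forall>z. Im z > Y \<longrightarrow> norm (f z) \<le> C"
    unfolding bdd_at_cusp_def by blast
  have "\<forall>z. Im z > max Y 1 \<longrightarrow> norm (f z) \<le> max C 1" using * by force
  then show ?thesis by (metis less_max_iff_disj zero_less_one)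
qed

lemma bdd_at_cusp_cong:
  assumes "\<And>z. Im z > 0 \<Longrightarrow> f z = g z" "bdd_at_cusp f"
  shows "bdd_at_cusp g"
proof -
  obtain Y C where "Y > 0" "\<And>z. Im z > Y \<Longrightarrow> norm (f z) \<le> C"
    using bdd_at_cuspD[OF assms(2)] by blast
  then show ?thesis by (intro bdd_at_cuspI[of Y _ C]) (simp flip: assms(1))
qed

lemma bdd_at_cusp_const [intro]: "bdd_at_cusp (\<lambda>z. c)"
  by (rule bdd_at_cuspI) auto

lemma bdd_at_cusp_add [intro]:
  assumes "bdd_at_cusp f" "bdd_at_cusp g" shows "bdd_at_cusp (\<lambda>z. f z + g z)"
proof -
  obtain Y C where 1: "Y > 0" "C > 0" "\<And>z. Im z > Y \<Longrightarrow> norm (f z) \<le> C"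
    using bdd_at_cuspD[OF assms(1)] by blast
  obtain Y' C' where 2: "Y' > 0" "C' > 0" "\<And>z. Im z > Y' \<Longrightarrow> norm (g z) \<le> C'"
    using bdd_at_cuspD[OF assms(2)] by blast
  show ?thesis
    by (rule bdd_at_cuspI[of "max Y Y'" _ "C + C'"]) (meson 1 2 add_mono max_less_iff_conj norm_triangle_le)
qed

lemma bdd_at_cusp_mult [intro]:
  assumes "bdd_at_cusp f" "bdd_at_cusp g" shows "bdd_at_cusp (\<lambda>z. f z * g z)"
proof -
  obtain Y C where 1: "Y > 0" "C > 0" "\<And>z. Im z > Y \<Longrightarrow> norm (f z) \<le> C"
    using bdd_at_cuspD[OF assms(1)] by blast
  obtain Y' C' where 2: "Y' > 0" "C' > 0" "\<And>z. Im z > Y' \<Longrightarrow> norm (g z) \<le> C'"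
    using bdd_at_cuspD[OF assms(2)] by blast
  show ?thesis
    by (rule bdd_at_cuspI[of "max Y Y'" _ "C * C'"])
      (use 1 2 in \<open>auto simp: norm_mult intro!: mult_mono\<close>)
qed

lemma bdd_at_cusp_diff [intro]:
  assumes "bdd_at_cusp f" "bdd_at_cusp g" shows "bdd_at_cusp (\<lambda>z. f z - g z)"
  using bdd_at_cusp_add[OF assms(1) bdd_at_cusp_mult[OF bdd_at_cusp_const[of "-1"] assms(2)]] by simp

lemma bdd_at_cusp_sum [intro]:
  assumes "\<And>i. i \<in> I \<Longrightarrow> bdd_at_cusp (f i)" shows "bdd_at_cusp (\<lambda>z. \<Sum>i\<in>I. f i z)"
  using assms by (induction I rule: infinite_finite_induct) auto

lemma bdd_at_cusp_poly [intro]: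
  assumes "bdd_at_cusp f" shows "bdd_at_cusp (\<lambda>z. poly P (f z))"
  by (induction P) (use assms in auto)

section \<open>Periodic functions as functions of the local parameter\<close>

lemma periodic_int:
  assumes per: "\<And>z. Im z > 0 \<Longrightarrow> f (z + of_nat w) = f z" and z: "Im z > 0"
  shows "f (z + of_nat w * of_int k) = (f z :: complex)"
proof -
  have *: "f (z + of_nat w * of_nat k) = f z" if "Im z > 0" for z k
  proof (induction k)
    case (Suc k)
    have "f (z + of_nat w * of_nat k + of_nat w) = f (z + of_nat w * of_nat k)"
      using that by (intro per) simp
    then show ?case using Suc by (simp add: algebra_simps)
  qed simp
  show ?thesis
  proof (cases "k \<ge> 0")
    case True then show ?thesis using *[OF z, of "nat k"] by simp
  next
    case False
    then show ?thesis
      using *[of "z + of_nat w * of_int k" "nat (-k)"] z by simp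
  qed
qed

text \<open>Composition with a branch of the logarithm gives a function \<open>G0\<close>
  independent of the branch, by periodicity; near any \<open>q0\<close> it can be computed with a
  branch that is holomorphic there. Boundedness removes the singularity at 0.\<close>

lemma qpar_function:
  assumes w: "w > 0" and holo: "f holomorphic_on {z. Im z > 0}"
    and per: "\<And>z. Im z > 0 \<Longrightarrow> f (z + of_nat w) = f z"
    and bdd: "bdd_at_cusp f"
  shows "\<exists>G. G holomorphic_on ball 0 1 \<and> (\<forall>z. Im z > 0 \<longrightarrow> f z = G (qpar w z))"
proof -
  obtain Y C where bdd: "\<And>z. Im z > Y \<Longrightarrow> norm (f z) \<le> C"
    using bdd_at_cuspD[OF bdd] by blast
  define l where "l = (\<lambda>q. of_nat w * Ln q / (2 * of_real pi * \<i>))"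
  define G0 where "G0 = (\<lambda>q. f (l q))"
  have inv: "f u = f v" if "qpar w u = qpar w v" "Im u > 0" for u v
  proof -
    from that(1) obtain n where "2 * of_real pi * \<i> * u / of_nat w = 2 * of_real pi * \<i> * v / of_nat w + of_int (2 * n) * (of_real pi * \<i>)"
      unfolding qpar_def exp_eq by (auto simp: mult_ac)
    then have "2 * of_real pi * \<i> * u  = 2 * of_real pi * \<i> * (v + of_nat w * of_int n)"
      using w by (simp add: field_simps)
    then have *: "u = v + of_nat w * of_int n" by simp
    then have "Im v > 0" using that(2) by simp
    then show ?thesis using periodic_int[of f w v n] per * by simp
  qed
  have eq: "f z = G0 (qpar w z)" if "Im z > 0" for z
    unfolding G0_def l_def by (rule inv) (use that w qpar_surj in auto)
  have "G0 analytic_on {q0}" if q0: "q0 \<in> ball 0 1 - {0}" for q0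
  proof -
    \<comment> \<open>The disc about \<open>q0\<close> reaching up to 0 keeps \<open>q / q0\<close>
      off the cut of \<open>Ln\<close>.\<close>
    define U where "U = ball q0 (norm q0) \<inter> ball 0 1"
    define h where "h = (\<lambda>q. l q0 + of_nat w * Ln (q / q0) / (2 * of_real pi * \<i>))"
    have U: "open U" "q0 \<in> U" using q0 by (auto simp: U_def)
    have nz: "q / q0 \<notin> \<real>\<^sub>\<le>\<^sub>0" if "q \<in> U" for q
    proof
      assume "q / q0 \<in> \<real>\<^sub>\<le>\<^sub>0"
      then obtain x where "q / q0 = of_real x" "x \<le> 0" by (auto elim: nonpos_Reals_cases)
      then have "q = of_real x * q0" using q0 by (simp add: field_simps)
      then have "q0 - q = of_real (1 - x) * q0" by (simp add: algebra_simps)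
      then have "norm (q0 - q) = \<bar>1 - x\<bar> * norm q0" by (simp only: norm_mult norm_of_real)
      moreover have "norm q0 \<le> \<bar>1 - x\<bar> * norm q0"
        using \<open>x \<le> 0\<close> mult_right_mono[of 1 "1-x" "norm q0"] by simp
      ultimately show False using that by (simp add: U_def dist_norm)
    qed
    have hq: "qpar w (h q) = q" if "q \<in> U" for q
    proof -
      have "q \<noteq> 0" using nz[OF that] by auto
      have "qpar w (h q) = qpar w (l q0) * qpar w (of_nat w * Ln (q / q0) / (2 * of_real pi * \<i>))"
        unfolding h_def qpar_def by (simp only: exp_add [symmetric] add_divide_distrib distrib_left)
      also have "\<dots> = q0 * (q / q0)" 
        unfolding l_def using qpar_surj[OF w, of q0] qpar_surj[OF w, of "q / q0"] q0 \<open>q \<noteq> 0\<close> by simp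
      finally show ?thesis using q0 by simp
    qed
    have imh: "Im (h q) > 0" if "q \<in> U" for q
      using hq[OF that] that norm_qpar_less_1[of w "h q"] w by (simp add: U_def)
    have "h holomorphic_on U"
      unfolding h_def using nz q0 w by (auto intro!: holomorphic_intros)
    then have "(f \<circ> h) holomorphic_on U"
      by (rule holomorphic_on_compose_gen[OF _ holo]) (use imh in auto)
    moreover have "(f \<circ> h) q = G0 q" if "q \<in> U" for q
      using eq[OF imh[OF that]] hq[OF that] by simp
    ultimately have "G0 holomorphic_on U" by (rule holomorphic_transform)
    then show ?thesis using U unfolding analytic_at by blast
  qed
  then have "G0 analytic_on ball 0 1 - {0}"
    using analytic_on_analytic_at[of G0 "ball 0 1 - {0}"] by simp
  then have "G0 holomorphic_on ball 0 1 - {0}" by (rule analytic_imp_holomorphic)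
  moreover have "\<forall>\<^sub>F q in at 0. norm (G0 q) \<le> C"
  proof -
    obtain r where r: "r > 0" "\<And>z. norm (qpar w z) < r \<Longrightarrow> Im z > Y"
      using qpar_large[OF w] by metis
    have "norm (G0 q) \<le> C" if "q \<noteq> 0" "norm q < r" for q
      unfolding G0_def using that qpar_surj[OF w that(1)] by (intro bdd r(2)) (simp add: l_def)
    then show ?thesis using r(1) by (auto simp: eventually_at dist_norm)
  qed
  ultimately obtain G where G: "G holomorphic_on ball 0 1" "\<And>q. q \<in> ball 0 1 - {0} \<Longrightarrow> G q = G0 q"
    using holomorphic_on_extend_bounded[of G0 "ball 0 1" 0] by auto
  show ?thesis
    using G eq w norm_qpar_less_1 by (intro exI[of _ G]) auto
qed

section \<open>Liouville's theorem on the modular curve\<close>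

text \<open>Modulo N the bottom row of A B^-1 equals that of B B^-1, namely (0, 1), and then the
  determinant makes the upper left entry 1. So the bottom row modulo N determines the coset.\<close>

lemma Gamma1_cosets:
  assumes A: "A \<in> SL2Z" and B: "B \<in> SL2Z"
    and c: "A$2$1 mod int N = B$2$1 mod int N" "A$2$2 mod int N = B$2$2 mod int N"
  shows "A ** adj B \<in> Gamma1 N"
proof -
  let ?M = "A ** adj B"
  have M: "?M \<in> SL2Z" using A B by (simp add: SL2Z_mult SL2Z_adj)
  have c': "[A$2$1 = B$2$1] (mod int N)" "[A$2$2 = B$2$2] (mod int N)"
    using c by (simp_all add: cong_def)
  have "[A$2$1 * B$2$2 + A$2$2 * - (B$2$1) = B$2$1 * B$2$2 + B$2$2 * - (B$2$1)] (mod int N)"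
    by (intro cong_add cong_mult c') auto
  then have 21: "[?M$2$1 = 0] (mod int N)" by simp
  have "[A$2$1 * - (B$1$2) + A$2$2 * B$1$1 = B$2$1 * - (B$1$2) + B$2$2 * B$1$1] (mod int N)"
    by (intro cong_add cong_mult c') auto
  also have "B$2$1 * - (B$1$2) + B$2$2 * B$1$1 = 1" using B by (simp add: SL2Z_iff algebra_simps)
  finally have 22: "[?M$2$2 = 1] (mod int N)" by (simp only: mat_mult_sel adj_sel)
  have "[?M$1$1 * ?M$2$2 - ?M$1$2 * ?M$2$1 = ?M$1$1 * 1 - ?M$1$2 * 0] (mod int N)"
    by (intro cong_diff cong_mult 21 22 cong_refl)
  also have "?M$1$1 * ?M$2$2 - ?M$1$2 * ?M$2$1 = 1" using M by (simp only: SL2Z_iff)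
  finally have "[?M$1$1 = 1] (mod int N)" by (simp only: mult_1_right mult_zero_right diff_zero cong_sym_eq)
  then show ?thesis using M 21 22 unfolding Gamma1_def Gamma0_def by blast
qed

text \<open>The supremum of \<open>|f|\<close> over the finitely many translates \<open>f \<circ> A\<close> is attained in a closed
  disc of the local parameter at some cusp, so the maximum principle applies there.\<close>

theorem Gamma1_Liouville:
  assumes N: "N > 0" and holo: "f holomorphic_on {z. Im z > 0}"
    and inv: "\<And>A z. A \<in> Gamma1 N \<Longrightarrow> Im z > 0 \<Longrightarrow> f (act A z) = f z"
    and bdd: "\<And>A. A \<in> SL2Z \<Longrightarrow> bdd_at_cusp (\<lambda>z. f (act A z))"
  obtains c where "\<And>z. Im z > 0 \<Longrightarrow> f z = c"
proof -
  \<comment> \<open>The translate of \<open>f\<close> by \<open>A\<close> depends only on the bottom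
    row of \<open>A\<close> modulo N, so there are finitely many translates.\<close>
  have same: "f (act A z) = f (act B z)"
    if A: "A \<in> SL2Z" and B: "B \<in> SL2Z"
      and c: "A$2$1 mod int N = B$2$1 mod int N" "A$2$2 mod int N = B$2$2 mod int N"
      and z: "Im z > 0" for A B z
  proof -
    have "f (act (A ** adj B) (act B z)) = f (act B z)"
      using Gamma1_cosets[OF A B c] z B by (intro inv) (auto intro!: Im_act_pos simp: SL2Z_det)
    moreover have "act (A ** adj B) (act B z) = act A z"
      using A B z by (subst act_mult) (auto simp: SL2Z_det SL2Z_adj act_adj intro!: Im_act_pos)
    ultimately show ?thesis by simp
  qed
  have "\<exists>G. G holomorphic_on ball 0 1 \<and> (\<forall>z. Im z > 0 \<longrightarrow> f (act A z) = G (qpar N z))"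
    if A: "A \<in> SL2Z" for A
  proof -
    have "(f \<circ> act A) holomorphic_on {z. Im z > 0}"
      using A by (intro holomorphic_on_compose_gen[OF act_holomorphic holo])
        (auto simp: SL2Z_det intro!: Im_act_pos)
    then have "(\<lambda>z. f (act A z)) holomorphic_on {z. Im z > 0}" by (simp add: o_def)
    moreover have "f (act A (z + of_nat N)) = f (act A z)" if z: "Im z > 0" for z
    proof -
      \<comment> \<open>Translation by N is the identity modulo N, so the width N serves every cusp
        at once.\<close>
      let ?T = "mat2 1 (int N) 0 1"
      have "act A (act ?T z) = act (A ** ?T) z"
        using z A by (subst act_mult) (auto simp: SL2Z_det)
      moreover have "f (act (A ** ?T) z) = f (act A z)"
        using A z by (intro same SL2Z_mult) (auto simp: SL2Z_iff)
      ultimately show ?thesis by (simp add: act_translation)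
    qed
    ultimately show ?thesis using bdd[OF A] by (rule qpar_function[OF N])
  qed
  then obtain G where G: "\<And>A. A \<in> SL2Z \<Longrightarrow> G A holomorphic_on ball 0 1"
    "\<And>A z. A \<in> SL2Z \<Longrightarrow> Im z > 0 \<Longrightarrow> f (act A z) = G A (qpar N z)" by metis
  define row where "row = (\<lambda>A::int^2^2. (A$2$1 mod int N, A$2$2 mod int N))"
  have "row ` SL2Z \<subseteq> {0..<int N} \<times> {0..<int N}" using N by (auto simp: row_def)
  then have "finite (row ` SL2Z)" by (rule finite_subset) auto
  then obtain R where R: "R \<subseteq> SL2Z" "finite R" "row ` R = row ` SL2Z"
    using finite_subset_image[of "row ` SL2Z" row SL2Z] by blast
  \<comment> \<open>By \<open>SL2Z_reduction\<close> every point can be moved to height at least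
    1/2, which lands in this compact disc inside the unit disc.\<close>
  obtain r where r: "r > 0" "r < 1" "\<And>z. Im z \<ge> 1/2 \<Longrightarrow> norm (qpar N z) \<le> r"
  proof (rule that)
    let ?r = "exp (- (2 * pi * (1/2) / N))"
    show "?r > 0" "?r < 1" using N by auto
    show "norm (qpar N z) \<le> ?r" if "Im z \<ge> 1/2" for z
      using that N by (simp add: norm_qpar field_simps)
  qed
  have "\<exists>q\<in>cball 0 r. \<forall>q'\<in>cball 0 r. norm (G A q') \<le> norm (G A q)" if "A \<in> R" for A
  proof (rule continuous_attains_sup)
    have "G A holomorphic_on cball 0 r"
      by (rule holomorphic_on_subset[OF G(1)]) (use that R r in auto)
    then show "continuous_on (cball 0 r) (\<lambda>q. norm (G A q))"
      by (intro continuous_on_norm holomorphic_on_imp_continuous_on)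
  qed (use r in auto)
  then obtain m where m: "\<And>A. A \<in> R \<Longrightarrow> m A \<in> cball 0 r"
    "\<And>A q. A \<in> R \<Longrightarrow> q \<in> cball 0 r \<Longrightarrow> norm (G A q) \<le> norm (G A (m A))" by metis
  have "R \<noteq> {}" using R(3) SL2Z_one by auto
  then have "finite ((\<lambda>A. norm (G A (m A))) ` R)" "(\<lambda>A. norm (G A (m A))) ` R \<noteq> {}" using R by auto
  from Max_in[OF this] obtain A where A: "A \<in> R" "norm (G A (m A)) = Max ((\<lambda>A. norm (G A (m A))) ` R)" by auto
  have max: "norm (G B (m B)) \<le> norm (G A (m A))" if "B \<in> R" for B
    using that R(2) unfolding A(2) by auto
  \<comment> \<open>Replacing the reducing matrix by the representative of its coset exhibits
    \<open>f z\<close> as a value of some \<open>G B'\<close> on the disc.\<close>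
  have fle: "norm (f z) \<le> norm (G A (m A))" if z: "Im z > 0" for z
  proof -
    obtain B where B: "B \<in> SL2Z" "Im (act B z) \<ge> 1/2" using SL2Z_reduction[OF z] .
    obtain B' where B': "B' \<in> R" "row B' = row (adj B)" using R(3) SL2Z_adj[OF B(1)]
      by (metis imageE imageI)
    have "f z = f (act (adj B) (act B z))" using B z by (simp add: act_adj)
    also have "\<dots> = f (act B' (act B z))"
      by (rule same) (use B B' R z in \<open>auto simp: SL2Z_adj row_def\<close>)
    also have "\<dots> = G B' (qpar N (act B z))" using B B' R by (intro G(2)) auto
    also have "norm \<dots> \<le> norm (G B' (m B'))" using B B' r by (intro m(2)) auto
    also have "\<dots> \<le> norm (G A (m A))" using B' by (intro max)
    finally show ?thesis .
  qed
  have SA: "A \<in> SL2Z" using A R by auto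
  \<comment> \<open>Conversely, off 0 all values of \<open>G A\<close> are values of
    \<open>f\<close>, hence bounded by the maximum, which is attained inside the unit disc.\<close>
  have le: "norm (G A q) \<le> norm (G A (m A))" if "q \<in> ball 0 1" for q
  proof (cases "q = 0")
    case True then show ?thesis using m(2)[OF A(1)] r by auto
  next
    case False
    then obtain z where z: "q = qpar N z" using qpar_surj[OF N] by metis
    then have "Im z > 0" using that norm_qpar_less_1[OF N] by simp
    then show ?thesis using fle[of "act A z"] G(2)[OF SA] z Im_act_pos[of z A] SL2Z_det[OF SA] by simp
  qed
  have "G A constant_on ball 0 1"
    by (rule maximum_modulus_principle[of _ _ "ball 0 1" "m A"]) (use G(1)[OF SA] m(1)[OF A(1)] r le in auto)
  then obtain c where c: "\<And>q. q \<in> ball 0 1 \<Longrightarrow> G A q = c" by (auto simp: constant_on_def)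
  show ?thesis
  proof (rule that)
    fix z assume z: "Im z > 0"
    let ?w = "act (adj A) z"
    have w: "Im ?w > 0" using z SA by (intro Im_act_pos) (auto simp: SL2Z_det SL2Z_adj)
    have "f z = f (act A ?w)" using z SA by (simp add: act_adj)
    also have "\<dots> = c" using w SA G(2) c norm_qpar_less_1[OF N] by simp
    finally show "f z = c" .
  qed
qed

section \<open>Eisenstein series\<close>

definition lin :: "int \<times> int \<Rightarrow> complex \<Rightarrow> complex" where
  "lin v z = of_int (fst v) * z + of_int (snd v)"

definition coprime_pairs :: "(int \<times> int) set" where
  "coprime_pairs = {v. coprime (fst v) (snd v)}"

definition vmul :: "int \<times> int \<Rightarrow> int^2^2 \<Rightarrow> int \<times> int" where
  "vmul v A = (fst v * A$1$1 + snd v * A$2$1, fst v * A$1$2 + snd v * A$2$2)"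

text \<open>The index set is a parameter, so that \<open>SL2Z\<close> just moves it
  (\<open>eisenstein_act\<close>) and level structure becomes a property of the set.\<close>

definition eisenstein :: "(int \<times> int) set \<Rightarrow> nat \<Rightarrow> complex \<Rightarrow> complex" where
  "eisenstein S k z = (\<Sum>\<^sub>\<infinity>v\<in>S. inverse (lin v z ^ k))"

text \<open>A product of two one-variable terms, which reduces summability over pairs to that of
  inverse squares; the price is weight at least 4 in \<open>eisenstein_term_bound\<close>.\<close>

definition majorant :: "int \<times> int \<Rightarrow> real" where
  "majorant v = inverse ((1 + \<bar>of_int (fst v)\<bar>)\<^sup>2 * (1 + \<bar>of_int (snd v)\<bar>)\<^sup>2)"

lemma majorant_pos: "majorant v > 0"
  unfolding majorant_def by (simp add: add_pos_nonneg)

lemma summable_inverse_square_int: "(\<lambda>m. inverse ((1 + \<bar>of_int m :: real\<bar>)\<^sup>2)) summable_on (UNIV :: int set)"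
proof -
  let ?f = "\<lambda>m::int. inverse ((1 + \<bar>of_int m :: real\<bar>)\<^sup>2)"
  have "summable (\<lambda>n. inverse ((of_nat (Suc n)) ^ 2 :: real))"
    using inverse_power_summable[of 2, where ?'a=real] by (subst summable_Suc_iff) auto
  then have *: "(\<lambda>n. inverse ((1 + real n)\<^sup>2)) summable_on UNIV"
    by (intro norm_summable_imp_summable_on) (simp add: add.commute)
  have 1: "?f summable_on range int"
    by (subst summable_on_reindex) (use * in \<open>auto simp: o_def\<close>)
  have 2: "?f summable_on range (\<lambda>n. - int n)"
    by (subst summable_on_reindex) (use * in \<open>auto simp: o_def inj_on_def\<close>)
  have "?f summable_on (range int \<union> (range (\<lambda>n. - int n) - range int))"
    by (intro summable_on_Un_disjoint 1 summable_on_subset_banach[OF 2]) auto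
  moreover have "range int \<union> (range (\<lambda>n. - int n) - range int) = UNIV"
  proof -
    have "m \<in> range int \<or> m \<in> range (\<lambda>n. - int n)" for m
      by (cases m rule: int_cases2) auto
    then show ?thesis by blast
  qed
  ultimately show ?thesis by simp
qed

lemma majorant_summable: "majorant summable_on S"
proof -
  let ?f = "\<lambda>m::int. inverse ((1 + \<bar>of_int m :: real\<bar>)\<^sup>2)"
  have "(\<lambda>v. ?f (fst v) * ?f (snd v)) summable_on (SIGMA m:UNIV. UNIV)"
  proof (rule summable_on_SigmaI)
    fix m :: int
    show "((\<lambda>n. ?f (fst (m, n)) * ?f (snd (m, n))) has_sum (?f m * infsum ?f UNIV)) UNIV"
      using has_sum_cmult_right[OF has_sum_infsum[OF summable_inverse_square_int], of "?f m"] by simp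
    show "?f (fst (m, n)) * ?f (snd (m, n)) \<ge> 0" for n by simp
  next
    show "(\<lambda>m. ?f m * infsum ?f UNIV) summable_on UNIV"
      by (intro summable_on_cmult_left summable_inverse_square_int)
  qed
  then have "majorant summable_on UNIV"
    by (simp add: majorant_def[abs_def] inverse_mult_distrib)
  then show ?thesis by (rule summable_on_subset_banach) auto
qed

lemma lin_nonzero: "Im z > 0 \<Longrightarrow> v \<noteq> (0,0) \<Longrightarrow> lin v z \<noteq> 0"
  unfolding lin_def using linear_form_nonzero[of z "fst v" "snd v"] by (cases v) auto

text \<open>With s = |m| + |n| >= 1, both 1 + |m| and 1 + |n| are at most 2 s, whence the constant
  16 and the exponent 4; \<open>linear_form_bound\<close> compares s with the linear form uniformly
  on the region.\<close>

lemma eisenstein_term_bound: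
  assumes "y > 0" "b \<ge> 0" "k \<ge> 4"
  shows "\<exists>C>0. \<forall>z v. Im z \<ge> y \<longrightarrow> \<bar>Re z\<bar> \<le> b \<longrightarrow> v \<noteq> (0,0) \<longrightarrow>
           norm (inverse (lin v z ^ k)) \<le> C * majorant v"
proof -
  obtain \<delta> where \<delta>: "\<delta> > 0" and le:
    "\<And>z m n. Im z \<ge> y \<Longrightarrow> \<bar>Re z\<bar> \<le> b \<Longrightarrow> norm (of_int m * z + of_int n :: complex) \<ge> \<delta> * (\<bar>of_int m\<bar> + \<bar>of_int n\<bar>)"
    using linear_form_bound[OF assms(1,2)] by blast
  have "norm (inverse (lin v z ^ k)) \<le> 16 / \<delta> ^ k * majorant v"
    if z: "Im z \<ge> y" "\<bar>Re z\<bar> \<le> b" and v: "v \<noteq> (0,0)" for z v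
  proof -
    define s :: real where "s = \<bar>of_int (fst v)\<bar> + \<bar>of_int (snd v)\<bar>"
    have "\<bar>fst v\<bar> + \<bar>snd v\<bar> \<ge> 1" using v by (cases v) auto
    then have s: "s \<ge> 1" unfolding s_def by linarith
    have "(1 + \<bar>of_int (fst v) :: real\<bar>)\<^sup>2 * (1 + \<bar>of_int (snd v)\<bar>)\<^sup>2 \<le> (2 * s)\<^sup>2 * (2 * s)\<^sup>2"
      using s by (intro mult_mono power_mono) (auto simp: s_def)
    also have "\<dots> = 16 * s ^ 4" by (simp add: power2_eq_square eval_nat_numeral)
    also have "\<dots> \<le> 16 * s ^ k" using s assms(3) by (intro mult_left_mono power_increasing) auto
    finally have 1: "inverse (s ^ k) \<le> 16 * majorant v"
      using s unfolding majorant_def by (simp add: field_simps add_pos_nonneg)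
    have "(\<delta> * s) ^ k \<le> norm (lin v z) ^ k"
      using le[OF z, of "fst v" "snd v"] \<delta> s by (intro power_mono) (auto simp: lin_def s_def)
    then have "norm (inverse (lin v z ^ k)) \<le> inverse ((\<delta> * s) ^ k)"
      using \<delta> s by (simp add: norm_inverse norm_power le_imp_inverse_le)
    also have "\<dots> = inverse (s ^ k) / \<delta> ^ k" by (simp add: power_mult_distrib field_simps)
    also have "\<dots> \<le> 16 * majorant v / \<delta> ^ k" using 1 \<delta> by (intro divide_right_mono) auto
    finally show ?thesis by simp
  qed
  then show ?thesis using \<delta> by (intro exI[of _ "16 / \<delta> ^ k"]) auto
qed

lemma eisenstein_summable:
  assumes "Im z > 0" "(0,0) \<notin> S" "k \<ge> 4"
  shows "(\<lambda>v. inverse (lin v z ^ k)) summable_on S"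
proof -
  obtain C where "C > 0" and C: "\<And>v. v \<noteq> (0,0) \<Longrightarrow> norm (inverse (lin v z ^ k)) \<le> C * majorant v"
    using eisenstein_term_bound[of "Im z" "\<bar>Re z\<bar>" k] assms by auto
  have "(\<lambda>v. norm (inverse (lin v z ^ k))) summable_on S"
  proof (rule summable_on_comparison_test)
    show "(\<lambda>v. C * majorant v) summable_on S"
      by (intro summable_on_cmult_right majorant_summable)
    fix v assume "v \<in> S"
    then show "norm (inverse (lin v z ^ k)) \<le> C * majorant v" using assms(2) by (intro C) auto
  qed simp
  then show ?thesis by (rule abs_summable_summable)
qed

lemma eisenstein_holomorphic:
  assumes "(0,0) \<notin> S" "k \<ge> 4"
  shows "eisenstein S k holomorphic_on {z. Im z > 0}"
proof -
  have "eisenstein S k analytic_on {x}" if x: "Im x > 0" for x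
  proof -
    \<comment> \<open>Half the height keeps the closed disc inside a single region of
      \<open>eisenstein_term_bound\<close>.\<close>
    define r where "r = Im x / 2"
    have r: "r > 0" using x by (simp add: r_def)
    obtain C where C: "C > 0" "\<And>z v. Im z \<ge> r \<Longrightarrow> \<bar>Re z\<bar> \<le> \<bar>Re x\<bar> + r \<Longrightarrow> v \<noteq> (0,0) \<Longrightarrow>
           norm (inverse (lin v z ^ k)) \<le> C * majorant v"
      using eisenstein_term_bound[of r "\<bar>Re x\<bar> + r" k] assms r by auto
    have box: "Im z \<ge> r \<and> \<bar>Re z\<bar> \<le> \<bar>Re x\<bar> + r" if "z \<in> cball x r" for z
    proof -
      have "\<bar>Re (x - z)\<bar> \<le> r" "\<bar>Im (x - z)\<bar> \<le> r"
        using that abs_Re_le_cmod[of "x - z"] abs_Im_le_cmod[of "x - z"] by (auto simp: dist_norm)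
      then show ?thesis unfolding r_def minus_complex.sel by linarith
    qed
    have lim: "uniform_limit (cball x r) (\<lambda>V z. \<Sum>v\<in>V. inverse (lin v z ^ k)) (\<lambda>z. \<Sum>\<^sub>\<infinity>v\<in>S. inverse (lin v z ^ k))
            (finite_subsets_at_top S)"
    proof (rule Weierstrass_m_test_general)
      fix v z assume "v \<in> S" "z \<in> cball x r"
      then show "norm (inverse (lin v z ^ k)) \<le> C * majorant v"
        using assms(1) box by (intro C) auto
    qed (intro summable_on_cmult_right majorant_summable)
    have nz: "lin v z \<noteq> 0" if "v \<in> S" "z \<in> cball x r" for v z
      using that box[of z] r assms(1) by (intro lin_nonzero) auto
    have hol: "(\<lambda>z. \<Sum>v\<in>V. inverse (lin v z ^ k)) holomorphic_on cball x r" if "V \<subseteq> S" for V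
      using nz that unfolding lin_def by (intro holomorphic_intros) auto
    have ev: "\<forall>\<^sub>F V in finite_subsets_at_top S.
        continuous_on (cball x r) (\<lambda>z. \<Sum>v\<in>V. inverse (lin v z ^ k)) \<and>
        (\<lambda>z. \<Sum>v\<in>V. inverse (lin v z ^ k)) holomorphic_on ball x r"
      by (rule eventually_finite_subsets_at_top_weakI)
        (use hol holomorphic_on_imp_continuous_on holomorphic_on_subset[OF _ ball_subset_cball] in blast)
    have "(\<lambda>z. \<Sum>\<^sub>\<infinity>v\<in>S. inverse (lin v z ^ k)) holomorphic_on ball x r"
      using holomorphic_uniform_limit[OF ev lim finite_subsets_at_top_neq_bot] by blast
    then show ?thesis
      unfolding analytic_at using r by (intro exI[of _ "ball x r"]) (auto simp: eisenstein_def[abs_def])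
  qed
  then have "eisenstein S k analytic_on {z. Im z > 0}"
    using analytic_on_analytic_at[of "eisenstein S k" "{z. Im z > 0}"] by simp
  then show ?thesis by (rule analytic_imp_holomorphic)
qed

section \<open>The action on Eisenstein series and their constant terms\<close>

lemma lin_act:
  assumes "A \<in> SL2Z" "Im z > 0"
  shows "lin v (act A z) * aut A z = lin (vmul v A) z"
proof -
  have nz: "aut A z \<noteq> 0" using aut_nonzero[of z A] assms by (simp add: SL2Z_det)
  have "act A z * aut A z = of_int (A$1$1) * z + of_int (A$1$2)"
    using nz by (simp add: act_def moebius_def aut_def)
  then have "lin v (act A z) * aut A z =
    of_int (fst v) * (of_int (A$1$1) * z + of_int (A$1$2)) + of_int (snd v) * aut A z"
    by (simp add: lin_def distrib_right mult.assoc)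
  then show ?thesis by (simp add: lin_def vmul_def aut_def algebra_simps)
qed

lemma vmul_vmul: "vmul (vmul v A) B = vmul v (A ** B)"
  by (simp add: vmul_def algebra_simps)

lemma vmul_one [simp]: "vmul v (mat 1) = v"
  by (simp add: vmul_def)

lemma vmul_adj:
  assumes "A \<in> SL2Z"
  shows "vmul (vmul v A) (adj A) = v" "vmul (vmul v (adj A)) A = v"
  using assms by (simp_all add: vmul_vmul adj_left adj_right)

lemma vmul_inj: "A \<in> SL2Z \<Longrightarrow> inj_on (\<lambda>v. vmul v A) S"
  by (rule inj_on_inverseI[of _ "\<lambda>v. vmul v (adj A)"]) (simp add: vmul_adj)

lemma vmul_image_iff:
  assumes "A \<in> SL2Z" shows "v \<in> (\<lambda>v. vmul v A) ` S \<longleftrightarrow> vmul v (adj A) \<in> S"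
  using vmul_adj[OF assms] by (metis (no_types, lifting) imageE imageI)

lemma vmul_coprime:
  assumes "A \<in> SL2Z" "v \<in> coprime_pairs"
  shows "vmul v A \<in> coprime_pairs"
proof -
  obtain m n where v: "vmul v A = (m, n)" by (cases "vmul v A")
  then have v': "v = vmul (m, n) (adj A)" using vmul_adj(1)[OF assms(1), of v] by simp
  have "coprime m n"
  proof (rule coprimeI)
    fix d assume "d dvd m" "d dvd n"
    then have "d dvd fst v" "d dvd snd v" by (simp_all add: v' vmul_def)
    then show "is_unit d" using assms(2) unfolding coprime_pairs_def
      by (meson coprime_common_divisor mem_Collect_eq)
  qed
  then show ?thesis by (simp add: v coprime_pairs_def)
qed

lemma vmul_coprime_image:
  assumes "A \<in> SL2Z" shows "(\<lambda>v. vmul v A) ` coprime_pairs = coprime_pairs"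
  using vmul_coprime assms SL2Z_adj by (auto simp: vmul_image_iff)  

lemma eisenstein_act:
  assumes A: "A \<in> SL2Z" and z: "Im z > 0"
  shows "eisenstein S k (act A z) = aut A z ^ k * eisenstein ((\<lambda>v. vmul v A) ` S) k z"
proof -
  have nz: "aut A z \<noteq> 0" using aut_nonzero[of z A] assms by (simp add: SL2Z_det)
  have "eisenstein ((\<lambda>v. vmul v A) ` S) k z = (\<Sum>\<^sub>\<infinity>v\<in>S. inverse (lin (vmul v A) z ^ k))"
    unfolding eisenstein_def using A by (subst infsum_reindex) (auto simp: vmul_inj o_def)
  also have "\<dots> = (\<Sum>\<^sub>\<infinity>v\<in>S. inverse (aut A z ^ k) * inverse (lin v (act A z) ^ k))"
    by (intro infsum_cong) (simp add: power_mult_distrib mult.commute flip: lin_act[OF A z])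
  also have "\<dots> = inverse (aut A z ^ k) * eisenstein S k (act A z)"
    unfolding eisenstein_def by (rule infsum_cmult_right')
  finally show ?thesis using nz by simp
qed

lemma zero_notin_coprime_pairs [simp]: "(0,0) \<notin> coprime_pairs"
  by (simp add: coprime_pairs_def)

text \<open>In a set of coprime pairs, only \<open>(0, 1)\<close> and \<open>(0, -1)\<close> contribute to the constant term.\<close>

lemma eisenstein_at_cusp:
  assumes S: "S \<subseteq> coprime_pairs" and N: "N > 0" and k: "k \<ge> 5" "even k"
    and per: "\<And>m n. (m, n) \<in> S \<longleftrightarrow> (m, n + m * int N) \<in> S"
  shows "(eisenstein S k \<longlongrightarrow> of_nat (card (S \<inter> {(0,1), (0,-1)}))) at_cusp"
    and "Im z > 0 \<Longrightarrow> eisenstein S k (z + of_nat N) = eisenstein S k z"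
    and "bdd_at_cusp (eisenstein S k)"
proof -
  define S0 where "S0 = S \<inter> {(0,1), (0,-1)}"
  define c :: complex where "c = of_nat (card S0)"
  have zS: "(0,0) \<notin> S" using S by auto
  have per1: "eisenstein S k (z + of_nat N) = eisenstein S k z" if z: "Im z > 0" for z
  proof -
    let ?T = "mat2 1 (int N) 0 1"
    have T: "?T \<in> SL2Z" by (simp add: SL2Z_iff)
    have "(\<lambda>v. vmul v ?T) ` S = S"
    proof -
      have "v \<in> (\<lambda>v. vmul v ?T) ` S \<longleftrightarrow> v \<in> S" for v
        using per[of "fst v" "snd v - fst v * int N"] by (simp only: vmul_image_iff[OF T]) (simp add: vmul_def)
      then show ?thesis by blast
    qed
    then show ?thesis using eisenstein_act[OF T z, of S k] by (simp add: act_translation aut_def)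
  qed
  then show "Im z > 0 \<Longrightarrow> eisenstein S k (z + of_nat N) = eisenstein S k z" .
  have decomp: "v \<in> S0" if v: "v \<in> S" "fst v = 0" for v
  proof -
    have "coprime (fst v) (snd v)" using v S by (auto simp: coprime_pairs_def)
    then have "is_unit (snd v)" using v by simp
    then have "\<bar>snd v\<bar> = 1" by (simp only: zdvd1_eq)
    then show ?thesis using v by (cases v) (auto simp: S0_def)
  qed
  \<comment> \<open>One factor of each term is spent on decay in the height, the other
    \<open>k - 1\<close> on convergence; hence weight at least 5.\<close>
  have "4 \<le> k - 1" using k(1) by simp
  then obtain C where C: "C > 0" "\<And>z v. Im z \<ge> 1 \<Longrightarrow> \<bar>Re z\<bar> \<le> real N \<Longrightarrow> v \<noteq> (0,0) \<Longrightarrow>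
           norm (inverse (lin v z ^ (k-1))) \<le> C * majorant v"
    using eisenstein_term_bound[of 1 "real N" "k-1"] by force
  define D where "D = C * infsum majorant (S - S0)"
  have est: "norm (eisenstein S k z - c) \<le> D / Im z" if z: "Im z \<ge> 1" "\<bar>Re z\<bar> \<le> real N" for z
  proof -
    have sm: "(\<lambda>v. inverse (lin v z ^ k)) summable_on T" if "T \<subseteq> S" for T
      using that z zS k by (intro eisenstein_summable) auto
    have "eisenstein S k z - (\<Sum>\<^sub>\<infinity>v\<in>S0. inverse (lin v z ^ k)) = (\<Sum>\<^sub>\<infinity>v\<in>S - S0. inverse (lin v z ^ k))"
      unfolding eisenstein_def by (intro infsum_Diff[symmetric] sm) (auto simp: S0_def)
    \<comment> \<open>The weight is even, so (0, -1) contributes 1 just as (0, 1) does.\<close>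
    moreover have "(\<Sum>\<^sub>\<infinity>v\<in>S0. inverse (lin v z ^ k)) = c"
    proof -
      have "finite S0" by (simp add: S0_def)
      moreover have "inverse (lin v z ^ k) = 1" if "v \<in> S0" for v
        using that k by (auto simp: S0_def lin_def)
      ultimately show ?thesis by (simp add: c_def)
    qed
    moreover have "norm (\<Sum>\<^sub>\<infinity>v\<in>S - S0. inverse (lin v z ^ k)) \<le> (\<Sum>\<^sub>\<infinity>v\<in>S - S0. C / Im z * majorant v)"
    proof (rule norm_infsum_le)
      show "((\<lambda>v. inverse (lin v z ^ k)) has_sum (\<Sum>\<^sub>\<infinity>v\<in>S - S0. inverse (lin v z ^ k))) (S - S0)"
        by (intro has_sum_infsum sm) auto
      show "((\<lambda>v. C / Im z * majorant v) has_sum (\<Sum>\<^sub>\<infinity>v\<in>S - S0. C / Im z * majorant v)) (S - S0)"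
        by (intro has_sum_infsum summable_on_cmult_right majorant_summable)
      fix v assume v: "v \<in> S - S0"
      then have "fst v \<noteq> 0" using decomp by blast
      \<comment> \<open>A nonzero first entry makes the linear form at least as large as the
        height.\<close>
      have "Im z \<le> \<bar>of_int (fst v)\<bar> * Im z"
        using \<open>fst v \<noteq> 0\<close> z mult_right_mono[of 1 "\<bar>of_int (fst v)\<bar>" "Im z"] by auto
      also have "\<dots> = \<bar>Im (lin v z)\<bar>" using z by (simp add: lin_def abs_mult)
      also have "\<dots> \<le> norm (lin v z)" by (rule abs_Im_le_cmod)
      finally have "inverse (norm (lin v z)) \<le> inverse (Im z)" using z by (intro le_imp_inverse_le) auto
      moreover have "norm (inverse (lin v z ^ (k-1))) \<le> C * majorant v"
        using v zS z by (intro C) auto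
      ultimately have "inverse (norm (lin v z)) * norm (inverse (lin v z ^ (k-1))) \<le> inverse (Im z) * (C * majorant v)"
        using z by (intro mult_mono) auto
      also have "inverse (norm (lin v z)) * norm (inverse (lin v z ^ (k-1))) = norm (inverse (lin v z ^ k))"
        using k by (cases k) (auto simp: norm_inverse norm_mult norm_power)
      finally show "norm (inverse (lin v z ^ k)) \<le> C / Im z * majorant v" by (simp add: field_simps)
    qed
    moreover have "(\<Sum>\<^sub>\<infinity>v\<in>S - S0. C / Im z * majorant v) = D / Im z"
      by (simp only: D_def infsum_cmult_right') simp
    ultimately show ?thesis by simp
  qed
  \<comment> \<open>A translation by a multiple of N changes neither side and brings the real part
    into the range of \<open>est\<close>.\<close>
  have est': "norm (eisenstein S k z - c) \<le> D / Im z" if z: "Im z \<ge> 1" for z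
  proof -
    define j where "j = \<lfloor>Re z / real N\<rfloor>"
    let ?w = "z + of_nat N * of_int (- j)"
    have "eisenstein S k ?w = eisenstein S k z" by (rule periodic_int) (use per1 z in auto)
    moreover have "of_int j \<le> Re z / real N" "Re z / real N \<le> of_int j + 1"
      unfolding j_def by linarith+
    then have "\<bar>Re ?w\<bar> \<le> real N" using N by (auto simp: field_simps)
    then have "norm (eisenstein S k ?w - c) \<le> D / Im ?w" using z by (intro est) auto
    ultimately show ?thesis by simp
  qed
  have "D \<ge> 0" unfolding D_def using C(1) majorant_pos by (intro mult_nonneg_nonneg infsum_nonneg) (auto intro: less_imp_le)
  show "(eisenstein S k \<longlongrightarrow> of_nat (card (S \<inter> {(0,1), (0,-1)}))) at_cusp"
  proof (rule tendstoI)
    fix e :: real assume e: "e > 0"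
    have "norm (eisenstein S k z - c) < e" if "Im z > max 1 (D / e)" for z
    proof -
      have "D / Im z < e" using that e by (simp add: field_simps)
      then show ?thesis using est'[of z] that by auto
    qed
    then show "eventually (\<lambda>z. dist (eisenstein S k z) (of_nat (card (S \<inter> {(0,1), (0,-1)}))) < e) at_cusp"
      unfolding eventually_at_cusp dist_norm c_def S0_def by blast
  qed
  show "bdd_at_cusp (eisenstein S k)"
  proof (rule bdd_at_cuspI)
    fix z :: complex assume z: "Im z > 1"
    have "D / Im z \<le> D" using z \<open>D \<ge> 0\<close> mult_left_mono[of 1 "Im z" D] by (simp add: field_simps)
    then have "norm (eisenstein S k z - c) \<le> D" using est'[of z] z by simp
    then show "norm (eisenstein S k z) \<le> D + norm c" by norm
  qed
qed

section \<open>Nonvanishing in some weight at a given point\<close>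

lemma poly_bounded_on_cball:
  fixes p :: "complex poly"
  shows "\<exists>C. \<forall>x. norm x \<le> R \<longrightarrow> norm (poly p x) \<le> C"
proof -
  have "compact (poly p ` cball 0 R)"
    by (intro compact_continuous_image continuous_intros compact_cball)
  then obtain C where "\<forall>x\<in>poly p ` cball 0 R. norm x \<le> C"
    using compact_imp_bounded bounded_iff by metis
  then show ?thesis by (intro exI[of _ C]) auto
qed

text \<open>If all moments \<open>\<Sum> y\<^sub>v ^ j\<close> vanished, then so would \<open>\<Sum> y\<^sub>v ^ 3 p(y\<^sub>v)\<close> for every polynomial
  \<open>p\<close>. Choosing \<open>p\<close> to vanish at all \<open>y\<^sub>v\<close> of size at least half the maximum, except at one of
  maximal size, and multiplying by a high power isolates that one.\<close>

lemma moments_not_all_zero: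
  fixes y :: "'a \<Rightarrow> complex" and S :: "'a set"
  assumes abs: "(\<lambda>v. norm (y v ^ 3)) summable_on S"
    and v0: "v0 \<in> S" "y v0 \<noteq> 0" and max: "\<And>v. v \<in> S \<Longrightarrow> norm (y v) \<le> norm (y v0)"
    and fin: "\<And>r. r > 0 \<Longrightarrow> finite {v \<in> S. norm (y v) \<ge> r}"
  shows "\<exists>j\<ge>3. (\<Sum>\<^sub>\<infinity>v\<in>S. y v ^ j) \<noteq> 0"
proof (rule ccontr)
  assume "\<not> ?thesis"
  then have zero: "(\<Sum>\<^sub>\<infinity>v\<in>S. y v ^ j) = 0" if "j \<ge> 3" for j using that by blast
  define y0 where "y0 = y v0"
  define r where "r = norm y0 / 2"
  have y0: "y0 \<noteq> 0" "r > 0" using v0 by (auto simp: y0_def r_def)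
  have ynorm: "norm (y v) \<le> norm y0" if "v \<in> S" for v using max[OF that] by (simp add: y0_def)
  define K where "K = {v \<in> S. norm (y v) \<ge> r}"
  define B where "B = y ` K - {y0}"
  have K: "finite K" unfolding K_def using y0 by (intro fin)
  then have B: "finite B" by (auto simp: B_def)
  define p :: "complex poly" where "p = (\<Prod>b\<in>B. [:-b, 1:])"
  have p0: "poly p y0 \<noteq> 0" using B by (auto simp: p_def poly_prod B_def)
  have pB: "poly p (y v) = 0" if "v \<in> K" "y v \<noteq> y0" for v
    using that B by (auto simp: p_def poly_prod B_def)
  obtain C where C: "\<And>x. norm x \<le> norm y0 \<Longrightarrow> norm (poly p x) \<le> C"
    using poly_bounded_on_cball by blast
  \<comment> \<open>Three powers of \<open>y v\<close> secure absolute convergence, and a polynomial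
    is bounded on the disc containing all the values.\<close>
  have sm: "(\<lambda>v. norm (y v ^ 3 * poly q (y v))) summable_on S" for q :: "complex poly"
  proof -
    obtain C where C: "\<And>x. norm x \<le> norm y0 \<Longrightarrow> norm (poly q x) \<le> C"
      using poly_bounded_on_cball by blast
    show ?thesis
    proof (rule summable_on_comparison_test)
      show "(\<lambda>v. norm (y v ^ 3) * C) summable_on S" by (rule summable_on_cmult_left[OF abs])
      show "norm (y v ^ 3 * poly q (y v)) \<le> norm (y v ^ 3) * C" if "v \<in> S" for v
        unfolding norm_mult using C ynorm[OF that] by (intro mult_left_mono) auto
    qed simp
  qed
  have sm': "(\<lambda>v. y v ^ 3 * poly q (y v)) summable_on T" if "T \<subseteq> S" for q T
    using abs_summable_summable[OF sm] that by (rule summable_on_subset_banach)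
  have polyzero: "(\<Sum>\<^sub>\<infinity>v\<in>S. y v ^ 3 * poly q (y v)) = 0" for q
  proof -
    have summand: "((\<lambda>v. coeff q i * y v ^ (i + 3)) has_sum 0) S" for i
    proof -
      have "(\<lambda>v. y v ^ 3 * poly (monom 1 i) (y v)) summable_on S" by (rule sm') simp
      then have "(\<lambda>v. y v ^ (i + 3)) summable_on S"
        by (simp add: poly_monom power_add mult.commute)
      then have "((\<lambda>v. y v ^ (i + 3)) has_sum 0) S" using zero[of "i + 3"] by (simp add: has_sum_iff)
      from has_sum_cmult_right[OF this, of "coeff q i"] show ?thesis by simp
    qed
    have "((\<lambda>v. \<Sum>i<n. coeff q i * y v ^ (i + 3)) has_sum 0) S" for n
    proof (induction n)
      case (Suc n)
      show ?case using has_sum_add[OF Suc summand[of n]] by simp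
    qed simp
    from this[of "Suc (degree q)"] show ?thesis
      by (intro infsumI) (simp add: poly_altdef sum_distrib_left power_add mult_ac lessThan_Suc_atMost)
  qed
  \<comment> \<open>Several indices may share the value \<open>y0\<close>; their terms are equal and
    add up to the nonzero \<open>a\<close>.\<close>
  define K0 where "K0 = {v \<in> K. y v = y0}"
  have K0: "finite K0" by (rule finite_subset[OF _ K]) (auto simp: K0_def)
  have v0K: "v0 \<in> K0" using v0 by (auto simp: K0_def K_def y0_def r_def)
  define a where "a = of_nat (card K0) * (y0 ^ 3 * poly p y0)"
  define D where "D = (\<Sum>\<^sub>\<infinity>v\<in>S - K0. norm (y v ^ 3) * C)"
  have a: "a \<noteq> 0" using K0 v0K y0 p0 by (auto simp: a_def)
  have bound: "norm a \<le> (1/2) ^ M * D" for M :: nat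
  proof -
    define q where "q = monom (inverse (y0 ^ M)) M * p"
    have q: "poly q x = (x / y0) ^ M * poly p x" for x
      by (simp add: q_def poly_monom power_divide field_simps)
    have "(\<Sum>\<^sub>\<infinity>v\<in>S. y v ^ 3 * poly q (y v)) - (\<Sum>\<^sub>\<infinity>v\<in>K0. y v ^ 3 * poly q (y v))
        = (\<Sum>\<^sub>\<infinity>v\<in>S - K0. y v ^ 3 * poly q (y v))"
      by (intro infsum_Diff[symmetric] sm') (auto simp: K0_def K_def)
    moreover have "(\<Sum>\<^sub>\<infinity>v\<in>K0. y v ^ 3 * poly q (y v)) = a"
    proof -
      have "(\<Sum>v\<in>K0. y v ^ 3 * poly q (y v)) = (\<Sum>v\<in>K0. y0 ^ 3 * poly p y0)"
        using y0 by (intro sum.cong) (auto simp: K0_def q)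
      then show ?thesis using K0 by (simp add: a_def)
    qed
    ultimately have "norm a = norm (\<Sum>\<^sub>\<infinity>v\<in>S - K0. y v ^ 3 * poly q (y v))"
      using polyzero[of q] by (metis diff_0 norm_minus_cancel)
    also have "\<dots> \<le> (\<Sum>\<^sub>\<infinity>v\<in>S - K0. (1/2) ^ M * (norm (y v ^ 3) * C))"
    proof (rule norm_infsum_le)
      show "((\<lambda>v. y v ^ 3 * poly q (y v)) has_sum (\<Sum>\<^sub>\<infinity>v\<in>S - K0. y v ^ 3 * poly q (y v))) (S - K0)"
        by (intro has_sum_infsum sm') auto
      show "((\<lambda>v. (1/2) ^ M * (norm (y v ^ 3) * C)) has_sum (\<Sum>\<^sub>\<infinity>v\<in>S - K0. (1/2) ^ M * (norm (y v ^ 3) * C))) (S - K0)"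
        by (intro has_sum_infsum summable_on_cmult_right summable_on_cmult_left summable_on_subset_banach[OF abs]) auto
      fix v assume v: "v \<in> S - K0"
      have C0: "C \<ge> 0" using C[of y0] norm_ge_zero[of "poly p y0"] by linarith
      show "norm (y v ^ 3 * poly q (y v)) \<le> (1/2) ^ M * (norm (y v ^ 3) * C)"
      \<comment> \<open>On \<open>K\<close> outside \<open>K0\<close> the polynomial vanishes;
        outside \<open>K\<close> the ratio \<open>y v / y0\<close> has size at most 1/2, whence the
        factor tending to 0.\<close>
      proof (cases "v \<in> K")
        case True
        then have "poly q (y v) = 0" using v by (simp add: q pB K0_def)
        then show ?thesis using C0 by simp
      next
        case False
        then have "norm (y v / y0) \<le> 1/2"
          using v y0 by (simp add: K_def r_def norm_divide field_simps)
        then have "norm ((y v / y0) ^ M) * norm (poly p (y v)) \<le> (1/2) ^ M * C"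
          unfolding norm_power using C ynorm[of v] v by (intro mult_mono power_mono) auto
        then have "norm (y v ^ 3) * (norm ((y v / y0) ^ M) * norm (poly p (y v))) \<le> norm (y v ^ 3) * ((1/2) ^ M * C)"
          by (intro mult_left_mono) auto
        then show ?thesis by (simp only: q norm_mult mult_ac)
      qed
    qed
    also have "\<dots> = (1/2) ^ M * D" by (simp only: D_def infsum_cmult_right')
    finally show ?thesis .
  qed
  have "(\<lambda>M. (1/2) ^ M * D) \<longlonglongrightarrow> 0 * D" by (intro tendsto_mult LIMSEQ_realpow_zero) auto
  then have "norm a \<le> 0 * D" by (rule LIMSEQ_le_const) (use bound in auto)
  then show False using a by simp
qed

text \<open>With \<open>y v\<close> the inverse square of the linear form, the j-th moment is the
  series of weight 2 j; j >= 3 accounts for both the parity and the bound 6.\<close>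

lemma eisenstein_nonzero:
  assumes S: "S \<subseteq> coprime_pairs" "S \<noteq> {}" and x: "Im x > 0"
  shows "\<exists>k\<ge>6. even k \<and> eisenstein S k x \<noteq> 0"
proof -
  define y where "y = (\<lambda>v. inverse (lin v x ^ 2))"
  have S0: "(0,0) \<notin> S" using S by auto
  then have nz: "lin v x \<noteq> 0" if "v \<in> S" for v using that x by (intro lin_nonzero) auto
  obtain c d where cd: "(c, d) \<in> S"
    and min: "\<And>m n. (m, n) \<in> S \<Longrightarrow> norm (of_int c * x + of_int d :: complex) \<le> norm (of_int m * x + of_int n)"
    using linear_form_minimum[OF x S(2)] by blast
  obtain C where C: "C > 0" "\<And>v. v \<noteq> (0,0) \<Longrightarrow> norm (inverse (lin v x ^ 4)) \<le> C * majorant v"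
    using eisenstein_term_bound[of "Im x" "\<bar>Re x\<bar>" 4] x by auto
  obtain C6 where C6: "C6 > 0" "\<And>v. v \<noteq> (0,0) \<Longrightarrow> norm (inverse (lin v x ^ 6)) \<le> C6 * majorant v"
    using eisenstein_term_bound[of "Im x" "\<bar>Re x\<bar>" 6] x by auto
  have "\<exists>j\<ge>3. (\<Sum>\<^sub>\<infinity>v\<in>S. y v ^ j) \<noteq> 0"
  proof (rule moments_not_all_zero)
    show "(\<lambda>v. norm (y v ^ 3)) summable_on S"
    proof (rule summable_on_comparison_test)
      show "(\<lambda>v. C6 * majorant v) summable_on S" by (intro summable_on_cmult_right majorant_summable)
      fix v assume "v \<in> S"
      then show "norm (y v ^ 3) \<le> C6 * majorant v"
        using S0 C6(2)[of v] by (auto simp: y_def power_inverse simp flip: power_mult)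
    qed simp
    show "(c, d) \<in> S" by fact
    show "y (c, d) \<noteq> 0" using nz[OF cd] by (simp add: y_def)
    show "norm (y v) \<le> norm (y (c, d))" if "v \<in> S" for v
      using min[of "fst v" "snd v"] that nz[OF cd]
      by (auto simp: y_def norm_inverse norm_power lin_def intro!: le_imp_inverse_le power_mono)
    show "finite {v \<in> S. norm (y v) \<ge> r}" if r: "r > 0" for r
    proof -
      \<comment> \<open>Squaring \<open>norm (y v)\<close> >= r gives a lower bound for a term of
        weight 4, and hence for \<open>majorant v\<close>.\<close>
      define e where "e = r\<^sup>2 / C"
      have e: "e > 0" using r C by (simp add: e_def)
      define b where "b = \<lceil>1 / e\<rceil>"
      have "{v \<in> S. norm (y v) \<ge> r} \<subseteq> {-b..b} \<times> {-b..b}"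
      proof
        fix v assume v: "v \<in> {v \<in> S. norm (y v) \<ge> r}"
        then have "r\<^sup>2 \<le> (norm (y v))\<^sup>2" using r by (intro power_mono) auto
        also have "\<dots> = norm (inverse (lin v x ^ 4))"
          by (simp add: y_def norm_inverse norm_power power_inverse flip: power_mult)
        also have "\<dots> \<le> C * majorant v" using v S0 by (intro C) auto
        finally have m: "e \<le> majorant v" using C by (simp add: e_def field_simps)
        define s t where "s = \<bar>of_int (fst v) :: real\<bar>" and "t = \<bar>of_int (snd v) :: real\<bar>"
        have st: "s \<ge> 0" "t \<ge> 0" by (auto simp: s_def t_def)
        have mst: "majorant v = inverse ((1 + s)\<^sup>2 * (1 + t)\<^sup>2)" by (simp add: majorant_def s_def t_def)
        have pos: "(1 + s)\<^sup>2 * (1 + t)\<^sup>2 > 0" using st by (simp add: add_pos_nonneg)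
        have le: "(1 + s)\<^sup>2 * (1 + t)\<^sup>2 \<le> 1 / e" using m e pos unfolding mst by (simp add: field_simps)
        have "s * 1 \<le> (1 + s)\<^sup>2 * (1 + t)\<^sup>2" "1 * t \<le> (1 + s)\<^sup>2 * (1 + t)\<^sup>2"
          using st by (intro mult_mono; simp add: power2_eq_square algebra_simps)+
        then have "s \<le> 1 / e" "t \<le> 1 / e" using le by auto
        then have "\<bar>fst v\<bar> \<le> b" "\<bar>snd v\<bar> \<le> b" unfolding b_def s_def t_def by linarith+
        then show "v \<in> {-b..b} \<times> {-b..b}" by (cases v) auto
      qed
      then show ?thesis by (rule finite_subset) auto
    qed
  qed
  then obtain j where j: "j \<ge> 3" "(\<Sum>\<^sub>\<infinity>v\<in>S. y v ^ j) \<noteq> 0" by blast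
  moreover have "(\<Sum>\<^sub>\<infinity>v\<in>S. y v ^ j) = eisenstein S (2 * j) x"
    unfolding eisenstein_def y_def by (simp add: power_inverse power_mult)
  ultimately show ?thesis by (intro exI[of _ "2 * j"]) auto
qed

section \<open>Expansions at a cusp\<close>

lemma has_q_expansion_qpar:
  "has_q_expansion f w F \<longleftrightarrow> fls_conv_radius F > 0 \<and> (\<exists>Y. \<forall>z. Im z > Y \<longrightarrow> f z = eval_fls F (qpar w z))"
  by (simp add: has_q_expansion_def qpar_def)

lemma has_q_expansionI:
  assumes g: "g has_laurent_expansion F" and w: "w > 0" and eq: "\<And>z. Im z > Y \<Longrightarrow> f z = g (qpar w z)"
  shows "has_q_expansion f w F"
proof -
  obtain e where e: "e > 0" "\<And>q. q \<noteq> 0 \<Longrightarrow> norm q < e \<Longrightarrow> eval_fls F q = g q"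
    using g unfolding has_laurent_expansion_def eventually_at by (auto simp: dist_norm)
  obtain Y' where "\<And>z. Im z > Y' \<Longrightarrow> norm (qpar w z) < e" using qpar_small[OF w e(1)] by metis
  then have "\<forall>z. Im z > max Y Y' \<longrightarrow> f z = eval_fls F (qpar w z)" using e(2) eq by simp
  then show ?thesis using g unfolding has_q_expansion_qpar has_laurent_expansion_def by blast
qed

lemma has_q_expansion_unique:
  assumes w: "w > 0" and "has_q_expansion f w F" "has_q_expansion f w G"
  shows "F = G"
proof -
  from assms obtain Y Y' where F: "fls_conv_radius F > 0" "\<And>z. Im z > Y \<Longrightarrow> f z = eval_fls F (qpar w z)"
    and G: "fls_conv_radius G > 0" "\<And>z. Im z > Y' \<Longrightarrow> f z = eval_fls G (qpar w z)"
    unfolding has_q_expansion_qpar by blast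
  obtain r where r: "r > 0" "\<And>z. norm (qpar w z) < r \<Longrightarrow> Im z > max Y Y'"
    using qpar_large[OF w, of "max Y Y'"] by metis
  have "eval_fls F q = eval_fls G q" if "q \<noteq> 0" "norm q < r" for q
  proof -
    obtain z where z: "qpar w z = q" using qpar_surj[OF w \<open>q \<noteq> 0\<close>] by blast
    then have "Im z > max Y Y'" using r(2) that by blast
    then show ?thesis using F(2)[of z] G(2)[of z] z by simp
  qed
  then have "\<forall>\<^sub>F q in at 0. eval_fls F q = eval_fls G q"
    unfolding eventually_at using r(1) by (auto simp: dist_norm)
  then have "eval_fls G has_laurent_expansion F"
    using F(1) by (simp add: has_laurent_expansion_def)
  then show ?thesis using eval_fls_has_laurent_expansion[OF G(1)] by (rule has_laurent_expansion_unique)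
qed

lemma q_expansion_eqI: "has_q_expansion f 1 F \<Longrightarrow> q_expansion f = F"
  unfolding q_expansion_def using has_q_expansion_unique[of 1 f] by (intro the_equality) auto

lemma has_q_expansion_tendsto:
  assumes "has_q_expansion f w F" "w > 0" "fls_subdegree F \<ge> 0"
  shows "(f \<longlongrightarrow> fls_nth F 0) at_cusp"
proof -
  obtain Y where F: "fls_conv_radius F > 0" "\<And>z. Im z > Y \<Longrightarrow> f z = eval_fls F (qpar w z)"
    using assms(1) unfolding has_q_expansion_qpar by blast
  have "(eval_fls F \<longlongrightarrow> fls_nth F 0) (at 0)"
    using has_laurent_expansion_imp_tendsto_0[OF eval_fls_has_laurent_expansion[OF F(1)] assms(3)] .
  then have "((\<lambda>z. eval_fls F (qpar w z)) \<longlongrightarrow> fls_nth F 0) at_cusp"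
    using filterlim_compose filterlim_qpar[OF assms(2)] by blast
  moreover have "\<forall>\<^sub>F z in at_cusp. eval_fls F (qpar w z) = f z"
    using eventually_at_cusp_gt[of Y] by eventually_elim (simp add: F(2))
  ultimately show ?thesis by (rule Lim_transform_eventually)
qed

lemma tendsto_bdd_at_cusp:
  assumes "(f \<longlongrightarrow> c) at_cusp" shows "bdd_at_cusp f"
proof -
  have "\<forall>\<^sub>F z in at_cusp. dist (f z) c < 1" using assms by (rule tendstoD) simp
  then obtain Y where "\<And>z. Im z > Y \<Longrightarrow> dist (f z) c < 1" unfolding eventually_at_cusp by blast
  then show ?thesis
    by (intro bdd_at_cuspI[of Y _ "norm c + 1"]) (metis add.commute dist_norm less_imp_le norm_triangle_sub order.strict_trans1 add_strict_left_mono)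
qed

lemma has_q_expansion_filterlim:
  assumes "has_q_expansion f w F" "w > 0" "fls_subdegree F < 0"
  shows "filterlim f at_infinity at_cusp"
proof -
  obtain Y where F: "fls_conv_radius F > 0" "\<And>z. Im z > Y \<Longrightarrow> f z = eval_fls F (qpar w z)"
    using assms(1) unfolding has_q_expansion_qpar by blast
  have "filterlim (eval_fls F) at_infinity (at 0)"
    using has_laurent_expansion_imp_filterlim_infinity_0[OF eval_fls_has_laurent_expansion[OF F(1)] assms(3)] .
  then have "filterlim (\<lambda>z. eval_fls F (qpar w z)) at_infinity at_cusp"
    using filterlim_compose filterlim_qpar[OF assms(2)] by blast
  moreover have ev: "\<forall>\<^sub>F z in at_cusp. eval_fls F (qpar w z) = f z"
    using eventually_at_cusp_gt[of Y] by eventually_elim (simp add: F(2))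
  ultimately show ?thesis using iffD1[OF filterlim_cong[OF refl refl ev]] by blast
qed

section \<open>Hauptmoduln are regular away from infinity\<close>

text \<open>By degrees: either the denominator wins, or the function is eventually bounded away from
  0. In \<open>quot_rational\<close> the second case contradicts the vanishing of the quotient at
  infinity.\<close>

lemma rational_function_at_infinity:
  fixes P Q :: "complex poly"
  assumes "Q \<noteq> 0"
  shows "((\<lambda>w. poly P w / poly Q w) \<longlongrightarrow> 0) at_infinity \<or>
    (\<exists>c>0. \<forall>\<^sub>F w in at_infinity. norm (poly P w / poly Q w) \<ge> c)"
proof (cases "degree P < degree Q \<or> P = 0")
  case True
  then show ?thesis using poly_divide_tendsto_0_at_infinity[of P Q] by auto
next
  case False
  define p q where "p = degree P" "q = degree Q"
  define l where "l = lead_coeff P / lead_coeff Q"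
  have l: "l \<noteq> 0" using False assms by (simp add: l_def)
  have "((\<lambda>w. (poly P w / w ^ p) / (poly Q w / w ^ q)) \<longlongrightarrow> l) at_infinity"
    unfolding l_def p_q_def using assms by (intro tendsto_divide poly_divide_tendsto_aux) auto
  then have "((\<lambda>w. norm ((poly P w / w ^ p) / (poly Q w / w ^ q))) \<longlongrightarrow> norm l) at_infinity"
    by (rule tendsto_norm)
  then have "\<forall>\<^sub>F w in at_infinity. norm ((poly P w / w ^ p) / (poly Q w / w ^ q)) > norm l / 2"
    by (rule order_tendstoD) (use l in auto)
  moreover have "\<forall>\<^sub>F w in at_infinity. norm (w :: complex) \<ge> 1"
    unfolding eventually_at_infinity by blast
  ultimately have "\<forall>\<^sub>F w in at_infinity. norm (poly P w / poly Q w) \<ge> norm l / 2"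
  proof eventually_elim
    case (elim w)
    have "w \<noteq> 0" using elim by auto
    have "q \<le> p" using False by (auto simp: p_q_def)
    have "poly P w / poly Q w = (poly P w / w ^ p) / (poly Q w / w ^ q) * w ^ (p - q)"
      using \<open>w \<noteq> 0\<close> \<open>q \<le> p\<close> by (simp add: power_diff)
    then have "norm (poly P w / poly Q w) = norm ((poly P w / w ^ p) / (poly Q w / w ^ q)) * norm w ^ (p - q)"
      by (metis norm_mult norm_power)
    moreover have "norm w ^ (p - q) \<ge> 1" using elim by simp
    moreover have "norm ((poly P w / w ^ p) / (poly Q w / w ^ q)) * 1 \<le>
        norm ((poly P w / w ^ p) / (poly Q w / w ^ q)) * norm w ^ (p - q)"
      by (intro mult_left_mono) (use elim in auto)
    ultimately show ?case using elim by linarith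
  qed
  then show ?thesis using l by (intro disjI2 exI[of _ "norm l / 2"]) auto
qed

lemma filterlim_act:
  assumes A: "A \<in> SL2Z" and z: "Im z > 0"
  shows "filterlim (act A) (at (act A z)) (at z)"
  unfolding filterlim_at
proof
  have "open {z. Im z > 0}" by (rule open_halfspace_Im_gt)
  have hol: "act A holomorphic_on {z. Im z > 0}" using A by (intro act_holomorphic) (simp add: SL2Z_det)
  have "isCont (act A) z"
    using holomorphic_on_imp_continuous_on[OF hol] \<open>open _\<close> z by (simp add: continuous_on_eq_continuous_at)
  then show "(act A \<longlongrightarrow> act A z) (at z)" by (simp add: isCont_def)
  have "\<forall>\<^sub>F w in at z. w \<in> {z. Im z > 0} - {z}"
    using \<open>open _\<close> z by (intro eventually_at_in_open) auto
  then show "\<forall>\<^sub>F w in at z. act A w \<in> UNIV \<and> act A w \<noteq> act A z"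
  proof eventually_elim
    case (elim w)
    then show ?case using act_adj(2)[OF A, of w] act_adj(2)[OF A z] by auto
  qed
qed

text \<open>What \<open>Gamma0 N\<close> and the group generated by \<open>Gamma1 N\<close> and -1
  have in common. Closure under negation makes v and -v behave alike; \<open>swap_notin\<close> says
  that the cusp 0 is inequivalent to infinity and supplies the pair (1, 0) for
  \<open>other_pairs_nonempty\<close>.\<close>

locale modular_group =
  fixes G :: "(int^2^2) set" and N :: nat
  assumes N_pos: "N > 0" and Gamma1_le: "Gamma1 N \<subseteq> G" and le_SL2Z: "G \<subseteq> SL2Z"
    and mult_mem: "A \<in> G \<Longrightarrow> B \<in> G \<Longrightarrow> A ** B \<in> G"
    and adj_mem: "A \<in> G \<Longrightarrow> adj A \<in> G"
    and uminus_mem: "A \<in> G \<Longrightarrow> - A \<in> G"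
    and swap_notin: "A \<in> G \<Longrightarrow> (A$2$1, A$2$2) \<noteq> (1, 0)"
begin

text \<open>The pairs which, as cusps \<open>- n / m\<close>, are inequivalent to infinity.\<close>

definition other_pairs :: "(int \<times> int) set" where
  "other_pairs = {v \<in> coprime_pairs. \<forall>A\<in>G. (A$2$1, A$2$2) \<noteq> v}"

lemma other_pairs_le: "other_pairs \<subseteq> coprime_pairs"
  by (auto simp: other_pairs_def)

lemma mem_SL2Z: "A \<in> G \<Longrightarrow> A \<in> SL2Z"
  using le_SL2Z by blast

lemma vmul_row: "vmul (A$2$1, A$2$2) B = ((A ** B)$2$1, (A ** B)$2$2)" for A :: "int^2^2"
  by (simp add: vmul_def)

lemma vmul_other_pairs:
  assumes A: "A \<in> G" and v: "v \<in> other_pairs"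
  shows "vmul v A \<in> other_pairs"
proof -
  have "vmul v A \<in> coprime_pairs" using v A mem_SL2Z by (auto simp: other_pairs_def intro: vmul_coprime)
  moreover have "(B$2$1, B$2$2) \<noteq> vmul v A" if B: "B \<in> G" for B
  proof
    assume "(B$2$1, B$2$2) = vmul v A"
    then have "vmul (B$2$1, B$2$2) (adj A) = v" using vmul_adj(1)[OF mem_SL2Z[OF A]] by simp
    then have "((B ** adj A)$2$1, (B ** adj A)$2$2) = v" by (simp only: vmul_row)
    moreover have "B ** adj A \<in> G" using A B by (intro mult_mem adj_mem)
    ultimately show False using v unfolding other_pairs_def by blast
  qed
  ultimately show ?thesis by (auto simp: other_pairs_def)
qed

lemma other_pairs_image:
  assumes "A \<in> G" shows "(\<lambda>v. vmul v A) ` other_pairs = other_pairs"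
proof
  show "(\<lambda>v. vmul v A) ` other_pairs \<subseteq> other_pairs" using vmul_other_pairs[OF assms] by blast
  show "other_pairs \<subseteq> (\<lambda>v. vmul v A) ` other_pairs"
  proof
    fix v assume "v \<in> other_pairs"
    then have "vmul v (adj A) \<in> other_pairs" using vmul_other_pairs adj_mem assms by blast
    then show "v \<in> (\<lambda>v. vmul v A) ` other_pairs" using vmul_image_iff[OF mem_SL2Z[OF assms]] by blast
  qed
qed

text \<open>The index set of the series after transport to the cusp B infinity
  (\<open>eisenstein_other_act\<close>).\<close>

definition pairs_at :: "int^2^2 \<Rightarrow> (int \<times> int) set" where
  "pairs_at B = (\<lambda>v. vmul v B) ` other_pairs"

lemma pairs_at_le: "B \<in> SL2Z \<Longrightarrow> pairs_at B \<subseteq> coprime_pairs"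
  unfolding pairs_at_def using vmul_coprime other_pairs_le by blast

text \<open>Conjugating the translation by N with \<open>B\<close> gives an element of
  \<open>Gamma1 N\<close>, hence of \<open>G\<close>, and \<open>G\<close> preserves
  \<open>other_pairs\<close>.\<close>

lemma pairs_at_periodic:
  assumes B: "B \<in> SL2Z"
  shows "(m, n) \<in> pairs_at B \<longleftrightarrow> (m, n + m * int N) \<in> pairs_at B"
proof -
  let ?T = "mat2 1 (int N) 0 1"
  let ?C = "(B ** ?T) ** adj B"
  have T: "?T \<in> SL2Z" by (simp add: SL2Z_iff)
  have C: "?C \<in> G"
  proof -
    have "?C \<in> Gamma1 N" by (rule Gamma1_cosets) (use B T in \<open>auto intro: SL2Z_mult\<close>)
    then show ?thesis using Gamma1_le by blast
  qed
  have "vmul (m, n) (adj B) \<in> other_pairs \<longleftrightarrow> vmul (vmul (m, n) (adj B)) ?C \<in> other_pairs"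
    using vmul_other_pairs[OF C] vmul_other_pairs[OF adj_mem[OF C]] vmul_adj(1)[OF mem_SL2Z[OF C]] by metis
  also have "vmul (vmul (m, n) (adj B)) ?C = vmul (vmul (vmul (m, n) (adj B ** B)) ?T) (adj B)"
    by (simp only: vmul_vmul matrix_mul_assoc)
  also have "vmul (vmul (m, n) (adj B ** B)) ?T = (m, n + m * int N)"
    using B by (simp add: adj_left) (simp add: vmul_def add.commute)
  finally show ?thesis unfolding pairs_at_def by (simp only: vmul_image_iff[OF B])
qed

text \<open>Moved back by the inverse of \<open>B\<close>, the pair (0, 1) becomes the bottom row of
  that inverse. An element of \<open>G\<close> with the same bottom row differs from it by a factor
  in \<open>Gamma1 N\<close>. So the constant term is nonzero exactly when \<open>B\<close> is not
  in \<open>G\<close>.\<close>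

lemma pairs_at_iff:
  assumes B: "B \<in> SL2Z"
  shows "(0, 1) \<in> pairs_at B \<longleftrightarrow> B \<notin> G" "(0, -1) \<in> pairs_at B \<longleftrightarrow> B \<notin> G"
proof -
  have cop: "(- (B$2$1), B$1$1) \<in> coprime_pairs" "(B$2$1, - (B$1$1)) \<in> coprime_pairs"
    using SL2Z_coprime(2)[OF B] by (auto simp: coprime_pairs_def coprime_commute)
  have *: "B \<in> G \<longleftrightarrow> (\<exists>A\<in>G. A$2$1 = - (B$2$1) \<and> A$2$2 = B$1$1)"
  proof
    assume "B \<in> G"
    then show "\<exists>A\<in>G. A$2$1 = - (B$2$1) \<and> A$2$2 = B$1$1"
      using adj_mem by (intro bexI[of _ "adj B"]) auto
  next
    assume "\<exists>A\<in>G. A$2$1 = - (B$2$1) \<and> A$2$2 = B$1$1"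
    then obtain A where A: "A \<in> G" "A$2$1 = - (B$2$1)" "A$2$2 = B$1$1" by blast
    then have "A ** adj (adj B) \<in> Gamma1 N"
      using B mem_SL2Z by (intro Gamma1_cosets SL2Z_adj) auto
    then have "A ** B \<in> G" using Gamma1_le by auto
    then have "adj A ** (A ** B) \<in> G" by (rule mult_mem[OF adj_mem[OF A(1)]])
    moreover have "adj A ** (A ** B) = B"
      using adj_left[OF mem_SL2Z[OF A(1)]] by (metis matrix_mul_assoc matrix_mul_lid)
    ultimately show "B \<in> G" by simp
  qed
  show "(0, 1) \<in> pairs_at B \<longleftrightarrow> B \<notin> G"
    unfolding pairs_at_def vmul_image_iff[OF B] using cop
    by (auto simp: vmul_def other_pairs_def *)
  have **: "B \<in> G \<longleftrightarrow> (\<exists>A\<in>G. A$2$1 = B$2$1 \<and> A$2$2 = - (B$1$1))"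
  proof -
    have "(\<exists>A\<in>G. A$2$1 = - (B$2$1) \<and> A$2$2 = B$1$1) \<longleftrightarrow> (\<exists>A\<in>G. A$2$1 = B$2$1 \<and> A$2$2 = - (B$1$1))"
    proof safe
      fix A assume "A \<in> G" "A$2$1 = - (B$2$1)" "A$2$2 = B$1$1"
      then show "\<exists>A\<in>G. A$2$1 = B$2$1 \<and> A$2$2 = - (B$1$1)"
        using uminus_mem by (intro bexI[of _ "-A"]) auto
    next
      fix A assume "A \<in> G" "A$2$1 = B$2$1" "A$2$2 = - (B$1$1)"
      then show "\<exists>A\<in>G. A$2$1 = - (B$2$1) \<and> A$2$2 = B$1$1"
        using uminus_mem by (intro bexI[of _ "-A"]) auto
    qed
    then show ?thesis using * by simp
  qed
  show "(0, -1) \<in> pairs_at B \<longleftrightarrow> B \<notin> G"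
    unfolding pairs_at_def vmul_image_iff[OF B] using cop
    by (auto simp: vmul_def other_pairs_def **)
qed

lemma pairs_at_card:
  assumes B: "B \<in> SL2Z"
  shows "card (pairs_at B \<inter> {(0,1), (0,-1)}) = (if B \<in> G then 0 else 2)"
proof -
  have "pairs_at B \<inter> {(0,1), (0,-1)} = (if B \<in> G then {} else {(0,1), (0,-1)})"
    using pairs_at_iff[OF B] by auto
  then show ?thesis by simp
qed

lemma one_mem: "mat 1 \<in> G"
  using Gamma1_le SL2Z_one by (auto simp: Gamma1_def Gamma0_def)

lemma pairs_at_one: "pairs_at (mat 1) = other_pairs"
  by (simp add: pairs_at_def)

lemma other_pairs_nonempty: "other_pairs \<noteq> {}"
proof -
  have "(1, 0) \<in> other_pairs" unfolding other_pairs_def coprime_pairs_def using swap_notin by auto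
  then show ?thesis by blast
qed

section \<open>Quotients of weight zero in the function field\<close>

context
  fixes k :: nat assumes k: "k \<ge> 6" "even k"
begin

lemma coprime_pairs_cusp:
  "(eisenstein coprime_pairs k \<longlongrightarrow> 2) at_cusp"
  "Im z > 0 \<Longrightarrow> eisenstein coprime_pairs k (z + of_nat N) = eisenstein coprime_pairs k z"
  "bdd_at_cusp (eisenstein coprime_pairs k)"
proof -
  have per: "(m, n) \<in> coprime_pairs \<longleftrightarrow> (m, n + m * int N) \<in> coprime_pairs" for m n
  proof -
    have "gcd m (n + m * int N) = gcd m n" using gcd_add_mult[of m "int N" n]
      by (simp add: add.commute mult.commute)
    then show ?thesis by (simp add: coprime_pairs_def coprime_iff_gcd_eq_1)
  qed
  have "coprime_pairs \<inter> {(0,1), (0,-1)} = {(0,1), (0,-1)}" by (auto simp: coprime_pairs_def)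
  then have card: "card (coprime_pairs \<inter> {(0,1), (0,-1)}) = 2" by simp
  show "(eisenstein coprime_pairs k \<longlongrightarrow> 2) at_cusp"
    using eisenstein_at_cusp(1)[OF order_refl N_pos _ k(2) per] k(1) card by simp
  show "Im z > 0 \<Longrightarrow> eisenstein coprime_pairs k (z + of_nat N) = eisenstein coprime_pairs k z"
    using eisenstein_at_cusp(2)[OF order_refl N_pos _ k(2) per] k(1) by simp
  show "bdd_at_cusp (eisenstein coprime_pairs k)"
    using eisenstein_at_cusp(3)[OF order_refl N_pos _ k(2) per] k(1) by simp
qed

lemma pairs_at_cusp:
  assumes B: "B \<in> SL2Z"
  shows "(eisenstein (pairs_at B) k \<longlongrightarrow> (if B \<in> G then 0 else 2)) at_cusp"
    "Im z > 0 \<Longrightarrow> eisenstein (pairs_at B) k (z + of_nat N) = eisenstein (pairs_at B) k z"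
    "bdd_at_cusp (eisenstein (pairs_at B) k)"
proof -
  note * = eisenstein_at_cusp[OF pairs_at_le[OF B] N_pos _ k(2) pairs_at_periodic[OF B]]
  show "(eisenstein (pairs_at B) k \<longlongrightarrow> (if B \<in> G then 0 else 2)) at_cusp"
    using *(1) k(1) pairs_at_card[OF B] by (auto split: if_splits)
  show "Im z > 0 \<Longrightarrow> eisenstein (pairs_at B) k (z + of_nat N) = eisenstein (pairs_at B) k z"
    "bdd_at_cusp (eisenstein (pairs_at B) k)"
    using *(2,3) k(1) by simp_all
qed

text \<open>The denominator has level one and is nonzero at all cusps, but may vanish inside the
  half plane; the element of the function field is therefore
  \<open>remove_sings quot\<close>.\<close>

definition quot :: "complex \<Rightarrow> complex" where
  "quot z = eisenstein other_pairs k z / eisenstein coprime_pairs k z"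

lemma eisenstein_coprime_act:
  assumes "B \<in> SL2Z" "Im z > 0"
  shows "eisenstein coprime_pairs k (act B z) = aut B z ^ k * eisenstein coprime_pairs k z"
  using eisenstein_act[OF assms, of coprime_pairs k] vmul_coprime_image[OF assms(1)] by simp

lemma eisenstein_other_act:
  assumes "B \<in> SL2Z" "Im z > 0"
  shows "eisenstein other_pairs k (act B z) = aut B z ^ k * eisenstein (pairs_at B) k z"
  using eisenstein_act[OF assms, of other_pairs k] by (simp add: pairs_at_def)

lemma quot_act:
  assumes "B \<in> SL2Z" "Im z > 0"
  shows "quot (act B z) = eisenstein (pairs_at B) k z / eisenstein coprime_pairs k z"
proof -
  have "aut B z \<noteq> 0" using aut_nonzero[of z B] assms by (simp add: SL2Z_det)
  then show ?thesis using assms by (simp add: quot_def eisenstein_other_act eisenstein_coprime_act)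
qed

lemma quot_invariant:
  assumes "B \<in> G" "Im z > 0" shows "quot (act B z) = quot z"
  using quot_act[OF mem_SL2Z assms(2), of B] assms other_pairs_image by (simp add: pairs_at_def quot_def)

lemma holomorphic_other: "eisenstein other_pairs k holomorphic_on {z. Im z > 0}"
  by (rule eisenstein_holomorphic) (use other_pairs_le k in auto)

lemma holomorphic_pairs_at:
  assumes "B \<in> SL2Z" shows "eisenstein (pairs_at B) k holomorphic_on {z. Im z > 0}"
  by (rule eisenstein_holomorphic) (use pairs_at_le[OF assms] k in auto)

lemma holomorphic_coprime: "eisenstein coprime_pairs k holomorphic_on {z. Im z > 0}"
  by (rule eisenstein_holomorphic) (use k in auto)

lemma quot_meromorphic: "quot meromorphic_on upper_half_plane"
proof -
  have op: "open {z. Im z > 0}" by (rule open_halfspace_Im_gt)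
  have "eisenstein other_pairs k analytic_on upper_half_plane" "eisenstein coprime_pairs k analytic_on upper_half_plane"
    using holomorphic_other holomorphic_coprime op
    by (simp_all add: upper_half_plane_def analytic_on_open)
  then show ?thesis unfolding quot_def[abs_def]
    by (intro meromorphic_on_divide analytic_on_imp_meromorphic_on)
qed

lemma coprime_eventually_nonzero: "\<forall>\<^sub>F z in at_cusp. eisenstein coprime_pairs k z \<noteq> 0"
  using coprime_pairs_cusp(1) by (rule tendsto_imp_eventually_ne) simp

lemma quot_cusp:
  assumes B: "B \<in> SL2Z"
  shows "\<exists>F. has_q_expansion (remove_sings quot \<circ> act B) N F"
proof -
  obtain g1 where g1: "g1 holomorphic_on ball 0 1" "\<And>z. Im z > 0 \<Longrightarrow> eisenstein (pairs_at B) k z = g1 (qpar N z)"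
    using qpar_function[OF N_pos holomorphic_pairs_at[OF B]] pairs_at_cusp[OF B] by blast
  obtain g2 where g2: "g2 holomorphic_on ball 0 1" "\<And>z. Im z > 0 \<Longrightarrow> eisenstein coprime_pairs k z = g2 (qpar N z)"
    using qpar_function[OF N_pos holomorphic_coprime] coprime_pairs_cusp by blast
  have an: "g1 analytic_on {0}" "g2 analytic_on {0}"
    using g1(1) g2(1) by (auto simp: analytic_at intro: exI[of _ "ball 0 1"])
  then have "(\<lambda>q. g1 q / g2 q) has_laurent_expansion
      fps_to_fls (fps_expansion g1 0) / fps_to_fls (fps_expansion g2 0)"
    by (intro laurent_expansion_intros has_laurent_expansion_fps analytic_at_imp_has_fps_expansion_0)
  moreover obtain Y where Y: "\<And>z. Im z > Y \<Longrightarrow> eisenstein coprime_pairs k z \<noteq> 0"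
    using coprime_eventually_nonzero unfolding eventually_at_cusp by blast
  \<comment> \<open>Above \<open>Y\<close> the denominator has no zeros, also after applying
    \<open>B\<close>, so \<open>remove_sings\<close> changes nothing there.\<close>
  have "(remove_sings quot \<circ> act B) z = g1 (qpar N z) / g2 (qpar N z)" if "Im z > max Y 0" for z
  proof -
    have z: "Im z > 0" "eisenstein coprime_pairs k z \<noteq> 0" using that Y by auto
    let ?w = "act B z"
    have w: "Im ?w > 0" using z B by (intro Im_act_pos) (auto simp: SL2Z_det)
    have "aut B z \<noteq> 0" using aut_nonzero[of z B] z B by (simp add: SL2Z_det)
    then have "eisenstein coprime_pairs k ?w \<noteq> 0" using z B by (simp add: eisenstein_coprime_act)
    moreover have "eisenstein other_pairs k analytic_on {?w}" "eisenstein coprime_pairs k analytic_on {?w}"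
      using holomorphic_other holomorphic_coprime w open_halfspace_Im_gt[of 0]
      by (auto simp: analytic_at)
    ultimately have "quot analytic_on {?w}" unfolding quot_def[abs_def] by (intro analytic_intros) auto
    then have "remove_sings quot ?w = quot ?w" by simp
    then show ?thesis using quot_act[OF B z(1)] g1(2)[OF z(1)] g2(2)[OF z(1)] by simp
  qed
  ultimately show ?thesis using has_q_expansionI[OF _ N_pos] by blast
qed

lemma remove_sings_quot_tendsto:
  assumes A: "A \<in> G" and z: "Im z > 0" and lim: "(quot \<longlongrightarrow> c) (at (act A z))"
  shows "(quot \<longlongrightarrow> c) (at z)"
proof -
  have "((\<lambda>w. quot (act A w)) \<longlongrightarrow> c) (at z)"
    using filterlim_compose[OF lim filterlim_act[OF mem_SL2Z[OF A] z]] .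
  moreover have "\<forall>\<^sub>F w in at z. w \<in> {z. Im z > 0}"
    using z by (intro eventually_at_in_open' open_halfspace_Im_gt) auto
  then have "\<forall>\<^sub>F w in at z. quot (act A w) = quot w"
    by eventually_elim (use quot_invariant[OF A] in auto)
  ultimately show ?thesis by (rule Lim_transform_eventually)
qed

text \<open>\<open>remove_sings\<close> is determined by limits, which \<open>act A\<close> carries
  over in both directions; where there is no limit both sides are 0 by convention.\<close>

lemma remove_sings_quot_act:
  assumes A: "A \<in> G" and z: "Im z > 0"
  shows "remove_sings quot (act A z) = remove_sings quot z"
proof -
  have *: "(quot \<longlongrightarrow> c) (at (act A z)) \<longleftrightarrow> (quot \<longlongrightarrow> c) (at z)" for c
  proof
    assume "(quot \<longlongrightarrow> c) (at z)"
    moreover have "Im (act A z) > 0" using A z by (intro Im_act_pos) (auto simp: SL2Z_det[OF mem_SL2Z])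
    ultimately show "(quot \<longlongrightarrow> c) (at (act A z))"
      using act_adj(2)[OF mem_SL2Z[OF A] z] by - (rule remove_sings_quot_tendsto[OF adj_mem[OF A]], auto)
  qed (rule remove_sings_quot_tendsto[OF A z])
  show ?thesis
  proof (cases "\<exists>c. (quot \<longlongrightarrow> c) (at z)")
    case True
    then obtain c where "(quot \<longlongrightarrow> c) (at z)" by blast
    then have "remove_sings quot z = c" "remove_sings quot (act A z) = c"
      using * by (auto intro: remove_sings_eqI)
    then show ?thesis by simp
  next
    case False
    then show ?thesis using * by (simp add: remove_sings_def)
  qed
qed

lemma modular_function_quot:
  assumes "\<Gamma> \<subseteq> G" shows "modular_function \<Gamma> (remove_sings quot)"
  unfolding modular_function_def
proof (intro conjI ballI)
  show "remove_sings quot nicely_meromorphic_on upper_half_plane"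
    by (rule remove_sings_nicely_meromorphic[OF quot_meromorphic])
  show "remove_sings quot (act A z) = remove_sings quot z" if "A \<in> \<Gamma>" "z \<in> upper_half_plane" for A z
    using that assms by (intro remove_sings_quot_act) auto
  show "\<exists>w>0. \<exists>F. has_q_expansion (remove_sings quot \<circ> act A) w F" if "A \<in> SL2Z" for A
    using quot_cusp[OF that] N_pos by blast
qed

text \<open>Since the quotient vanishes at infinity, where \<open>t\<close> has a pole, it is a rational function
  of \<open>t\<close> vanishing at infinity, and so vanishes at all other poles of \<open>t\<close>.\<close>

lemma quot_rational:
  assumes \<Gamma>: "\<Gamma> \<subseteq> G" and t: "generates_function_field \<Gamma> t" and inf: "filterlim t at_infinity at_cusp"
  shows "\<exists>R. (R \<longlongrightarrow> 0) at_infinity \<and>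
    (\<forall>x. Im x > 0 \<longrightarrow> (\<forall>\<^sub>F z in at x. eisenstein other_pairs k z = R (t z) * eisenstein coprime_pairs k z))"
proof -
  obtain P Q where Q: "Q \<noteq> 0" and
    PQ: "\<forall>\<^sub>F z in cosparse upper_half_plane. remove_sings quot z = poly P (t z) / poly Q (t z)"
    using t modular_function_quot[OF \<Gamma>] unfolding generates_function_field_def by blast
  define R where "R = (\<lambda>w. poly P w / poly Q w)"
  have conn: "connected upper_half_plane" "open upper_half_plane"
    unfolding upper_half_plane_def
    by (auto intro: convex_connected convex_halfspace_Im_gt open_halfspace_Im_gt)
  have "eisenstein coprime_pairs k analytic_on upper_half_plane"
    using holomorphic_coprime conn by (simp add: upper_half_plane_def analytic_on_open)
  then have "(\<forall>z\<in>upper_half_plane. eisenstein coprime_pairs k z = 0) \<or>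
      (\<forall>\<^sub>F z in cosparse upper_half_plane. eisenstein coprime_pairs k z \<noteq> 0)"
    using conn by (intro nicely_meromorphic_imp_constant_or_avoid analytic_on_imp_nicely_meromorphic_on) auto
  moreover have "\<not> (\<forall>z\<in>upper_half_plane. eisenstein coprime_pairs k z = 0)"
  proof
    assume *: "\<forall>z\<in>upper_half_plane. eisenstein coprime_pairs k z = 0"
    have "\<forall>\<^sub>F z in at_cusp. False"
      using coprime_eventually_nonzero eventually_at_cusp_gt[of 0]
      by eventually_elim (use * in auto)
    then show False by simp
  qed
  ultimately have nz: "\<forall>\<^sub>F z in cosparse upper_half_plane. eisenstein coprime_pairs k z \<noteq> 0" by blast
  have good: "\<forall>\<^sub>F z in cosparse upper_half_plane. quot z = R (t z) \<and>
      eisenstein other_pairs k z = R (t z) * eisenstein coprime_pairs k z"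
    using PQ nz eventually_remove_sings_eq[OF quot_meromorphic]
    by eventually_elim (auto simp: R_def quot_def field_simps)
  have good_at: "\<forall>\<^sub>F z in at x. quot z = R (t z) \<and>
      eisenstein other_pairs k z = R (t z) * eisenstein coprime_pairs k z" if "Im x > 0" for x
    using eventually_cosparse_imp_eventually_at[OF good] that by simp
  have "(R \<longlongrightarrow> 0) at_infinity"
  proof (rule ccontr)
    assume "\<not> ?thesis"
    then obtain c where c: "c > 0" "\<forall>\<^sub>F w in at_infinity. norm (R w) \<ge> c"
      using rational_function_at_infinity[OF Q, of P] unfolding R_def by blast
    have "\<forall>\<^sub>F z in at_cusp. norm (R (t z)) \<ge> c"
      using eventually_compose_filterlim[OF c(2) inf] .
    moreover have "(quot \<longlongrightarrow> 0 / 2) at_cusp"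
      unfolding quot_def[abs_def] using pairs_at_cusp(1)[OF SL2Z_one] one_mem
      by (intro tendsto_divide coprime_pairs_cusp) (auto simp: pairs_at_one)
    then have "\<forall>\<^sub>F z in at_cusp. dist (quot z) 0 < c" using c(1) by (intro tendstoD) auto
    ultimately have "\<forall>\<^sub>F z in at_cusp. quot z \<noteq> R (t z)" by eventually_elim auto
    then obtain Y where Y: "\<And>z. Im z > Y \<Longrightarrow> quot z \<noteq> R (t z)" unfolding eventually_at_cusp by blast
    \<comment> \<open>The identity holds only off a discrete set, so the contradiction is drawn in a
      punctured neighbourhood of a point above \<open>Y\<close>.\<close>
    define x where "x = \<i> * of_real (max Y 0 + 1)"
    have x: "Im x > Y" "Im x > 0" by (auto simp: x_def)
    have "\<forall>\<^sub>F z in at x. z \<in> {z. Im z > Y}"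
      using x by (intro eventually_at_in_open' open_halfspace_Im_gt) auto
    with good_at[OF x(2)] have "\<forall>\<^sub>F z in at x. False" by eventually_elim (use Y in auto)
    then show False by simp
  qed
  moreover have "\<forall>\<^sub>F z in at x. eisenstein other_pairs k z = R (t z) * eisenstein coprime_pairs k z"
    if "Im x > 0" for x by (rule eventually_mono[OF good_at[OF that]]) auto
  ultimately show ?thesis by blast
qed

text \<open>Near a pole \<open>R (t z)\<close> tends to 0 while the level one series stays finite,
  so the numerator vanishes at \<open>x\<close>. With the denominator cleared, its own zeros need no
  separate case.\<close>

lemma no_pole:
  assumes \<Gamma>: "\<Gamma> \<subseteq> G" and t: "generates_function_field \<Gamma> t" and inf: "filterlim t at_infinity at_cusp"
    and x: "Im x > 0" and pole: "is_pole t x"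
  shows "eisenstein other_pairs k x = 0"
proof -
  obtain R where R: "(R \<longlongrightarrow> 0) at_infinity"
    "\<forall>\<^sub>F z in at x. eisenstein other_pairs k z = R (t z) * eisenstein coprime_pairs k z"
    using quot_rational[OF \<Gamma> t inf] x by blast
  have op: "open {z. Im z > 0}" by (rule open_halfspace_Im_gt)
  have cont: "isCont (eisenstein other_pairs k) x" "isCont (eisenstein coprime_pairs k) x"
    using holomorphic_other holomorphic_coprime x op
    by (auto dest!: holomorphic_on_imp_continuous_on simp: continuous_on_eq_continuous_at)
  have "((\<lambda>z. R (t z)) \<longlongrightarrow> 0) (at x)"
    using filterlim_compose[OF R(1)] pole unfolding is_pole_def by blast
  then have "((\<lambda>z. R (t z) * eisenstein coprime_pairs k z) \<longlongrightarrow> 0 * eisenstein coprime_pairs k x) (at x)"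
    using cont(2) by (intro tendsto_mult) (auto simp: isCont_def)
  moreover have "\<forall>\<^sub>F z in at x. R (t z) * eisenstein coprime_pairs k z = eisenstein other_pairs k z"
    using R(2) by eventually_elim simp
  ultimately have "(eisenstein other_pairs k \<longlongrightarrow> 0 * eisenstein coprime_pairs k x) (at x)"
    by (rule Lim_transform_eventually)
  then show ?thesis using cont(1) LIM_unique unfolding isCont_def by fastforce
qed

text \<open>At a cusp inequivalent to infinity the transported numerator tends to 2, by
  \<open>pairs_at_cusp\<close>, whereas a pole of \<open>t\<close> would make it tend to 0.\<close>

lemma no_pole_cusp:
  assumes \<Gamma>: "\<Gamma> \<subseteq> G" and t: "generates_function_field \<Gamma> t" and inf: "filterlim t at_infinity at_cusp"
    and B: "B \<in> SL2Z" "B \<notin> G"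
  shows "\<not> filterlim (t \<circ> act B) at_infinity at_cusp"
proof
  assume pole: "filterlim (t \<circ> act B) at_infinity at_cusp"
  obtain R where R: "(R \<longlongrightarrow> 0) at_infinity"
    "\<And>x. Im x > 0 \<Longrightarrow> \<forall>\<^sub>F z in at x. eisenstein other_pairs k z = R (t z) * eisenstein coprime_pairs k z"
    using quot_rational[OF \<Gamma> t inf] by blast
  have "((\<lambda>z. R ((t \<circ> act B) z)) \<longlongrightarrow> 0) at_cusp" using filterlim_compose[OF R(1) pole] .
  then have "((\<lambda>z. R ((t \<circ> act B) z) * eisenstein coprime_pairs k z) \<longlongrightarrow> 0 * 2) at_cusp"
    by (intro tendsto_mult coprime_pairs_cusp)
  then have "((\<lambda>z. eisenstein (pairs_at B) k z - R ((t \<circ> act B) z) * eisenstein coprime_pairs k z) \<longlongrightarrow> 2 - 0 * 2) at_cusp"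
    using pairs_at_cusp(1)[OF B(1)] B(2) by (intro tendsto_diff) auto
  then have "\<forall>\<^sub>F z in at_cusp. eisenstein (pairs_at B) k z - R ((t \<circ> act B) z) * eisenstein coprime_pairs k z \<noteq> 0"
    by (rule tendsto_imp_eventually_ne) simp
  then obtain Y where Y: "\<And>z. Im z > Y \<Longrightarrow> eisenstein (pairs_at B) k z \<noteq> R ((t \<circ> act B) z) * eisenstein coprime_pairs k z"
    unfolding eventually_at_cusp by auto
  define x where "x = \<i> * of_real (max Y 0 + 1)"
  have x: "Im x > Y" "Im x > 0" by (auto simp: x_def)
  have "Im (act B x) > 0" using B x by (intro Im_act_pos) (auto simp: SL2Z_det)
  from eventually_compose_filterlim[OF R(2)[OF this] filterlim_act[OF B(1) x(2)]]
  have "\<forall>\<^sub>F z in at x. eisenstein other_pairs k (act B z) = R (t (act B z)) * eisenstein coprime_pairs k (act B z)" .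
  moreover have "\<forall>\<^sub>F z in at x. z \<in> {z. Im z > max Y 0}"
    using x by (intro eventually_at_in_open' open_halfspace_Im_gt) auto
  ultimately have "\<forall>\<^sub>F z in at x. False"
  proof eventually_elim
    case (elim z)
    have z: "Im z > 0" "Im z > Y" using elim by auto
    have "aut B z \<noteq> 0" using aut_nonzero[of z B] z B by (simp add: SL2Z_det)
    then have "eisenstein (pairs_at B) k z = R (t (act B z)) * eisenstein coprime_pairs k z"
      using elim(1) by (simp add: eisenstein_other_act[OF B(1) z(1)] eisenstein_coprime_act[OF B(1) z(1)])
    then show False using Y[OF z(2)] by simp
  qed
  then show False by simp
qed

end

text \<open>A pole in the half plane would be a common zero of the numerators of all even weights
  from 6 on, against \<open>eisenstein_nonzero\<close>. At the other cusps weight 6 alone suffices,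
  and an expansion without polar terms gives a limit.\<close>

theorem hauptmodul_holomorphic:
  assumes \<Gamma>: "\<Gamma> \<subseteq> G" and t: "is_hauptmodul \<Gamma> t"
  shows "t holomorphic_on {z. Im z > 0}"
    and "B \<in> SL2Z \<Longrightarrow> B \<notin> G \<Longrightarrow> bdd_at_cusp (\<lambda>z. t (act B z))"
proof -
  obtain F where F: "has_q_expansion t 1 F" "fls_nth F (-1) = 1"
    using t unfolding is_hauptmodul_def by blast
  have gen: "generates_function_field \<Gamma> t" using t unfolding is_hauptmodul_def by blast
  then have mod: "modular_function \<Gamma> t" unfolding generates_function_field_def by blast
  have "fls_subdegree F \<le> -1" using F(2) by (intro fls_subdegree_leI) auto
  then have inf: "filterlim t at_infinity at_cusp" using has_q_expansion_filterlim[OF F(1)] by simp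
  have "\<not> is_pole t x" if x: "Im x > 0" for x
  proof
    assume pole: "is_pole t x"
    obtain k where k: "k \<ge> 6" "even k" "eisenstein other_pairs k x \<noteq> 0"
      using eisenstein_nonzero[OF other_pairs_le other_pairs_nonempty x] by blast
    then show False using no_pole[OF k(1,2) \<Gamma> gen inf x pole] by simp
  qed
  then have "t analytic_on {x}" if "Im x > 0" for x
    using mod that unfolding modular_function_def by (intro nicely_meromorphic_on_imp_analytic_at) auto
  then have "t analytic_on {z. Im z > 0}" using analytic_on_analytic_at[of t "{z. Im z > 0}"] by simp
  then show "t holomorphic_on {z. Im z > 0}" by (rule analytic_imp_holomorphic)
  assume B: "B \<in> SL2Z" "B \<notin> G"
  obtain w E where E: "w > 0" "has_q_expansion (t \<circ> act B) w E"
    using mod B(1) unfolding modular_function_def by blast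
  have "\<not> fls_subdegree E < 0"
    using has_q_expansion_filterlim[OF E(2,1)] no_pole_cusp[of 6, OF _ _ \<Gamma> gen inf B] by auto
  then have "((t \<circ> act B) \<longlongrightarrow> fls_nth E 0) at_cusp" using has_q_expansion_tendsto[OF E(2,1)] by simp
  then show "bdd_at_cusp (\<lambda>z. t (act B z))" using tendsto_bdd_at_cusp by (simp add: o_def)
qed

end

section \<open>Faber polynomials\<close>

lemma fls_poly_pCons: "fls_poly (pCons a P) u = fls_const a + u * fls_poly P u"
  by (simp add: fls_poly_def map_poly_pCons)

lemma fls_poly_0 [simp]: "fls_poly 0 u = 0"
  by (simp add: fls_poly_def)

lemma fls_poly_add: "fls_poly (P + Q) u = fls_poly P u + fls_poly Q u"
proof -
  have "map_poly fls_const (P + Q) = map_poly fls_const P + map_poly fls_const Q"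
    by (rule poly_eqI) (simp add: coeff_map_poly fls_eq_iff)
  then show ?thesis by (simp add: fls_poly_def)
qed

lemma fls_poly_minus: "fls_poly (- P) u = - fls_poly P u"
proof -
  have "map_poly fls_const (- P) = - map_poly fls_const P"
    by (rule poly_eqI) (simp add: coeff_map_poly fls_eq_iff)
  then show ?thesis by (simp add: fls_poly_def)
qed

lemma fls_poly_diff: "fls_poly (P - Q) u = fls_poly P u - fls_poly Q u"
  using fls_poly_add[of P "-Q" u] by (simp add: fls_poly_minus)

lemma fls_poly_monom: "fls_poly (monom c n) u = fls_const c * u ^ n"
  by (induction n) (simp_all add: monom_0 monom_Suc fls_poly_pCons mult_ac)

lemma fls_poly_altdef: "fls_poly P u = (\<Sum>i\<le>degree P. fls_const (coeff P i) * u ^ i)"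
proof -
  have *: "fls_poly (sum f I) u = (\<Sum>i\<in>I. fls_poly (f i) u)" for f and I :: "nat set"
    by (induction I rule: infinite_finite_induct) (simp_all add: fls_poly_add)
  have "fls_poly P u = fls_poly (\<Sum>i\<le>degree P. monom (coeff P i) i) u"
    by (simp only: poly_as_sum_of_monoms)
  then show ?thesis by (simp only: * fls_poly_monom)
qed

locale hauptmodul_series =
  fixes u :: "complex fls"
  assumes lead: "fls_nth u (-1) = 1" and below: "k < -1 \<Longrightarrow> fls_nth u k = 0"
begin

lemma subdegree: "fls_subdegree u = -1"
  using lead below by (intro fls_subdegree_eqI) auto

lemma power_nth: "fls_nth (u ^ n) (- int n) = 1" "k < - int n \<Longrightarrow> fls_nth (u ^ n) k = 0"
proof -
  have "fls_nth (u ^ n) (int n * fls_subdegree u) = fls_nth u (fls_subdegree u) ^ n"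
    by (rule fls_pow_base)
  then show "fls_nth (u ^ n) (- int n) = 1" by (simp add: subdegree lead)
  have "fls_subdegree (u ^ n) = int n * fls_subdegree u" by (rule fls_subdegree_pow)
  then show "k < - int n \<Longrightarrow> fls_nth (u ^ n) k = 0" by (simp add: subdegree)
qed

lemma fls_poly_nth_degree: "fls_nth (fls_poly P u) (- int (degree P)) = lead_coeff P"
proof -
  have "fls_nth (fls_poly P u) (- int (degree P)) =
      (\<Sum>i\<le>degree P. coeff P i * fls_nth (u ^ i) (- int (degree P)))"
    by (simp add: fls_poly_altdef fls_nth_sum)
  also have "\<dots> = (\<Sum>i\<in>{degree P}. coeff P i * fls_nth (u ^ i) (- int (degree P)))"
    by (rule sum.mono_neutral_right) (auto simp: power_nth)
  finally show ?thesis by (simp add: power_nth)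
qed

text \<open>The powers of \<open>u\<close> begin at distinct orders with coefficient 1, so the
  leading coefficient of a polynomial is visible in the terms of nonpositive order.\<close>

lemma fls_poly_unique:
  assumes "\<And>k. k \<le> 0 \<Longrightarrow> fls_nth (fls_poly P u) k = fls_nth (fls_poly Q u) k"
  shows "P = Q"
proof -
  have "lead_coeff (P - Q) = 0"
    using assms fls_poly_nth_degree[of "P - Q"] by (simp add: fls_poly_diff)
  then have "P - Q = 0" by (simp only: leading_coeff_0_iff)
  then show ?thesis by simp
qed

text \<open>Induction on the order of the pole: a multiple of a power of \<open>u\<close> removes
  the lowest term.\<close>

lemma fls_poly_exists:
  assumes "\<And>k. k < - int n \<Longrightarrow> fls_nth F k = 0"
  shows "\<exists>P. \<forall>k\<le>0. fls_nth (fls_poly P u) k = fls_nth F k"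
  using assms
proof (induction n arbitrary: F)
  case 0
  then have "fls_nth (fls_poly [:fls_nth F 0:] u) k = fls_nth F k" if "k \<le> 0" for k
    using that by (auto simp: fls_poly_pCons)
  then show ?case by blast
next
  case (Suc n)
  define c where "c = fls_nth F (- int (Suc n))"
  have "fls_nth (F - fls_const c * u ^ Suc n) k = 0" if "k < - int n" for k
  proof (cases "k = - int (Suc n)")
    case True
    then show ?thesis using power_nth(1)[of "Suc n"]
      by (simp only: fls_minus_nth fls_mult_const_nth c_def) simp
  next
    case False
    then have "k < - int (Suc n)" using that by simp
    then show ?thesis using power_nth(2)[of k "Suc n"] Suc.prems
      by (simp only: fls_minus_nth fls_mult_const_nth) simp
  qed
  then obtain P where P: "\<And>k. k \<le> 0 \<Longrightarrow> fls_nth (fls_poly P u) k = fls_nth (F - fls_const c * u ^ Suc n) k"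
    using Suc.IH by blast
  then have "\<forall>k\<le>0. fls_nth (fls_poly (P + monom c (Suc n)) u) k = fls_nth F k"
    by (simp add: fls_poly_add fls_poly_monom)
  then show ?case by blast
qed

lemma faber_poly_nth:
  assumes "k \<le> 0"
  shows "fls_nth (fls_poly (faber_poly u n) u) k = fls_nth (fls_const (1 / of_nat n) * fls_X_inv ^ n) k"
proof -
  let ?F = "fls_const (1 / of_nat n) * fls_X_inv ^ n :: complex fls"
  let ?p = "\<lambda>P. \<forall>k\<le>0. fls_nth (fls_poly P u - ?F) k = 0"
  obtain P where P: "\<And>k. k \<le> 0 \<Longrightarrow> fls_nth (fls_poly P u) k = fls_nth ?F k"
    using fls_poly_exists[of n ?F] by auto
  have "?p (THE P. ?p P)"
  proof (rule theI)
    show "?p P" using P by simp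
    show "Q = P" if "?p Q" for Q using that P by (intro fls_poly_unique) simp
  qed
  then show ?thesis using assms unfolding faber_poly_def by simp
qed

text \<open>By linearity only powers matter, and \<open>u ^ i\<close> times the derivative of
  \<open>u\<close> is, up to the factor i + 1, the derivative of the next power.\<close>

lemma residue_fls_poly_deriv: "fls_nth (fls_poly P u * fls_deriv u) (-1) = 0"
proof -
  have *: "fls_nth (u ^ i * fls_deriv u) (-1) = 0" for i
  proof -
    have "fls_nth (fls_deriv (u ^ Suc i)) (-1) = 0" by (simp only: fls_deriv_nth) simp
    moreover have "fls_deriv (u ^ Suc i) = of_nat (Suc i) * (u ^ i * fls_deriv u)"
      using fls_deriv_power[of u "Suc i"] by (simp add: mult_ac)
    moreover have "of_nat (Suc i) * (u ^ i * fls_deriv u) = fls_const (of_nat (Suc i)) * (u ^ i * fls_deriv u)"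
      by (simp only: fls_of_nat)
    ultimately have "of_nat (Suc i) * fls_nth (u ^ i * fls_deriv u) (-1) = 0"
      by (simp only: fls_mult_const_nth)
    then show ?thesis by (simp del: of_nat_Suc)
  qed
  have "fls_nth (fls_poly P u * fls_deriv u) (-1) =
      (\<Sum>i\<le>degree P. coeff P i * fls_nth (u ^ i * fls_deriv u) (-1))"
    by (simp add: fls_poly_altdef sum_distrib_right fls_nth_sum mult.assoc)
  then show ?thesis by (simp add: *)
qed

lemma fls_deriv_fls_poly: "fls_deriv (fls_poly P u) = fls_poly (pderiv P) u * fls_deriv u"
  by (induction P) (simp_all add: fls_poly_pCons pderiv_pCons fls_poly_add algebra_simps)

lemma fls_poly_mult: "fls_poly (P * Q) u = fls_poly P u * fls_poly Q u"
proof (induction P)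
  case (pCons a P)
  have "fls_poly (smult a Q) u = fls_const a * fls_poly Q u"
    by (induction Q) (simp_all add: fls_poly_pCons algebra_simps)
  then show ?case using pCons by (simp add: fls_poly_pCons fls_poly_add algebra_simps)
qed simp

abbreviation faber :: "nat \<Rightarrow> complex fls" where
  "faber n \<equiv> fls_poly (faber_poly u n) u"

lemma faber_decompose:
  "faber n = fls_const (1 / of_nat n) * fls_X_inv ^ n + fps_to_fls (fls_regpart (faber n - fls_const (1 / of_nat n) * fls_X_inv ^ n))"
proof (rule fls_eqI)
  fix k :: int
  show "fls_nth (faber n) k = fls_nth (fls_const (1 / of_nat n) * fls_X_inv ^ n + fps_to_fls (fls_regpart (faber n - fls_const (1 / of_nat n) * fls_X_inv ^ n))) k"
    using faber_poly_nth[of k n] by (cases "k \<ge> 0") auto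
qed

text \<open>Grunsky's symmetry: the derivative of a Laurent series has no residue, so neither does
  \<open>X\<^sub>n(u) (X\<^sub>m(u))'\<close>, being the derivative of a polynomial in \<open>u\<close>.\<close>

lemma faber_symmetric:
  assumes "m > 0" "n > 0"
  shows "fls_nth (faber n) (int m) = fls_nth (faber m) (int n)"
proof -
  define a b where "a = fls_regpart (faber n - fls_const (1 / of_nat n) * fls_X_inv ^ n)"
    and "b = fls_regpart (faber m - fls_const (1 / of_nat m) * fls_X_inv ^ m)"
  let ?A = "fls_const (1 / of_nat n) * fls_X_inv ^ n :: complex fls"
  let ?B = "fls_const (1 / of_nat m) * fls_X_inv ^ m :: complex fls"
  have A: "faber n = ?A + fps_to_fls a" and B: "faber m = ?B + fps_to_fls b"
    using faber_decompose unfolding a_def b_def by blast+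
  have dB: "fls_deriv ?B = - (fls_X_inv ^ Suc m)"
  proof (rule fls_eqI)
    fix k
    show "fls_nth (fls_deriv ?B) k = fls_nth (- (fls_X_inv ^ Suc m)) k"
      using assms by (auto simp del: power_Suc)
  qed
  define D where "D = fls_deriv (faber m)"
  have D: "D = fls_deriv ?B + fps_to_fls (fps_deriv b)"
    unfolding D_def by (subst B) (simp only: fls_deriv_add fls_deriv_fps_to_fls)
  have "faber n * D = fls_poly (faber_poly u n * pderiv (faber_poly u m)) u * fls_deriv u"
    by (simp add: D_def fls_deriv_fls_poly fls_poly_mult mult.assoc)
  then have "fls_nth (faber n * D) (-1) = 0" by (simp only: residue_fls_poly_deriv)
  moreover have "faber n * D = ?A * D + fps_to_fls a * D"
    by (subst A) (rule distrib_right)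
  moreover have "fps_to_fls a * D = fps_to_fls a * fls_deriv ?B + fps_to_fls a * fps_to_fls (fps_deriv b)"
    unfolding D by (rule distrib_left)
  \<comment> \<open>The factor n from differentiation cancels the 1/n in \<open>?A\<close>; since n
    - 1 >= 0, the polar part of \<open>D\<close> is not seen.\<close>
  moreover have "fls_nth (?A * D) (-1) = fls_nth (faber m) (int n)"
    using assms by (simp only: mult.assoc fls_mult_const_nth fls_X_inv_power_times_conv_shift(1)) (simp add: D_def)
  moreover have "fls_nth (fps_to_fls a * fls_deriv ?B) (-1) = - fls_nth (fps_to_fls a) (int m)"
    unfolding dB by (simp add: fls_X_inv_power_times_conv_shift mult.commute[of "fps_to_fls a"] del: power_Suc)
  moreover have "fls_nth (fps_to_fls a) (int m) = fls_nth (faber n) (int m)"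
    using assms by (simp add: A)
  moreover have "fls_nth (fps_to_fls a * fps_to_fls (fps_deriv b)) (-1) = 0"
    by (simp flip: fls_times_fps_to_fls)
  ultimately show ?thesis by simp
qed

end

section \<open>From formal expansions to functions\<close>

lemma fls_poly_has_laurent_expansion:
  assumes "f has_laurent_expansion F"
  shows "(\<lambda>q. poly P (f q)) has_laurent_expansion fls_poly P F"
  by (induction P) (auto simp: fls_poly_pCons intro!: laurent_expansion_intros assms)

lemma has_q_expansion_poly:
  assumes "has_q_expansion f w F" "w > 0"
  shows "has_q_expansion (\<lambda>z. poly P (f z)) w (fls_poly P F)"
proof -
  obtain Y where F: "fls_conv_radius F > 0" "\<And>z. Im z > Y \<Longrightarrow> f z = eval_fls F (qpar w z)"
    using assms(1) unfolding has_q_expansion_qpar by blast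
  show ?thesis
    by (rule has_q_expansionI[OF fls_poly_has_laurent_expansion[OF eval_fls_has_laurent_expansion[OF F(1)]] assms(2), where Y = Y])
      (simp add: F(2))
qed

text \<open>The polar part of a Faber polynomial plus any convergent power series. The constant term
  is left free because Liouville's theorem compares functions only up to constants.\<close>

definition faber_like :: "(complex \<Rightarrow> complex) \<Rightarrow> nat \<Rightarrow> complex fps \<Rightarrow> bool" where
  "faber_like f n g \<longleftrightarrow> fps_conv_radius g > 0 \<and>
     (\<exists>Y. \<forall>z. Im z > Y \<longrightarrow> f z = inverse (qpar 1 z ^ n) / of_nat n + eval_fps g (qpar 1 z))"

lemma hauptmodul_faber:
  assumes t: "is_hauptmodul \<Gamma> t"
  shows "\<exists>g. faber_like (\<lambda>z. poly (faber_poly (q_expansion t) n) (t z)) n g \<and>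
      fps_nth g 0 = 0 \<and> (\<forall>m>0. fps_nth g m = faber_coeff t m n)"
    and "m > 0 \<Longrightarrow> n > 0 \<Longrightarrow> faber_coeff t m n = faber_coeff t n m"
proof -
  obtain F where F: "has_q_expansion t 1 F" "fls_nth F (-1) = 1" "\<And>k. k < -1 \<Longrightarrow> fls_nth F k = 0"
    using t unfolding is_hauptmodul_def by blast
  interpret hauptmodul_series F by unfold_locales (use F in auto)
  have q: "q_expansion t = F" using F(1) by (rule q_expansion_eqI)
  show "m > 0 \<Longrightarrow> n > 0 \<Longrightarrow> faber_coeff t m n = faber_coeff t n m"
    unfolding faber_coeff_def q by (rule faber_symmetric)
  let ?A = "fls_const (1 / of_nat n) * fls_X_inv ^ n :: complex fls"
  define g where "g = fls_regpart (faber n - ?A)"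
  have E: "faber n = ?A + fps_to_fls g" unfolding g_def by (rule faber_decompose)
  have hq: "has_q_expansion (\<lambda>z. poly (faber_poly F n) (t z)) 1 (faber n)"
    using has_q_expansion_poly[OF F(1)] by simp
  then obtain Y where conv: "fls_conv_radius (faber n) > 0"
    and eq: "\<And>z. Im z > Y \<Longrightarrow> poly (faber_poly F n) (t z) = eval_fls (faber n) (qpar 1 z)"
    unfolding has_q_expansion_qpar by blast
  have "fls_conv_radius (faber n - ?A) > 0"
  proof -
    have "(\<lambda>q. eval_fls (faber n) q - 1 / of_nat n * inverse q ^ n) has_laurent_expansion faber n - ?A"
      by (intro laurent_expansion_intros conv) 
    then show ?thesis by (simp add: has_laurent_expansion_def)
  qed
  then have g: "fps_conv_radius g > 0" by (simp only: g_def fps_conv_radius_fls_regpart)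
  have A: "fls_conv_radius ?A = \<infinity>"
    by (simp add: fls_X_inv_power_times_conv_shift)
  obtain r where r: "r > 0" "ereal r < fps_conv_radius g" using g ereal_dense2 by (metis ereal_less(2))
  obtain Y' where Y': "\<And>z. Im z > Y' \<Longrightarrow> norm (qpar 1 z) < r" using qpar_small[of 1 r] r(1) by auto
  have "poly (faber_poly F n) (t z) = inverse (qpar 1 z ^ n) / of_nat n + eval_fps g (qpar 1 z)"
    if "Im z > max Y Y'" for z
  proof -
    have nr: "ereal (norm (qpar 1 z)) < fps_conv_radius g"
      using Y'[of z] that r(2) by (meson ereal_less_eq(3) less_imp_le max_less_iff_conj order.strict_trans1)
    have "poly (faber_poly F n) (t z) = eval_fls (?A + fps_to_fls g) (qpar 1 z)"
      using eq[of z] that E by simp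
    also have "\<dots> = eval_fls ?A (qpar 1 z) + eval_fps g (qpar 1 z)"
      using nr A by (subst eval_fls_add) (auto simp: eval_fps_to_fls)
    also have "eval_fls ?A (qpar 1 z) = inverse (qpar 1 z ^ n) / of_nat n"
    proof -
      have "eval_fls ?A (qpar 1 z) = eval_fls (fls_const (1 / of_nat n)) (qpar 1 z) * eval_fls fls_X_inv (qpar 1 z) ^ n"
        by (subst eval_fls_mult) (auto simp: eval_fls_power intro!: order.strict_trans2[OF _ fls_conv_radius_power])
      moreover have "eval_fls fls_X_inv (qpar 1 z) = inverse (qpar 1 z)"
        by (simp add: eval_fls_def fls_base_factor_to_fps_X_inv power_int_minus)
      ultimately show ?thesis by (simp add: power_inverse divide_inverse mult.commute)
    qed
    finally show ?thesis .
  qed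
  then have "faber_like (\<lambda>z. poly (faber_poly (q_expansion t) n) (t z)) n g"
    unfolding faber_like_def q using g by blast
  moreover have "fps_nth g 0 = 0" using faber_poly_nth[of 0 n] by (simp add: g_def)
  moreover have "fps_nth g m = faber_coeff t m n" if "m > 0" for m
    using that by (simp add: g_def faber_coeff_def q)
  ultimately show "\<exists>g. faber_like (\<lambda>z. poly (faber_poly (q_expansion t) n) (t z)) n g \<and>
      fps_nth g 0 = 0 \<and> (\<forall>m>0. fps_nth g m = faber_coeff t m n)" by blast
qed

section \<open>The quadratic character\<close>

definition pm1 :: "nat \<Rightarrow> int \<Rightarrow> bool" where
  "pm1 N a \<longleftrightarrow> [a = 1] (mod int N) \<or> [a = -1] (mod int N)"

text \<open>Off the units the value is -1 rather than 0, in accordance with \<open>psi\<close>;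
  multiplicativity is claimed on units only (\<open>chi_mult\<close>).\<close>

definition chi :: "nat \<Rightarrow> int \<Rightarrow> complex" where
  "chi N a = (if pm1 N a then 1 else -1)"

lemma chi_cases: "chi N a = 1 \<or> chi N a = -1"
  by (simp add: chi_def)

lemma chi_square [simp]: "chi N a * chi N a = 1"
  by (simp add: chi_def)

lemma chi_cong: "[a = b] (mod int N) \<Longrightarrow> chi N a = chi N b"
  unfolding chi_def pm1_def cong_def by simp

lemma pm1_mod: assumes "N \<in> {5, 8}" shows "pm1 N a \<longleftrightarrow> a mod int N = 1 \<or> a mod int N = int N - 1"
  using assms by (auto simp: pm1_def cong_def)

text \<open>The units modulo 5 or 8 form, modulo +-1, a group of order two, so the product of two
  nontrivial classes is trivial. This is checked on residues.\<close>

lemma pm1_mult: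
  assumes N: "N \<in> {5, 8}" and a: "coprime a (int N)" and b: "coprime b (int N)"
  shows "pm1 N (a * b) \<longleftrightarrow> (pm1 N a \<longleftrightarrow> pm1 N b)"
proof -
  have res: "x mod int N \<in> (if N = 5 then {1,2,3,4} else {1,3,5,7})" if "coprime x (int N)" for x
  proof (cases "N = 5")
    case True
    have "\<not> 5 dvd x" using that True by (auto simp: coprime_absorb_right)
    then have "x mod 5 \<noteq> 0" by (simp add: dvd_eq_mod_eq_0)
    moreover have "x mod 5 \<ge> 0" "x mod 5 < 5" by simp_all
    ultimately show ?thesis using True by auto
  next
    case False
    then have N8: "N = 8" using N by simp
    have "odd x"
    proof
      assume "even x"
      then show False using coprime_common_divisor[of x 8 2] that N8 by simp
    qed
    then have "x mod 8 mod 2 = 1" by (simp add: mod_mod_cancel odd_iff_mod_2_eq_one)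
    moreover have "x mod 8 \<ge> 0" "x mod 8 < 8" by simp_all
    moreover have "y \<in> {0,1,2,3,4,5,6,7}" if "y \<ge> 0" "y < 8" for y :: int using that by auto
    ultimately have "x mod 8 \<in> {1,3,5,7}" by fastforce
    then show ?thesis using N8 by simp
  qed
  have 5: "(x * y mod 5 = 1 \<or> x * y mod 5 = 4) \<longleftrightarrow> ((x = 1 \<or> x = 4) \<longleftrightarrow> (y = 1 \<or> y = 4))"
    if "x \<in> {1,2,3,4}" "y \<in> {1,2,3,4}" for x y :: int
    using that by (elim insertE emptyE; simp)
  have 8: "(x * y mod 8 = 1 \<or> x * y mod 8 = 7) \<longleftrightarrow> ((x = 1 \<or> x = 7) \<longleftrightarrow> (y = 1 \<or> y = 7))"
    if "x \<in> {1,3,5,7}" "y \<in> {1,3,5,7}" for x y :: int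
    using that by (elim insertE emptyE; simp)
  consider "N = 5" | "N = 8" using N by blast
  then show ?thesis
  proof cases
    case 1
    have r: "a mod 5 \<in> {1,2,3,4}" "b mod 5 \<in> {1,2,3,4}"
      using res[OF a] res[OF b] unfolding 1 by (simp_all only: if_True refl of_nat_numeral)
    show ?thesis unfolding pm1_mod[OF N] unfolding 1 using 5[OF r] by (simp add: mod_mult_eq)
  next
    case 2
    have r: "a mod 8 \<in> {1,3,5,7}" "b mod 8 \<in> {1,3,5,7}"
      using res[OF a] res[OF b] unfolding 2 by (simp_all only: if_False of_nat_numeral numeral_eq_iff num.distinct)
    show ?thesis unfolding pm1_mod[OF N] unfolding 2 using 8[OF r] by (simp add: mod_mult_eq)
  qed
qed

lemma chi_mult:
  assumes "N \<in> {5, 8}" "coprime a (int N)" "coprime b (int N)"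
  shows "chi N (a * b) = chi N a * chi N b"
  using pm1_mult[OF assms] by (simp add: chi_def)

section \<open>The group of level N, its character and the kernel\<close>

lemma Gamma0_iff: "A \<in> Gamma0 N \<longleftrightarrow> A \<in> SL2Z \<and> int N dvd A$2$1"
  by (auto simp: Gamma0_def cong_0_iff)

lemma Gamma0_SL2Z: "A \<in> Gamma0 N \<Longrightarrow> A \<in> SL2Z"
  by (simp add: Gamma0_iff)

lemma Gamma0_diag: "A \<in> Gamma0 N \<Longrightarrow> [A$1$1 * A$2$2 = 1] (mod int N)"
proof -
  assume A: "A \<in> Gamma0 N"
  then have "A$1$1 * A$2$2 - 1 = A$1$2 * A$2$1" by (simp add: Gamma0_iff SL2Z_iff)
  then have "int N dvd A$1$1 * A$2$2 - 1" using A by (simp add: Gamma0_iff)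
  then show ?thesis by (simp add: cong_iff_dvd_diff)
qed

lemma Gamma0_coprime:
  assumes "A \<in> Gamma0 N" shows "coprime (A$1$1) (int N)" "coprime (A$2$2) (int N)"
proof -
  have "coprime (A$1$1 * A$2$2) (int N)" using Gamma0_diag[OF assms]
    by (metis cong_imp_coprime cong_sym coprime_1_left)
  then show "coprime (A$1$1) (int N)" "coprime (A$2$2) (int N)" by simp_all
qed

lemma Gamma0_mult: "A \<in> Gamma0 N \<Longrightarrow> B \<in> Gamma0 N \<Longrightarrow> A ** B \<in> Gamma0 N"
  by (auto simp: Gamma0_iff SL2Z_mult)

lemma Gamma0_adj: "A \<in> Gamma0 N \<Longrightarrow> adj A \<in> Gamma0 N"
  by (auto simp: Gamma0_iff SL2Z_adj)

lemma Gamma0_uminus: "A \<in> Gamma0 N \<Longrightarrow> - A \<in> Gamma0 N"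
  by (simp add: Gamma0_iff SL2Z_iff)

lemma Gamma0_mult_cancel:
  assumes "A \<in> Gamma0 N" shows "A ** B \<in> Gamma0 N \<longleftrightarrow> B \<in> Gamma0 N"
proof
  assume "A ** B \<in> Gamma0 N"
  then have "adj A ** (A ** B) \<in> Gamma0 N" using assms Gamma0_adj Gamma0_mult by blast
  moreover have "adj A ** (A ** B) = B"
    using adj_left[OF Gamma0_SL2Z[OF assms]] by (metis matrix_mul_assoc matrix_mul_lid)
  ultimately show "B \<in> Gamma0 N" by simp
qed (rule Gamma0_mult[OF assms])

text \<open>The lower left entry vanishes modulo N, so the upper left entry is multiplicative there,
  and \<open>chi\<close> of it is a character of \<open>Gamma0 N\<close>.\<close>

lemma chi_Gamma0_mult:
  assumes N: "N \<in> {5, 8}" and A: "A \<in> Gamma0 N" and B: "B \<in> Gamma0 N"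
  shows "chi N ((A ** B)$1$1) = chi N (A$1$1) * chi N (B$1$1)"
proof -
  have "[A$1$1 * B$1$1 + A$1$2 * B$2$1 = A$1$1 * B$1$1 + A$1$2 * 0] (mod int N)"
    using B by (intro cong_add cong_mult cong_refl) (simp add: Gamma0_iff cong_0_iff)
  then have "chi N ((A ** B)$1$1) = chi N (A$1$1 * B$1$1)" by (intro chi_cong) simp
  also have "\<dots> = chi N (A$1$1) * chi N (B$1$1)"
    by (intro chi_mult N Gamma0_coprime(1)[OF A] Gamma0_coprime(1)[OF B])
  finally show ?thesis .
qed

text \<open>The union of \<open>Gamma1 N\<close> and its negative, as the kernel of a character. It
  acts like \<open>Gamma1 N\<close> but contains -1, as \<open>modular_group\<close>
  requires.\<close>

definition Gamma1_pm :: "nat \<Rightarrow> (int^2^2) set" where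
  "Gamma1_pm N = {A \<in> Gamma0 N. chi N (A$1$1) = 1}"

lemma chi_one: "chi N 1 = 1"
  by (simp add: chi_def pm1_def)

lemma chi_adj:
  assumes N: "N \<in> {5, 8}" and A: "A \<in> Gamma0 N"
  shows "chi N (adj A $1$1) = chi N (A$1$1)"
proof -
  have "chi N (A$1$1 * A$2$2) = 1" using chi_cong[OF Gamma0_diag[OF A]] chi_one by simp
  then have "chi N (A$1$1) * chi N (A$2$2) = 1"
    using chi_mult[OF N Gamma0_coprime[OF A]] by simp
  then show ?thesis using chi_cases[of N "A$1$1"] chi_cases[of N "A$2$2"] by auto
qed

lemma chi_uminus: "chi N (- a) = chi N a"
proof -
  have "pm1 N (-a) \<longleftrightarrow> pm1 N a"
    unfolding pm1_def using cong_minus_minus_iff[of a 1 "int N"] cong_minus_minus_iff[of a "-1" "int N"] by auto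
  then show ?thesis by (simp add: chi_def)
qed

lemma act_uminus: "act (- A) z = act A z"
proof -
  have "act (- A) z = (- (of_int (A$1$1) * z + of_int (A$1$2))) / (- (of_int (A$2$1) * z + of_int (A$2$2)))"
    by (simp add: act_def moebius_def)
  then show ?thesis by (simp only: minus_divide_divide act_def moebius_def)
qed

lemma modular_group_Gamma0:
  assumes "N > 1" shows "modular_group (Gamma0 N) N"
proof
  show "N > 0" using assms by simp
  show "Gamma1 N \<subseteq> Gamma0 N" by (auto simp: Gamma1_def)
  show "Gamma0 N \<subseteq> SL2Z" by (auto simp: Gamma0_iff)
  show "(A$2$1, A$2$2) \<noteq> (1, 0)" if "A \<in> Gamma0 N" for A
    using that assms by (auto simp: Gamma0_iff)
qed (auto intro: Gamma0_mult Gamma0_adj Gamma0_uminus)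

lemma modular_group_Gamma1_pm:
  assumes N: "N \<in> {5, 8}" shows "modular_group (Gamma1_pm N) N"
proof
  show "N > 0" using N by auto
  have "chi N (A$1$1) = 1" if "A \<in> Gamma1 N" for A
    using that chi_cong[of "A$1$1" 1 N] chi_one by (simp add: Gamma1_def)
  then show "Gamma1 N \<subseteq> Gamma1_pm N" by (auto simp: Gamma1_def Gamma1_pm_def)
  show "Gamma1_pm N \<subseteq> SL2Z" by (auto simp: Gamma0_iff Gamma1_pm_def)
  show "A ** B \<in> Gamma1_pm N" if "A \<in> Gamma1_pm N" "B \<in> Gamma1_pm N" for A B
    using that chi_Gamma0_mult[OF N, of A B] Gamma0_mult[of A N B]
    unfolding Gamma1_pm_def mem_Collect_eq by (metis mult_1)
  show "adj A \<in> Gamma1_pm N" if "A \<in> Gamma1_pm N" for A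
    using that chi_adj[OF N, of A] Gamma0_adj[of A N] unfolding Gamma1_pm_def mem_Collect_eq by metis
  show "- A \<in> Gamma1_pm N" if "A \<in> Gamma1_pm N" for A
    using that Gamma0_uminus[of A N] chi_uminus[of N "A$1$1"] by (simp add: Gamma1_pm_def)
  show "(A$2$1, A$2$2) \<noteq> (1, 0)" if "A \<in> Gamma1_pm N" for A
    using that N by (auto simp: Gamma0_iff Gamma1_pm_def)
qed

lemma Gamma1_pm_cases:
  assumes "A \<in> Gamma1_pm N" shows "A \<in> Gamma1 N \<or> - A \<in> Gamma1 N"
proof -
  have A: "A \<in> Gamma0 N" using assms by (simp add: Gamma1_pm_def)
  note d = Gamma0_diag[OF A]
  have "pm1 N (A$1$1)" using assms by (simp add: Gamma1_pm_def chi_def split: if_splits)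
  then consider "[A$1$1 = 1] (mod int N)" | "[A$1$1 = -1] (mod int N)" unfolding pm1_def by blast
  then show ?thesis
  proof cases
    case 1
    have "[A$1$1 * A$2$2 = 1 * A$2$2] (mod int N)" by (intro cong_mult 1 cong_refl)
    then have "[A$2$2 = 1] (mod int N)" using d by (metis cong_sym cong_trans mult_1)
    then show ?thesis using 1 A by (simp add: Gamma1_def)
  next
    case 2
    have "[A$1$1 * A$2$2 = -1 * A$2$2] (mod int N)" by (intro cong_mult 2 cong_refl)
    then have "[- (A$2$2) = 1] (mod int N)" using d by (metis cong_sym cong_trans mult_minus1)
    moreover have "[- (A$1$1) = 1] (mod int N)" using 2 cong_minus_minus_iff[of "A$1$1" "-1" "int N"] by simp
    ultimately show ?thesis using Gamma0_uminus[OF A] by (simp add: Gamma1_def)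
  qed
qed

lemma Gamma0_nontrivial:
  assumes "N \<in> {5, 8}" obtains \<sigma> where "\<sigma> \<in> Gamma0 N" "chi N (\<sigma>$1$1) = -1"
proof
  \<comment> \<open>The determinants are 6 - 5 and 9 - 8; the upper left entries 2 modulo 5 and 3
    modulo 8 are not +-1.\<close>
  let ?s = "if N = 5 then mat2 2 1 5 3 else mat2 3 1 8 3"
  show "?s \<in> Gamma0 N" using assms by (auto simp: Gamma0_iff SL2Z_iff)
  show "chi N (?s $1$1) = -1" using assms by (auto simp: chi_def pm1_def cong_def)
qed

section \<open>The anti-invariant functions\<close>

lemma bdd_eval_fps_qpar:
  assumes "fps_conv_radius g > 0" shows "bdd_at_cusp (\<lambda>z. eval_fps g (qpar 1 z))"
proof -
  have "isCont (eval_fps g) 0"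
    using continuous_on_eval_fps[of g] assms by (auto simp: continuous_on_eq_continuous_at zero_ereal_def)
  then have "(eval_fps g \<longlongrightarrow> eval_fps g 0) (at 0)" by (simp add: isCont_def)
  then have "((\<lambda>z. eval_fps g (qpar 1 z)) \<longlongrightarrow> eval_fps g 0) at_cusp"
    using filterlim_compose filterlim_qpar[of 1] by fastforce
  then show ?thesis by (rule tendsto_bdd_at_cusp)
qed

text \<open>The polar term cancels in f - h, and survives once in 2 f - h because 2 - 1 = 1.\<close>

lemma faber_like_diff:
  assumes f: "faber_like f n a" and h: "faber_like h n b"
  shows "bdd_at_cusp (\<lambda>z. f z - h z)"
    and "faber_like (\<lambda>z. 2 * f z - h z - c) n (fps_const 2 * a - b - fps_const c)"
proof -
  obtain Y where a: "fps_conv_radius a > 0"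
    and Y: "\<And>z. Im z > Y \<Longrightarrow> f z = inverse (qpar 1 z ^ n) / of_nat n + eval_fps a (qpar 1 z)"
    using f unfolding faber_like_def by blast
  obtain Y' where b: "fps_conv_radius b > 0"
    and Y': "\<And>z. Im z > Y' \<Longrightarrow> h z = inverse (qpar 1 z ^ n) / of_nat n + eval_fps b (qpar 1 z)"
    using h unfolding faber_like_def by blast
  have "bdd_at_cusp (\<lambda>z. eval_fps a (qpar 1 z) - eval_fps b (qpar 1 z))"
    by (intro bdd_at_cusp_diff bdd_eval_fps_qpar a b)
  then obtain Y1 C where "\<And>z. Im z > Y1 \<Longrightarrow> norm (eval_fps a (qpar 1 z) - eval_fps b (qpar 1 z)) \<le> C"
    unfolding bdd_at_cusp_def by blast
  then show "bdd_at_cusp (\<lambda>z. f z - h z)"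
    by (intro bdd_at_cuspI[of "max Y1 (max Y Y')" _ C]) (simp add: Y Y')
  have a2: "fps_conv_radius (fps_const 2 * a) > 0"
    by (rule less_le_trans[OF _ fps_conv_radius_mult]) (use a in simp)
  have ab: "fps_conv_radius (fps_const 2 * a - b) > 0"
    by (rule less_le_trans[OF _ fps_conv_radius_diff]) (use a2 b in simp)
  have abc: "fps_conv_radius (fps_const 2 * a - b - fps_const c) > 0"
    by (rule less_le_trans[OF _ fps_conv_radius_diff]) (use ab in simp)
  obtain r where r: "r > 0" "ereal r < min (fps_conv_radius a) (fps_conv_radius b)"
    using a b ereal_dense2[of 0 "min (fps_conv_radius a) (fps_conv_radius b)"] by auto
  obtain Y2 where Y2: "\<And>z. Im z > Y2 \<Longrightarrow> norm (qpar 1 z) < r" using qpar_small[of 1 r] r(1) by auto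
  have "2 * f z - h z - c = inverse (qpar 1 z ^ n) / of_nat n + eval_fps (fps_const 2 * a - b - fps_const c) (qpar 1 z)"
    if z: "Im z > max Y2 (max Y Y')" for z
  proof -
    have "ereal (norm (qpar 1 z)) < ereal r" using Y2 z by simp
    then have q: "ereal (norm (qpar 1 z)) < fps_conv_radius a" "ereal (norm (qpar 1 z)) < fps_conv_radius b"
      using r(2) order.strict_trans[of "ereal (norm (qpar 1 z))" "ereal r"] by (simp_all only: min_less_iff_conj)
    have q2: "ereal (norm (qpar 1 z)) < fps_conv_radius (fps_const 2 * a)"
      by (rule less_le_trans[OF _ fps_conv_radius_mult]) (use q in simp)
    have q3: "ereal (norm (qpar 1 z)) < fps_conv_radius (fps_const 2 * a - b)"
      by (rule less_le_trans[OF _ fps_conv_radius_diff]) (use q q2 in simp)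
    have "eval_fps (fps_const 2 * a - b - fps_const c) (qpar 1 z) = 2 * eval_fps a (qpar 1 z) - eval_fps b (qpar 1 z) - c"
      using q q2 q3 by (simp add: eval_fps_diff eval_fps_mult)
    then show ?thesis using Y[of z] Y'[of z] z by simp
  qed
  then show "faber_like (\<lambda>z. 2 * f z - h z - c) n (fps_const 2 * a - b - fps_const c)"
    using abc unfolding faber_like_def by blast
qed

text \<open>Growth at infinity is left out: a pole is allowed there and is described separately by
  \<open>faber_like\<close>.\<close>

definition anti_invariant :: "nat \<Rightarrow> (complex \<Rightarrow> complex) \<Rightarrow> bool" where
  "anti_invariant N f \<longleftrightarrow> f holomorphic_on {z. Im z > 0} \<and>
     (\<forall>A\<in>Gamma0 N. \<forall>z. Im z > 0 \<longrightarrow> f (act A z) = chi N (A$1$1) * f z) \<and>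
     (\<forall>A\<in>SL2Z. A \<notin> Gamma0 N \<longrightarrow> bdd_at_cusp (\<lambda>z. f (act A z)))"

lemma act_SL2Z_mult:
  assumes "A \<in> SL2Z" "B \<in> SL2Z" "Im z > 0" shows "act A (act B z) = act (A ** B) z"
  using assms by (subst act_mult) (auto simp: SL2Z_det)

lemma Im_act_SL2Z: "A \<in> SL2Z \<Longrightarrow> Im z > 0 \<Longrightarrow> Im (act A z) > 0"
  by (rule Im_act_pos) (auto simp: SL2Z_det)

text \<open>With g and h the Faber polynomials of \<open>t\<close> and \<open>t0\<close>, and s the
  transform of g by \<open>\<sigma>\<close>, the function g + s - h is a constant c: at infinity g
  and h have the same pole and s has none. Then f = 2 g - h - c equals g - s; the first form shows
  the coefficients, the second the character.\<close>

theorem hauptmodul_anti_invariant: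
  assumes N: "N \<in> {5, 8}" and t: "is_hauptmodul (Gamma1 N) t" and t0: "is_hauptmodul (Gamma0 N) t0"
  shows "\<exists>f g. anti_invariant N f \<and> faber_like f n g \<and>
    (\<forall>m>0. fps_nth g m = 2 * faber_coeff t m n - faber_coeff t0 m n)"
proof -
  interpret G0: modular_group "Gamma0 N" N by (rule modular_group_Gamma0) (use N in auto)
  interpret G1: modular_group "Gamma1_pm N" N by (rule modular_group_Gamma1_pm[OF N])
  define P P0 where "P = faber_poly (q_expansion t) n" and "P0 = faber_poly (q_expansion t0) n"
  define g h where "g = (\<lambda>z. poly P (t z))" and "h = (\<lambda>z. poly P0 (t0 z))"
  obtain a where a: "faber_like g n a" "\<forall>m>0. fps_nth a m = faber_coeff t m n"
    using hauptmodul_faber(1)[OF t, of n] unfolding g_def P_def by blast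
  obtain b where b: "faber_like h n b" "\<forall>m>0. fps_nth b m = faber_coeff t0 m n"
    using hauptmodul_faber(1)[OF t0, of n] unfolding h_def P0_def by blast
  have t_inv: "t (act A z) = t z" if A: "A \<in> Gamma1_pm N" and z: "Im z > 0" for A z
  proof -
    have *: "t (act B z) = t z" if "B \<in> Gamma1 N" for B
      using t that z unfolding is_hauptmodul_def generates_function_field_def modular_function_def by simp
    show ?thesis using Gamma1_pm_cases[OF A] *[of A] *[of "-A"] act_uminus[of A z] by auto
  qed
  then have g_inv: "g (act A z) = g z" if "A \<in> Gamma1_pm N" "Im z > 0" for A z
    using that by (simp add: g_def)
  have h_inv: "h (act A z) = h z" if "A \<in> Gamma0 N" "Im z > 0" for A z
    using t0 that unfolding is_hauptmodul_def generates_function_field_def modular_function_def by (simp add: h_def)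
  have hol: "g holomorphic_on {z. Im z > 0}" "h holomorphic_on {z. Im z > 0}"
    unfolding g_def h_def poly_altdef
    by (intro holomorphic_intros G1.hauptmodul_holomorphic(1)[OF G1.Gamma1_le t]
        G0.hauptmodul_holomorphic(1)[OF order_refl t0])+
  have g_bdd: "bdd_at_cusp (\<lambda>z. g (act A z))" if "A \<in> SL2Z" "A \<notin> Gamma1_pm N" for A
    unfolding g_def using G1.hauptmodul_holomorphic(2)[OF G1.Gamma1_le t that] by (rule bdd_at_cusp_poly)
  have h_bdd: "bdd_at_cusp (\<lambda>z. h (act A z))" if "A \<in> SL2Z" "A \<notin> Gamma0 N" for A
    unfolding h_def using G0.hauptmodul_holomorphic(2)[OF order_refl t0 that] by (rule bdd_at_cusp_poly)
  obtain \<sigma> where \<sigma>: "\<sigma> \<in> Gamma0 N" "chi N (\<sigma>$1$1) = -1" using Gamma0_nontrivial[OF N] .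
  have \<sigma>S: "\<sigma> \<in> SL2Z" using \<sigma> Gamma0_SL2Z by blast
  define s where "s = (\<lambda>z. g (act \<sigma> z))"
  have inv: "(chi N (A$1$1) = 1 \<longrightarrow> g (act A z) = g z \<and> s (act A z) = s z) \<and>
      (chi N (A$1$1) = -1 \<longrightarrow> g (act A z) = s z \<and> s (act A z) = g z)"
    if A: "A \<in> Gamma0 N" and z: "Im z > 0" for A z
  proof -
    have AS: "A \<in> SL2Z" using A Gamma0_SL2Z by blast
    have s: "s (act A z) = g (act (\<sigma> ** A) z)"
      unfolding s_def using act_SL2Z_mult[OF \<sigma>S AS z] by simp
    have \<sigma>z: "Im (act \<sigma> z) > 0" using \<sigma>S z by (rule Im_act_SL2Z)
    \<comment> \<open>All \<open>B\<close> of character -1 give the same value, because they lie in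
      the coset of \<open>\<sigma>\<close>.\<close>
    have via: "g (act B z) = g (act \<sigma> z)" if B: "B \<in> Gamma0 N" "chi N (B$1$1) = -1" for B
    proof -
      have "B ** adj \<sigma> \<in> Gamma1_pm N"
        using B \<sigma> chi_Gamma0_mult[OF N B(1) Gamma0_adj[OF \<sigma>(1)]] chi_adj[OF N \<sigma>(1)]
        by (simp only: Gamma1_pm_def mem_Collect_eq Gamma0_mult Gamma0_adj) simp
      then have "g (act (B ** adj \<sigma>) (act \<sigma> z)) = g (act \<sigma> z)" using \<sigma>z by (rule g_inv)
      moreover have "act (B ** adj \<sigma>) (act \<sigma> z) = act B z"
        using act_SL2Z_mult[OF Gamma0_SL2Z[OF B(1)] SL2Z_adj[OF \<sigma>S] \<sigma>z] act_adj(2)[OF \<sigma>S z] by simp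
      ultimately show ?thesis by simp
    qed
    have \<sigma>A: "\<sigma> ** A \<in> Gamma0 N" "chi N ((\<sigma> ** A)$1$1) = - chi N (A$1$1)"
      using Gamma0_mult[OF \<sigma>(1) A] chi_Gamma0_mult[OF N \<sigma>(1) A] \<sigma>(2) by simp_all
    show ?thesis
    proof (intro conjI impI)
      assume 1: "chi N (A$1$1) = 1"
      show "g (act A z) = g z" using A 1 z by (intro g_inv) (auto simp: Gamma1_pm_def)
      show "s (act A z) = s z" unfolding s using via[OF \<sigma>A(1)] \<sigma>A(2) 1 by (simp add: s_def)
    next
      assume 1: "chi N (A$1$1) = -1"
      show "g (act A z) = s z" unfolding s_def using via[OF A 1] .
      have "\<sigma> ** A \<in> Gamma1_pm N" using \<sigma>A 1 by (simp add: Gamma1_pm_def del: mat_mult_sel)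
      then show "s (act A z) = g z" unfolding s using z by (rule g_inv)
    qed
  qed
  have s_hol: "s holomorphic_on {z. Im z > 0}"
  proof -
    have "(g \<circ> act \<sigma>) holomorphic_on {z. Im z > 0}"
      using \<sigma>S by (intro holomorphic_on_compose_gen[OF act_holomorphic hol(1)]) (auto simp: SL2Z_det intro: Im_act_SL2Z)
    then show ?thesis by (simp add: s_def o_def)
  qed
  have s_bdd: "bdd_at_cusp (\<lambda>z. s (act A z))" if A: "A \<in> SL2Z" "A \<notin> Gamma0 N" for A
  proof -
    have "\<sigma> ** A \<notin> Gamma1_pm N" using A Gamma0_mult_cancel[OF \<sigma>(1), of A] by (auto simp: Gamma1_pm_def)
    then have "bdd_at_cusp (\<lambda>z. g (act (\<sigma> ** A) z))" using A \<sigma>S by (intro g_bdd SL2Z_mult)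
    then show ?thesis
      by (rule bdd_at_cusp_cong[rotated]) (use act_SL2Z_mult[OF \<sigma>S A(1)] in \<open>simp add: s_def\<close>)
  qed
  have g_bdd0: "bdd_at_cusp (\<lambda>z. g (act A z))" if "A \<in> SL2Z" "A \<notin> Gamma0 N" for A
    using that by (intro g_bdd) (auto simp: Gamma1_pm_def)
  define F where "F = (\<lambda>z. g z - h z + s z)"
  have "\<exists>c. \<forall>z. Im z > 0 \<longrightarrow> F z = c"
  proof (rule Gamma1_Liouville[of N F])
    show "N > 0" using N by auto
    show "F holomorphic_on {z. Im z > 0}" unfolding F_def by (intro holomorphic_intros hol s_hol)
    have F_inv: "F (act A z) = F z" if "A \<in> Gamma0 N" "Im z > 0" for A z
      using inv[OF that] h_inv[OF that] chi_cases[of N "A$1$1"] by (auto simp: F_def)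
    then show "F (act A z) = F z" if "A \<in> Gamma1 N" "Im z > 0" for A z
      using that by (simp add: Gamma1_def)
    show "bdd_at_cusp (\<lambda>z. F (act A z))" if A: "A \<in> SL2Z" for A
    proof (cases "A \<in> Gamma0 N")
      case True
      \<comment> \<open>\<open>\<sigma>\<close> lies outside \<open>Gamma1_pm N\<close>, so
        \<open>g\<close> has no pole at the cusp to which \<open>\<sigma>\<close> carries
        infinity.\<close>
      have "bdd_at_cusp s" unfolding s_def using \<sigma> \<sigma>S by (intro g_bdd) (auto simp: Gamma1_pm_def)
      then have "bdd_at_cusp F" unfolding F_def by (intro bdd_at_cusp_add faber_like_diff(1)[OF a(1) b(1)])
      then show ?thesis by (rule bdd_at_cusp_cong[rotated]) (simp add: F_inv[OF True])
    next
      case False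
      then show ?thesis unfolding F_def
        by (intro bdd_at_cusp_add bdd_at_cusp_diff g_bdd0 h_bdd s_bdd A)
    qed
  qed blast
  then obtain c where c: "\<And>z. Im z > 0 \<Longrightarrow> s z = c - g z + h z"
    unfolding F_def by (metis add_diff_cancel_left' diff_add_eq diff_diff_eq2)
  define f where "f = (\<lambda>z. 2 * g z - h z - c)"
  have f: "f z = g z - s z" if "Im z > 0" for z using c[OF that] by (simp add: f_def)
  have "anti_invariant N f" unfolding anti_invariant_def
  proof (intro conjI ballI allI impI)
    show "f holomorphic_on {z. Im z > 0}" unfolding f_def by (intro holomorphic_intros hol)
    show "f (act A z) = chi N (A$1$1) * f z" if A: "A \<in> Gamma0 N" "Im z > 0" for A z
    proof -
      have "Im (act A z) > 0" using A Gamma0_SL2Z Im_act_SL2Z by blast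
      then show ?thesis using inv[OF A] f A(2) chi_cases[of N "A$1$1"] by auto
    qed
    show "bdd_at_cusp (\<lambda>z. f (act A z))" if "A \<in> SL2Z" "A \<notin> Gamma0 N" for A
      unfolding f_def using that by (intro bdd_at_cusp_diff bdd_at_cusp_mult bdd_at_cusp_const g_bdd0 h_bdd)
  qed
  moreover have "faber_like f n (fps_const 2 * a - b - fps_const c)"
    unfolding f_def by (rule faber_like_diff(2)[OF a(1) b(1)])
  moreover have "fps_nth (fps_const 2 * a - b - fps_const c) m = 2 * faber_coeff t m n - faber_coeff t0 m n"
    if "m > 0" for m using that a(2) b(2) by simp
  ultimately show ?thesis by blast
qed

section \<open>Hecke operators\<close>

text \<open>The pairs (a, b) of upper entries of the triangular matrices with lower right entry d =
  n / a and 0 <= b < d; these represent the integer matrices of determinant n up to left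
  multiplication by \<open>SL2Z\<close>.\<close>

definition hecke_index :: "nat \<Rightarrow> (nat \<times> nat) set" where
  "hecke_index n = (SIGMA a:{a. a dvd n}. {..<n div a})"

definition hecke_mat :: "nat \<Rightarrow> nat \<times> nat \<Rightarrow> int^2^2" where
  "hecke_mat n i = mat2 (int (fst i)) (int (snd i)) 0 (int (n div fst i))"

lemma finite_hecke_index: "n > 0 \<Longrightarrow> finite (hecke_index n)"
  unfolding hecke_index_def by (intro finite_SigmaI) auto

lemma hecke_indexD:
  assumes "i \<in> hecke_index n" "n > 0"
  shows "fst i * (n div fst i) = n" "fst i > 0" "n div fst i > 0" "snd i < n div fst i" "fst i dvd n"
proof -
  have d: "fst i dvd n" using assms by (auto simp: hecke_index_def)
  then show "fst i * (n div fst i) = n" "fst i dvd n" by simp_all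
  then show "fst i > 0" "n div fst i > 0" using assms(2) by (auto intro: Nat.gr0I)
  show "snd i < n div fst i" using assms by (auto simp: hecke_index_def)
qed

lemma det_hecke_mat: "i \<in> hecke_index n \<Longrightarrow> n > 0 \<Longrightarrow> det (hecke_mat n i) = int n"
  using hecke_indexD(1)[of i n] by (simp add: hecke_mat_def flip: of_nat_mult)

text \<open>The bottom row (-y', x') of \<open>A\<close> annihilates the first column of
  \<open>X\<close>; a translation then reduces the upper right entry modulo the lower right
  one.\<close>

lemma hermite_form:
  assumes X: "det X = int n" and n: "n > 0"
  shows "\<exists>C\<in>SL2Z. \<exists>i\<in>hecke_index n. X = C ** hecke_mat n i"
proof -
  define x y where "x = X$1$1" and "y = X$2$1"
  define g where "g = gcd x y"
  have "x \<noteq> 0 \<or> y \<noteq> 0" using X n by (auto simp: x_def y_def det_2)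
  then have g: "g > 0" by (auto simp: g_def)
  then have "gcd x y \<noteq> 0" by (simp add: g_def)
  from gcd_coprime_exists[OF this] obtain x' y' where xy: "x = x' * g" "y = y' * g" "coprime x' y'"
    unfolding g_def by blast
  then have "coprime (- y') x'" by (simp add: coprime_commute)
  then obtain A where A: "A \<in> SL2Z" "A$2$1 = - y'" "A$2$2 = x'" by (rule SL2Z_bottom_row)
  define Z where "Z = A ** X"
  have Z21: "Z$2$1 = 0" using xy A by (simp add: Z_def x_def[symmetric] y_def[symmetric])
  have Z11: "Z$1$1 = g"
  proof -
    have "Z$1$1 = g * (A$1$1 * A$2$2 - A$1$2 * A$2$1)"
      by (simp add: Z_def x_def[symmetric] y_def[symmetric] A) (simp add: xy algebra_simps)
    then show ?thesis using A(1) by (simp add: SL2Z_iff)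
  qed
  have "det Z = int n" using X A by (simp add: Z_def det_mul SL2Z_det)
  then have gn: "g * Z$2$2 = int n" by (simp add: det_2 Z21 Z11)
  define a d where "a = nat g" and "d = nat (Z$2$2)"
  have Z22: "Z$2$2 > 0" using gn g n by (metis of_nat_0_less_iff zero_less_mult_pos)
  have "int (a * d) = int n" using gn g Z22 by (simp add: a_def d_def)
  then have ad: "a * d = n" by (simp only: of_nat_eq_iff)
  have a0: "a > 0" using g by (simp add: a_def)
  have d: "n div a = d" using ad a0 by auto
  define j where "j = Z$1$2 div int d"
  define b where "b = nat (Z$1$2 mod int d)"
  have d0: "d > 0" using Z22 by (simp add: d_def)
  have b: "int b = Z$1$2 - j * int d" "b < d"
    using d0 by (simp_all add: b_def j_def minus_div_mult_eq_mod nat_less_iff)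
  have i: "(a, b) \<in> hecke_index n" using ad b(2) d by (auto simp: hecke_index_def)
  let ?T = "mat2 1 j 0 1"
  have "Z = ?T ** hecke_mat n (a, b)"
  proof -
    have "int a = g" "int d = Z$2$2" using g Z22 by (simp_all add: a_def d_def)
    then have "hecke_mat n (a, b) = mat2 g (int b) 0 (Z$2$2)" by (simp add: hecke_mat_def d)
    moreover have "Z$1$2 = int b + j * Z$2$2" using b(1) \<open>int d = Z$2$2\<close> by simp
    ultimately show ?thesis using Z21 Z11 by (simp add: mat_eq_iff)
  qed
  then have "adj A ** Z = adj A ** (?T ** hecke_mat n (a, b))" by simp
  moreover have "adj A ** Z = X" unfolding Z_def
    using adj_left[OF A(1)] by (metis matrix_mul_assoc matrix_mul_lid)
  ultimately have "X = (adj A ** ?T) ** hecke_mat n (a, b)" by (simp add: matrix_mul_assoc)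
  moreover have "adj A ** ?T \<in> SL2Z" using A by (intro SL2Z_mult SL2Z_adj) (auto simp: SL2Z_iff)
  ultimately show ?thesis using i by blast
qed

text \<open>An \<open>SL2Z\<close> factor between two such triangular matrices is a translation,
  which moves b by a multiple of d.\<close>

lemma hermite_unique:
  assumes C: "C \<in> SL2Z" and i: "i \<in> hecke_index n" "i' \<in> hecke_index n" and n: "n > 0"
    and eq: "C ** hecke_mat n i = hecke_mat n i'"
  shows "i = i'"
proof -
  note I = hecke_indexD[OF i(1) n] hecke_indexD[OF i(2) n]
  have e: "C$1$1 * int (fst i) = int (fst i')" "C$2$1 * int (fst i) = 0"
     "C$1$1 * int (snd i) + C$1$2 * int (n div fst i) = int (snd i')"
    using eq by (simp_all add: mat_eq_iff hecke_mat_def)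
  have C21: "C$2$1 = 0" using e(2) I(2) by simp
  then have u: "C$1$1 * C$2$2 = 1" using C by (simp add: SL2Z_iff)
  have "C$1$1 > 0" using e(1) I(2,7) by (metis of_nat_0_less_iff zero_less_mult_pos2)
  then have C11: "C$1$1 = 1" using u by (simp add: zmult_eq_1_iff)
  then have f: "fst i = fst i'" using e(1) by simp
  have "int (snd i) mod int (n div fst i) = int (snd i') mod int (n div fst i)"
    using e(3) C11 by (metis mod_mult_self1 mult_1)
  then have "snd i = snd i'" using I(4,9) f by simp
  then show ?thesis using f by (simp add: prod_eq_iff)
qed

text \<open>Right multiplication permutes the classes. Two indices with the same image have
  representatives differing by a left factor in \<open>SL2Z\<close>, so
  \<open>hermite_unique\<close> gives injectivity, and finiteness the rest.\<close>

lemma hecke_permutation: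
  assumes A: "A \<in> SL2Z" and n: "n > 0"
  shows "\<exists>C \<pi>. (\<forall>i\<in>hecke_index n. C i \<in> SL2Z \<and> hecke_mat n i ** A = C i ** hecke_mat n (\<pi> i)) \<and>
    bij_betw \<pi> (hecke_index n) (hecke_index n)"
proof -
  have "\<forall>i\<in>hecke_index n. \<exists>C. \<exists>j. C \<in> SL2Z \<and> j \<in> hecke_index n \<and> hecke_mat n i ** A = C ** hecke_mat n j"
  proof
    fix i assume "i \<in> hecke_index n"
    then have "det (hecke_mat n i ** A) = int n"
      using A n by (simp add: det_mul det_hecke_mat SL2Z_det)
    from hermite_form[OF this n] show "\<exists>C. \<exists>j. C \<in> SL2Z \<and> j \<in> hecke_index n \<and> hecke_mat n i ** A = C ** hecke_mat n j"
      by blast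
  qed
  then obtain C \<pi> where "\<forall>i\<in>hecke_index n. C i \<in> SL2Z \<and> \<pi> i \<in> hecke_index n \<and>
      hecke_mat n i ** A = C i ** hecke_mat n (\<pi> i)"
    unfolding bchoice_iff by blast
  then have C: "\<And>i. i \<in> hecke_index n \<Longrightarrow> C i \<in> SL2Z"
    "\<And>i. i \<in> hecke_index n \<Longrightarrow> \<pi> i \<in> hecke_index n"
    "\<And>i. i \<in> hecke_index n \<Longrightarrow> hecke_mat n i ** A = C i ** hecke_mat n (\<pi> i)"
    by blast+
  have "inj_on \<pi> (hecke_index n)"
  proof (rule inj_onI)
    fix i j assume ij: "i \<in> hecke_index n" "j \<in> hecke_index n" "\<pi> i = \<pi> j"
    have M: "hecke_mat n l = C l ** hecke_mat n (\<pi> l) ** adj A" if "l \<in> hecke_index n" for l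
    proof -
      have "hecke_mat n l ** A ** adj A = C l ** hecke_mat n (\<pi> l) ** adj A" using C(3)[OF that] by simp
      then show ?thesis using adj_right[OF A] by (simp flip: matrix_mul_assoc)
    qed
    have "(C j ** adj (C i)) ** hecke_mat n i = C j ** (adj (C i) ** C i) ** hecke_mat n (\<pi> i) ** adj A"
      using M[OF ij(1)] by (simp add: matrix_mul_assoc)
    also have "\<dots> = hecke_mat n j" using adj_left[OF C(1)[OF ij(1)]] M[OF ij(2)] ij(3) by simp
    finally have "(C j ** adj (C i)) ** hecke_mat n i = hecke_mat n j" .
    then show "i = j"
      by (rule hermite_unique[OF SL2Z_mult[OF C(1)[OF ij(2)] SL2Z_adj[OF C(1)[OF ij(1)]]] ij(1,2) n])
  qed
  moreover have "\<pi> ` hecke_index n \<subseteq> hecke_index n" using C(2) by blast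
  ultimately have "bij_betw \<pi> (hecke_index n) (hecke_index n)"
    using endo_inj_surj[OF finite_hecke_index[OF n]] by (auto simp: bij_betw_def)
  then show ?thesis using C(1,3) by blast
qed

text \<open>Weight zero, without normalising factor. The twist by \<open>chi\<close> of the upper
  left entry offsets the character of the \<open>SL2Z\<close> factor that arises when the
  representatives are permuted.\<close>

definition hecke :: "nat \<Rightarrow> nat \<Rightarrow> (complex \<Rightarrow> complex) \<Rightarrow> complex \<Rightarrow> complex" where
  "hecke N n f z = (\<Sum>i\<in>hecke_index n. chi N (int (fst i)) * f (act (hecke_mat n i) z))"

lemma act_hecke_mat:
  "act (hecke_mat n (a, b)) z = (of_nat a * z + of_nat b) / of_nat (n div a)"
  by (simp add: act_def moebius_def hecke_mat_def)

lemma Im_act_hecke_mat: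
  assumes "i \<in> hecke_index n" "n > 0"
  shows "Im (act (hecke_mat n i) z) = real (fst i) * Im z / real (n div fst i)"
proof -
  obtain a b where i: "i = (a, b)" by (cases i)
  show ?thesis unfolding i act_hecke_mat by (simp add: Im_divide_of_nat)
qed

lemma bdd_at_cusp_hecke_mat:
  assumes i: "i \<in> hecke_index n" and n: "n > 0" and f: "bdd_at_cusp f"
  shows "bdd_at_cusp (\<lambda>z. f (act (hecke_mat n i) z))"
proof -
  note I = hecke_indexD[OF i n]
  obtain Y C where "Y > 0" and Y: "\<And>z. Im z > Y \<Longrightarrow> norm (f z) \<le> C" using bdd_at_cuspD[OF f] by blast
  have "norm (f (act (hecke_mat n i) z)) \<le> C" if "Im z > Y * real (n div fst i)" for z
  proof (rule Y)
    have "Y * real (n div fst i) > 0" using \<open>Y > 0\<close> I(3) by (intro mult_pos_pos) auto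
    then have "Im z > 0" using that by simp
    have "Y * real (n div fst i) < Im z" by (rule that)
    also have "Im z \<le> real (fst i) * Im z" using I(2) \<open>Im z > 0\<close> mult_right_mono[of 1 "real (fst i)" "Im z"] by simp
    finally show "Im (act (hecke_mat n i) z) > Y"
      using I(3) by (simp only: Im_act_hecke_mat[OF i n] pos_less_divide_eq of_nat_0_less_iff)
  qed
  then show ?thesis by (rule bdd_at_cuspI)
qed

lemma hecke_anti_invariant:
  assumes N: "N \<in> {5, 8}" and f: "anti_invariant N f" and n: "n > 0" "coprime n N"
  shows "anti_invariant N (hecke N n f)"
  unfolding anti_invariant_def
proof (intro conjI ballI allI impI)
  have f1: "f holomorphic_on {z. Im z > 0}"
    and f2: "\<And>A z. A \<in> Gamma0 N \<Longrightarrow> Im z > 0 \<Longrightarrow> f (act A z) = chi N (A$1$1) * f z"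
    and f3: "\<And>A. A \<in> SL2Z \<Longrightarrow> A \<notin> Gamma0 N \<Longrightarrow> bdd_at_cusp (\<lambda>z. f (act A z))"
    using f unfolding anti_invariant_def by blast+
  have detp: "det (hecke_mat n i) > 0" if "i \<in> hecke_index n" for i
    using det_hecke_mat[OF that n(1)] n by simp
  have imp: "Im (act (hecke_mat n i) z) > 0" if "i \<in> hecke_index n" "Im z > 0" for i z
    using that detp by (intro Im_act_pos)
  have copr: "coprime (int (fst i)) (int N)" "coprime (int (n div fst i)) (int N)" if "i \<in> hecke_index n" for i
  proof -
    have "coprime (fst i * (n div fst i)) N" using n hecke_indexD(1)[OF that n(1)] by simp
    then show "coprime (int (fst i)) (int N)" "coprime (int (n div fst i)) (int N)" by simp_all
  qed
  show "hecke N n f holomorphic_on {z. Im z > 0}"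
  proof -
    have "(\<lambda>z. f (act (hecke_mat n i) z)) holomorphic_on {z. Im z > 0}" if "i \<in> hecke_index n" for i
    proof -
      have "(f \<circ> act (hecke_mat n i)) holomorphic_on {z. Im z > 0}"
        using detp[OF that] imp[OF that] by (intro holomorphic_on_compose_gen[OF act_holomorphic f1]) auto
      then show ?thesis by (simp add: o_def)
    qed
    then show ?thesis unfolding hecke_def[abs_def] by (intro holomorphic_intros) auto
  qed
  have move: "f (act (hecke_mat n i) (act A z)) = f (act C (act (hecke_mat n j) z))"
    if "i \<in> hecke_index n" "j \<in> hecke_index n" "A \<in> SL2Z" "C \<in> SL2Z" "Im z > 0"
      "hecke_mat n i ** A = C ** hecke_mat n j" for i j A C z
  proof -
    have "act (hecke_mat n i) (act A z) = act (hecke_mat n i ** A) z"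
      using that detp by (subst act_mult) (auto simp: SL2Z_det)
    also have "\<dots> = act C (act (hecke_mat n j) z)"
      unfolding that(6) using that detp by (subst act_mult) (auto simp: SL2Z_det)
    finally show ?thesis by simp
  qed
  \<comment> \<open>Since n is prime to N, the diagonal entries are units modulo N; comparing lower
    left entries shows that passing from \<open>A\<close> to \<open>C\<close> preserves membership
    in \<open>Gamma0 N\<close>.\<close>
  have level: "C \<in> Gamma0 N \<longleftrightarrow> A \<in> Gamma0 N"
    if i: "i \<in> hecke_index n" "j \<in> hecke_index n" and A: "A \<in> SL2Z" and C: "C \<in> SL2Z"
      and eq: "hecke_mat n i ** A = C ** hecke_mat n j" for i j A C
  proof -
    have e: "int (n div fst i) * A$2$1 = C$2$1 * int (fst j)"
      using eq by (simp add: mat_eq_iff hecke_mat_def)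
    have "int N dvd C$2$1 \<longleftrightarrow> int N dvd C$2$1 * int (fst j)"
      using copr(1)[OF i(2)] by (simp add: coprime_dvd_mult_left_iff coprime_commute)
    also have "\<dots> \<longleftrightarrow> int N dvd int (n div fst i) * A$2$1" by (simp only: e)
    also have "\<dots> \<longleftrightarrow> int N dvd A$2$1"
      using copr(2)[OF i(1)] by (simp add: coprime_dvd_mult_right_iff coprime_commute)
    finally show ?thesis using A C by (simp add: Gamma0_iff)
  qed
  show "hecke N n f (act A z) = chi N (A$1$1) * hecke N n f z" if A: "A \<in> Gamma0 N" and z: "Im z > 0" for A z
  proof -
    have AS: "A \<in> SL2Z" using A Gamma0_SL2Z by blast
    obtain C \<pi> where C: "\<And>i. i \<in> hecke_index n \<Longrightarrow> C i \<in> SL2Z"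
      "\<And>i. i \<in> hecke_index n \<Longrightarrow> hecke_mat n i ** A = C i ** hecke_mat n (\<pi> i)"
      and \<pi>: "bij_betw \<pi> (hecke_index n) (hecke_index n)"
      using hecke_permutation[OF AS n(1)] by blast
    have \<pi>I: "\<pi> i \<in> hecke_index n" if "i \<in> hecke_index n" for i using bij_betwE[OF \<pi>] that by blast
    have "chi N (int (fst i)) * f (act (hecke_mat n i) (act A z)) =
        chi N (A$1$1) * (chi N (int (fst (\<pi> i))) * f (act (hecke_mat n (\<pi> i)) z))" if i: "i \<in> hecke_index n" for i
    proof -
      have CG: "C i \<in> Gamma0 N" using level[OF i \<pi>I[OF i] AS C(1)[OF i] C(2)[OF i]] A by simp
      have "f (act (hecke_mat n i) (act A z)) = chi N (C i $1$1) * f (act (hecke_mat n (\<pi> i)) z)"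
        using move[OF i \<pi>I[OF i] AS C(1)[OF i] z C(2)[OF i]] f2[OF CG imp[OF \<pi>I[OF i] z]] by simp
      moreover have "chi N (int (fst i)) * chi N (A$1$1) = chi N (C i $1$1) * chi N (int (fst (\<pi> i)))"
      proof -
        \<comment> \<open>The upper left entries are compared modulo N, where \<open>A$2$1\<close>
          vanishes.\<close>
        have e: "int (fst i) * A$1$1 + int (snd i) * A$2$1 = C i $1$1 * int (fst (\<pi> i))"
          using C(2)[OF i] by (simp add: mat_eq_iff hecke_mat_def)
        have "[int (fst i) * A$1$1 + int (snd i) * A$2$1 = int (fst i) * A$1$1 + int (snd i) * 0] (mod int N)"
          using A by (intro cong_add cong_mult cong_refl) (simp add: Gamma0_iff cong_0_iff)
        then have "chi N (int (fst i) * A$1$1) = chi N (C i $1$1 * int (fst (\<pi> i)))"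
          unfolding e by (simp add: chi_cong)
        then show ?thesis
          using chi_mult[OF N copr(1)[OF i] Gamma0_coprime(1)[OF A]]
            chi_mult[OF N Gamma0_coprime(1)[OF CG] copr(1)[OF \<pi>I[OF i]]] by simp
      qed
      \<comment> \<open>All four values are signs, so factors may change sides.\<close>
      then have "chi N (int (fst i)) * chi N (C i $1$1) = chi N (A$1$1) * chi N (int (fst (\<pi> i)))"
        using chi_cases[of N "int (fst i)"] chi_cases[of N "A$1$1"] chi_cases[of N "C i $1$1"]
          chi_cases[of N "int (fst (\<pi> i))"] by auto
      ultimately show ?thesis by (metis mult.assoc)
    qed
    then have "hecke N n f (act A z) = (\<Sum>i\<in>hecke_index n.
        chi N (A$1$1) * (chi N (int (fst (\<pi> i))) * f (act (hecke_mat n (\<pi> i)) z)))"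
      unfolding hecke_def by (rule sum.cong[OF refl])
    also have "\<dots> = chi N (A$1$1) * (\<Sum>i\<in>hecke_index n. chi N (int (fst (\<pi> i))) * f (act (hecke_mat n (\<pi> i)) z))"
      by (simp only: sum_distrib_left)
    also have "(\<Sum>i\<in>hecke_index n. chi N (int (fst (\<pi> i))) * f (act (hecke_mat n (\<pi> i)) z)) = hecke N n f z"
      unfolding hecke_def by (rule sum.reindex_bij_betw[OF \<pi>])
    finally show ?thesis .
  qed
  show "bdd_at_cusp (\<lambda>z. hecke N n f (act A z))" if A: "A \<in> SL2Z" "A \<notin> Gamma0 N" for A
  proof -
    obtain C \<pi> where C: "\<And>i. i \<in> hecke_index n \<Longrightarrow> C i \<in> SL2Z"
      "\<And>i. i \<in> hecke_index n \<Longrightarrow> hecke_mat n i ** A = C i ** hecke_mat n (\<pi> i)"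
      and \<pi>: "bij_betw \<pi> (hecke_index n) (hecke_index n)"
      using hecke_permutation[OF A(1) n(1)] by blast
    have \<pi>I: "\<pi> i \<in> hecke_index n" if "i \<in> hecke_index n" for i using bij_betwE[OF \<pi>] that by blast
    have "bdd_at_cusp (\<lambda>z. f (act (hecke_mat n i) (act A z)))" if i: "i \<in> hecke_index n" for i
    proof -
      \<comment> \<open>By \<open>level\<close> the cusps occurring in the sum are again
        inequivalent to infinity, so each summand is bounded.\<close>
      have "C i \<notin> Gamma0 N" using level[OF i \<pi>I[OF i] A(1) C(1)[OF i] C(2)[OF i]] A by simp
      then have "bdd_at_cusp (\<lambda>z. f (act (C i) (act (hecke_mat n (\<pi> i)) z)))"
        by (intro bdd_at_cusp_hecke_mat[OF \<pi>I[OF i] n(1), of "\<lambda>z. f (act (C i) z)"] f3 C(1)[OF i])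
      then show ?thesis
        by (rule bdd_at_cusp_cong[rotated]) (use move[OF i \<pi>I[OF i] A(1) C(1)[OF i] _ C(2)[OF i]] in simp)
    qed
    then show ?thesis unfolding hecke_def
      by (intro bdd_at_cusp_sum bdd_at_cusp_mult bdd_at_cusp_const)
  qed
qed

section \<open>Coefficients under Hecke operators\<close>

definition root_of_unity :: "nat \<Rightarrow> complex" where
  "root_of_unity d = exp (2 * of_real pi * \<i> / of_nat d)"

lemma root_of_unity_power_eq_1: "d > 0 \<Longrightarrow> root_of_unity d ^ j = 1 \<longleftrightarrow> d dvd j"
  using complex_root_unity_eq_1[of d j]
  by (simp add: root_of_unity_def exp_of_nat_mult[symmetric] mult_ac)

lemma root_of_unity_nonzero [simp]: "root_of_unity d \<noteq> 0"
  by (simp add: root_of_unity_def)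

lemma sum_powers_root:
  fixes x :: complex
  assumes "x ^ d = 1"
  shows "(\<Sum>b<d. x ^ b) = (if x = 1 then of_nat d else 0)"
  using assms by (simp add: geometric_sum)

lemma sum_roots_of_unity:
  assumes d: "d > 0"
  shows "(\<Sum>b<d. (root_of_unity d ^ b) ^ j) = (if d dvd j then of_nat d else 0)"
    and "(\<Sum>b<d. inverse ((root_of_unity d ^ b) ^ j)) = (if d dvd j then of_nat d else 0)"
proof -
  let ?x = "root_of_unity d ^ j"
  have 1: "?x ^ d = 1" using root_of_unity_power_eq_1[OF d, of "j * d"] by (simp add: power_mult)
  have 2: "?x = 1 \<longleftrightarrow> d dvd j" by (rule root_of_unity_power_eq_1[OF d])
  have comm: "(root_of_unity d ^ b) ^ j = ?x ^ b" for b by (simp add: mult.commute flip: power_mult)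
  show "(\<Sum>b<d. (root_of_unity d ^ b) ^ j) = (if d dvd j then of_nat d else 0)"
    unfolding comm using sum_powers_root[OF 1] 2 by simp
  have "inverse ?x ^ d = 1" using 1 by (simp add: power_inverse)
  from sum_powers_root[OF this] 2
  show "(\<Sum>b<d. inverse ((root_of_unity d ^ b) ^ j)) = (if d dvd j then of_nat d else 0)"
    unfolding comm by (simp add: power_inverse inverse_eq_1_iff)
qed

text \<open>\<open>qpar d (of_nat a * z)\<close> is a d-th root of q^a, and adding b multiplies it
  by a power of a primitive d-th root of unity.\<close>

lemma qpar_hecke:
  assumes "d > 0"
  shows "qpar 1 ((of_nat a * z + of_nat b) / of_nat d) = qpar d (of_nat a * z) * root_of_unity d ^ b"
    and "qpar d (of_nat a * z) ^ d = qpar 1 z ^ a"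
proof -
  have e: "2 * of_real pi * \<i> * ((of_nat a * z + of_nat b) / of_nat d) / of_nat 1 =
      2 * of_real pi * \<i> * (of_nat a * z) / of_nat d + of_nat b * (2 * of_real pi * \<i> / of_nat d)"
    using assms by (simp add: field_simps)
  show "qpar 1 ((of_nat a * z + of_nat b) / of_nat d) = qpar d (of_nat a * z) * root_of_unity d ^ b"
    unfolding qpar_def root_of_unity_def e by (simp only: exp_add exp_of_nat_mult)
  have "qpar d (of_nat a * z) ^ d = exp (of_nat d * (2 * of_real pi * \<i> * (of_nat a * z) / of_nat d))"
    unfolding qpar_def by (simp only: exp_of_nat_mult)
  also have "of_nat d * (2 * of_real pi * \<i> * (of_nat a * z) / of_nat d) = of_nat a * (2 * of_real pi * \<i> * z / of_nat 1)"
    using assms by (simp add: field_simps)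
  also have "exp \<dots> = qpar 1 z ^ a" unfolding qpar_def by (simp only: exp_of_nat_mult)
  finally show "qpar d (of_nat a * z) ^ d = qpar 1 z ^ a" .
qed

text \<open>Summation over b keeps the exponents divisible by d, each with factor d. The d-th root
  of q^a then occurs in powers of q^a only, so the coefficient of index d i moves to exponent a
  i.\<close>

lemma hecke_block_sums:
  fixes g :: "complex fps"
  assumes a: "a > 0" and d: "d > 0"
    and conv: "\<And>b. b < d \<Longrightarrow> ereal (norm (qpar 1 ((of_nat a * z + of_nat b) / of_nat d))) < fps_conv_radius g"
  shows "(\<lambda>m. (if a dvd m then of_nat d * fps_nth g (d * (m div a)) else 0) * qpar 1 z ^ m) sums
    (\<Sum>b<d. eval_fps g (qpar 1 ((of_nat a * z + of_nat b) / of_nat d)))"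
proof -
  let ?w = "\<lambda>b. qpar 1 ((of_nat a * z + of_nat b) / of_nat d)"
  let ?S = "\<Sum>b<d. eval_fps g (?w b)"
  let ?Q = "qpar d (of_nat a * z)"
  have "(\<lambda>j. \<Sum>b<d. fps_nth g j * ?w b ^ j) sums ?S"
    by (intro sums_sum sums_eval_fps conv) simp
  moreover have "(\<Sum>b<d. fps_nth g j * ?w b ^ j) = (if d dvd j then of_nat d * fps_nth g j * ?Q ^ j else 0)" for j
  proof -
    have "(\<Sum>b<d. fps_nth g j * ?w b ^ j) = fps_nth g j * ?Q ^ j * (\<Sum>b<d. (root_of_unity d ^ b) ^ j)"
      unfolding qpar_hecke(1)[OF d] power_mult_distrib sum_distrib_left by (simp only: mult.assoc)
    then show ?thesis unfolding sum_roots_of_unity(1)[OF d] by simp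
  qed
  ultimately have 1: "(\<lambda>j. if d dvd j then of_nat d * fps_nth g j * ?Q ^ j else 0) sums ?S" by simp
  have "(\<lambda>i. if d dvd d * i then of_nat d * fps_nth g (d * i) * ?Q ^ (d * i) else 0) sums ?S"
    by (subst sums_mono_reindex[of "\<lambda>i. d * i"]) (use 1 d in \<open>auto simp: strict_mono_def dvd_def\<close>)
  then have 2: "(\<lambda>i. of_nat d * fps_nth g (d * i) * qpar 1 z ^ (a * i)) sums ?S"
    by (simp add: power_mult qpar_hecke(2)[OF d])
  let ?h = "\<lambda>m. (if a dvd m then of_nat d * fps_nth g (d * (m div a)) else 0) * qpar 1 z ^ m"
  have "(\<lambda>i. ?h (a * i)) sums ?S" using 2 a by simp
  then show ?thesis
    by (subst (asm) sums_mono_reindex[of "\<lambda>i. a * i"]) (use a in \<open>auto simp: strict_mono_def dvd_def\<close>)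
qed

text \<open>No point of the half plane maps to q = 0, so the value is prescribed off 0 only and the
  comparison goes through Laurent expansions at 0.\<close>

lemma power_series_constant:
  fixes C :: "nat \<Rightarrow> complex"
  assumes r: "r > 0" and s: "\<And>q. q \<noteq> 0 \<Longrightarrow> norm q < r \<Longrightarrow> (\<lambda>m. C m * q ^ m) sums c" and m: "m > 0"
  shows "C m = 0"
proof -
  define F where "F = Abs_fps C"
  have ev: "eval_fps F q = c" if "q \<noteq> 0" "norm q < r" for q
    using s[OF that] by (simp add: eval_fps_def F_def sums_iff)
  have "fps_conv_radius F \<ge> ereal (r / 2)"
  proof -
    have "summable (\<lambda>m. C m * of_real (r / 2) ^ m)" using s[of "of_real (r/2)"] r by (auto simp: sums_iff)
    from conv_radius_geI[OF this] show ?thesis using r by (simp add: F_def fps_conv_radius_def)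
  qed
  then have rad: "fps_conv_radius F > 0" using r by (auto intro: less_le_trans[of _ "ereal (r/2)"])
  have "eval_fps F has_laurent_expansion fps_to_fls F"
    by (rule has_laurent_expansion_fps) (use rad in \<open>auto simp: has_fps_expansion_def\<close>)
  moreover have "eventually (\<lambda>q. eval_fps F q = c) (at 0)"
    unfolding eventually_at using r ev by (auto simp: dist_norm)
  ultimately have "(\<lambda>_. c) has_laurent_expansion fps_to_fls F"
    using has_laurent_expansion_cong[of "eval_fps F" "\<lambda>_. c"] by simp
  then have "fps_to_fls F = fls_const c"
    using has_laurent_expansion_const by (rule has_laurent_expansion_unique)
  then have "fls_nth (fps_to_fls F) (int m) = fls_nth (fls_const c) (int m)" by simp
  then show ?thesis using m by (simp add: F_def)
qed

text \<open>In the polar part the block of a contributes only if d = n / a divides M; as d divides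
  n, which is prime to M, only a = n remains. Hence T_n f - n chi(n) f' is bounded at all cusps, so
  constant, and its coefficients of positive index vanish. Division by n turns the factor d into
  1/a.\<close>

theorem hecke_relation:
  assumes N: "N \<in> {5, 8}" and f: "anti_invariant N f" "faber_like f M g"
    and f': "anti_invariant N f'" "faber_like f' (M * n) g'"
    and n: "n > 0" "coprime n N" and M: "M > 0" "coprime n M" and m: "m > 0"
  shows "fps_nth g' m = chi N (int n) *
    (\<Sum>a | a dvd n \<and> a dvd m. chi N (int a) / of_nat a * fps_nth g ((n div a) * (m div a)))"
proof -
  obtain Y where g: "fps_conv_radius g > 0"
    and Y: "\<And>z. Im z > Y \<Longrightarrow> f z = inverse (qpar 1 z ^ M) / of_nat M + eval_fps g (qpar 1 z)"
    using f(2) unfolding faber_like_def by blast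
  obtain Y' where g': "fps_conv_radius g' > 0"
    and Y': "\<And>z. Im z > Y' \<Longrightarrow> f' z = inverse (qpar 1 z ^ (M * n)) / of_nat (M * n) + eval_fps g' (qpar 1 z)"
    using f'(2) unfolding faber_like_def by blast
  obtain r where r: "r > 0" "ereal r < fps_conv_radius g" "ereal r < fps_conv_radius g'"
    using g g' ereal_dense2[of 0 "min (fps_conv_radius g) (fps_conv_radius g')"] by auto
  obtain Yr where Yr: "\<And>z. Im z > Yr \<Longrightarrow> norm (qpar 1 z) < r" using qpar_small[of 1 r] r(1) by auto
  \<comment> \<open>A positive height above all thresholds. The points (a z + b) / d have height at
    least Im z / n, so Im z > Z n keeps all of them above Z.\<close>
  define Z where "Z = max 1 (max Yr (max Y Y'))"
  have fin: "finite {a. a dvd n}" using n by auto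
  let ?w = "\<lambda>a b z. (of_nat a * z + of_nat b) / of_nat (n div a) :: complex"
  have dpos: "n div a > 0" "a > 0" if "a dvd n" for a
    using that n by (auto intro: Nat.gr0I)
  have wZ: "Im (?w a b z) > Z" if "a dvd n" "Im z > Z * real n" for a b z
  proof -
    note ap = dpos[OF that(1)]
    have "Z \<ge> 1" by (simp add: Z_def)
    then have "Z * real n \<ge> 0" by simp
    then have z: "Im z > 0" using that(2) by linarith
    have "n div a \<le> n" by simp
    then have "Z * real (n div a) \<le> Z * real n" using \<open>Z \<ge> 1\<close> by (intro mult_left_mono) auto
    also have "\<dots> < Im z" by (rule that)
    also have "Im z \<le> real a * Im z" using ap(2) z mult_right_mono[of 1 "real a" "Im z"] by simp
    finally have "Z < real a * Im z / real (n div a)" using ap(1) by (simp only: pos_less_divide_eq of_nat_0_less_iff)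
    then show ?thesis by (simp add: Im_divide_of_nat)
  qed
  define E where "E = (\<lambda>z. (\<Sum>a | a dvd n. chi N (int a) * (\<Sum>b<n div a. eval_fps g (qpar 1 (?w a b z)))))"
  have hecke_eq: "hecke N n f z = chi N (int n) * inverse (qpar 1 z ^ (M * n)) / of_nat M + E z"
    if z: "Im z > Z * real n" for z
  proof -
    have "hecke N n f z = (\<Sum>(a,b)\<in>(SIGMA a:{a. a dvd n}. {..<n div a}). chi N (int a) * f (?w a b z))"
      unfolding hecke_def hecke_index_def by (intro sum.cong refl) (auto simp: act_hecke_mat)
    also have "\<dots> = (\<Sum>a | a dvd n. \<Sum>b<n div a. chi N (int a) * f (?w a b z))"
      by (subst sum.Sigma) (use fin in auto)
    also have "\<dots> = (\<Sum>a | a dvd n. chi N (int a) * (\<Sum>b<n div a. inverse (qpar 1 (?w a b z) ^ M) / of_nat M + eval_fps g (qpar 1 (?w a b z))))"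
    proof (intro sum.cong refl)
      fix a assume a: "a \<in> {a. a dvd n}"
      have "f (?w a b z) = inverse (qpar 1 (?w a b z) ^ M) / of_nat M + eval_fps g (qpar 1 (?w a b z))" for b
        using wZ[of a z b] a z by (intro Y) (simp add: Z_def)
      then show "(\<Sum>b<n div a. chi N (int a) * f (?w a b z)) =
          chi N (int a) * (\<Sum>b<n div a. inverse (qpar 1 (?w a b z) ^ M) / of_nat M + eval_fps g (qpar 1 (?w a b z)))"
        by (simp only: sum_distrib_left)
    qed
    also have "\<dots> = (\<Sum>a | a dvd n. chi N (int a) * ((\<Sum>b<n div a. inverse (qpar 1 (?w a b z) ^ M)) / of_nat M)) + E z"
      unfolding E_def by (simp only: sum.distrib distrib_left sum_divide_distrib)
    also have "(\<Sum>a | a dvd n. chi N (int a) * ((\<Sum>b<n div a. inverse (qpar 1 (?w a b z) ^ M)) / of_nat M)) =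
        (\<Sum>a | a dvd n. if a = n then chi N (int n) * inverse (qpar 1 z ^ (M * n)) / of_nat M else 0)"
    proof (intro sum.cong refl)
      fix a assume "a \<in> {a. a dvd n}"
      then have a: "a dvd n" by simp
      let ?d = "n div a"
      have d: "?d > 0" using dpos[OF a] by simp
      have "(\<Sum>b<?d. inverse (qpar 1 (?w a b z) ^ M)) = inverse (qpar ?d (of_nat a * z) ^ M) * (\<Sum>b<?d. inverse ((root_of_unity ?d ^ b) ^ M))"
        unfolding qpar_hecke(1)[OF d] power_mult_distrib inverse_mult_distrib sum_distrib_left ..
      also have "\<dots> = inverse (qpar ?d (of_nat a * z) ^ M) * (if ?d dvd M then of_nat ?d else 0)"
        by (simp only: sum_roots_of_unity(2)[OF d])
      finally have e: "(\<Sum>b<?d. inverse (qpar 1 (?w a b z) ^ M)) = inverse (qpar ?d (of_nat a * z) ^ M) * (if ?d dvd M then of_nat ?d else 0)" .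
      have dn: "?d dvd n" using a by (metis dvd_div_mult_self dvd_triv_left)
      have "?d dvd M \<longleftrightarrow> a = n"
      proof
        assume "?d dvd M"
        then have "is_unit ?d" using M(2) dn coprime_common_divisor by blast
        then have "?d = 1" by simp
        then show "a = n" using a by (metis dvd_div_mult_self mult_1)
      qed (use n in simp)
      moreover have "qpar 1 (of_nat n * z) = qpar 1 z ^ n" using qpar_hecke(2)[of 1 n z] by simp
      ultimately show "chi N (int a) * ((\<Sum>b<?d. inverse (qpar 1 (?w a b z) ^ M)) / of_nat M) =
          (if a = n then chi N (int n) * inverse (qpar 1 z ^ (M * n)) / of_nat M else 0)"
        unfolding e using n by (auto simp: mult.commute[of M n] simp flip: power_mult)
    qed
    also have "\<dots> = chi N (int n) * inverse (qpar 1 z ^ (M * n)) / of_nat M"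
      using fin by (simp add: sum.delta)
    finally show ?thesis .
  qed
  \<comment> \<open>The factor n balances the 1 / (M n) in the polar term of \<open>f'\<close>
    against the 1 / M in that of the transform.\<close>
  define F where "F = (\<lambda>z. hecke N n f z - of_nat n * chi N (int n) * f' z)"
  have F_eq: "F z = E z - of_nat n * chi N (int n) * eval_fps g' (qpar 1 z)" if z: "Im z > Z * real n" for z
  proof -
    have "Z * 1 \<le> Z * real n" using n by (intro mult_left_mono) (auto simp: Z_def)
    then have "Im z > Y'" using z by (simp add: Z_def)
    have "of_nat n * x * (Q / of_nat (M * n) + e) = x * Q / of_nat M + of_nat n * x * e" for x Q e :: complex
      using n M by (simp add: field_simps)
    then show ?thesis unfolding F_def hecke_eq[OF z] Y'[OF \<open>Im z > Y'\<close>] by simp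
  qed
  have T: "anti_invariant N (hecke N n f)" by (rule hecke_anti_invariant[OF N f(1) n])
  have Fhol: "F holomorphic_on {z. Im z > 0}" unfolding F_def
    using T f'(1) unfolding anti_invariant_def by (intro holomorphic_intros) auto
  have F_chi: "F (act A z) = chi N (A$1$1) * F z" if "A \<in> Gamma0 N" "Im z > 0" for A z
    using T f'(1) that unfolding anti_invariant_def F_def by (simp add: algebra_simps)
  have F_inf: "bdd_at_cusp F"
  proof -
    have "bdd_at_cusp (\<lambda>z. eval_fps g (qpar 1 (?w a b z)))" if "a dvd n" "b < n div a" for a b
      using bdd_at_cusp_hecke_mat[OF _ n(1) bdd_eval_fps_qpar[OF g], of "(a, b)"] that
      by (simp add: hecke_index_def act_hecke_mat)
    then have "bdd_at_cusp (\<lambda>z. E z - of_nat n * chi N (int n) * eval_fps g' (qpar 1 z))"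
      unfolding E_def by (intro bdd_at_cusp_diff bdd_at_cusp_sum bdd_at_cusp_mult bdd_at_cusp_const bdd_eval_fps_qpar g') auto
    then obtain Y1 C where "\<And>z. Im z > Y1 \<Longrightarrow> norm (E z - of_nat n * chi N (int n) * eval_fps g' (qpar 1 z)) \<le> C"
      unfolding bdd_at_cusp_def by blast
    then show ?thesis by (intro bdd_at_cuspI[of "max Y1 (Z * real n)" _ C]) (simp add: F_eq)
  qed
  have "\<exists>c. \<forall>z. Im z > 0 \<longrightarrow> F z = c"
  proof (rule Gamma1_Liouville[of N F])
    show "N > 0" using N by auto
    show "F (act A z) = F z" if "A \<in> Gamma1 N" "Im z > 0" for A z
      using F_chi[of A z] that chi_cong[of "A$1$1" 1 N] chi_one by (simp add: Gamma1_def)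
    show "bdd_at_cusp (\<lambda>z. F (act A z))" if A: "A \<in> SL2Z" for A
    proof (cases "A \<in> Gamma0 N")
      case True
      have "bdd_at_cusp (\<lambda>z. chi N (A$1$1) * F z)" by (intro bdd_at_cusp_mult bdd_at_cusp_const F_inf)
      then show ?thesis by (rule bdd_at_cusp_cong[rotated]) (simp add: F_chi[OF True])
    next
      case False
      then show ?thesis using T f'(1) A unfolding anti_invariant_def F_def
        by (intro bdd_at_cusp_diff bdd_at_cusp_mult bdd_at_cusp_const) auto
    qed
  qed (use Fhol in blast)+
  then obtain c where c: "\<And>z. Im z > 0 \<Longrightarrow> F z = c" by blast
  define C where "C = (\<lambda>m. (\<Sum>a | a dvd n. chi N (int a) *
      (if a dvd m then of_nat (n div a) * fps_nth g ((n div a) * (m div a)) else 0))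
      - of_nat n * chi N (int n) * fps_nth g' m)"
  have sums: "(\<lambda>m. C m * qpar 1 z ^ m) sums c" if z: "Im z > Z * real n" for z
  proof -
    have "Z * 1 \<le> Z * real n" using n by (intro mult_left_mono) (auto simp: Z_def)
    then have z1: "Im z > Z" using z by simp
    have "(\<lambda>m. \<Sum>a | a dvd n. chi N (int a) *
        ((if a dvd m then of_nat (n div a) * fps_nth g ((n div a) * (m div a)) else 0) * qpar 1 z ^ m)) sums E z"
      unfolding E_def
    proof (intro sums_sum sums_mult hecke_block_sums)
      fix a b assume "a \<in> {a. a dvd n}" "b < n div a"
      then have "norm (qpar 1 (?w a b z)) < r" using wZ[of a z b] z by (intro Yr) (simp add: Z_def)
      then show "ereal (norm (qpar 1 (?w a b z))) < fps_conv_radius g"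
        using r(2) order.strict_trans[of "ereal (norm (qpar 1 (?w a b z)))" "ereal r"] by simp
    qed (use dpos in auto)
    moreover have "(\<lambda>m. of_nat n * chi N (int n) * (fps_nth g' m * qpar 1 z ^ m)) sums
        (of_nat n * chi N (int n) * eval_fps g' (qpar 1 z))"
    proof (intro sums_mult sums_eval_fps)
      have "norm (qpar 1 z) < r" using z1 by (intro Yr) (simp add: Z_def)
      then show "ereal (norm (qpar 1 z)) < fps_conv_radius g'"
        using r(3) order.strict_trans[of "ereal (norm (qpar 1 z))" "ereal r"] by simp
    qed
    ultimately have "(\<lambda>m. (\<Sum>a | a dvd n. chi N (int a) *
        ((if a dvd m then of_nat (n div a) * fps_nth g ((n div a) * (m div a)) else 0) * qpar 1 z ^ m)) -
        of_nat n * chi N (int n) * (fps_nth g' m * qpar 1 z ^ m)) sums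
        (E z - of_nat n * chi N (int n) * eval_fps g' (qpar 1 z))" by (rule sums_diff)
    moreover have "E z - of_nat n * chi N (int n) * eval_fps g' (qpar 1 z) = c"
      using F_eq[OF z] c[of z] z1 by (simp add: Z_def)
    moreover have "(\<Sum>a | a dvd n. chi N (int a) *
        ((if a dvd m then of_nat (n div a) * fps_nth g ((n div a) * (m div a)) else 0) * qpar 1 z ^ m)) -
        of_nat n * chi N (int n) * (fps_nth g' m * qpar 1 z ^ m) = C m * qpar 1 z ^ m" for m
      unfolding C_def left_diff_distrib sum_distrib_right by (simp only: mult.assoc)
    ultimately show ?thesis by (simp only:)
  qed
  obtain r1 where r1: "r1 > 0" "\<And>z. norm (qpar 1 z) < r1 \<Longrightarrow> Im z > Z * real n"
    using qpar_large[of 1 "Z * real n"] by auto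
  have "C m = 0"
  proof (rule power_series_constant[OF r1(1) _ m])
    fix q :: complex assume q: "q \<noteq> 0" "norm q < r1"
    obtain z where "qpar 1 z = q" using qpar_surj[OF zero_less_one q(1)] by blast
    then show "(\<lambda>m. C m * q ^ m) sums c" using sums[of z] r1(2)[of z] q by simp
  qed
  moreover have "(\<Sum>a | a dvd n. chi N (int a) *
      (if a dvd m then of_nat (n div a) * fps_nth g ((n div a) * (m div a)) else 0)) =
      of_nat n * (\<Sum>a | a dvd n \<and> a dvd m. chi N (int a) / of_nat a * fps_nth g ((n div a) * (m div a)))"
  proof -
    have "(\<Sum>a | a dvd n. chi N (int a) *
      (if a dvd m then of_nat (n div a) * fps_nth g ((n div a) * (m div a)) else 0)) =
      (\<Sum>a | a dvd n \<and> a dvd m. chi N (int a) * (of_nat (n div a) * fps_nth g ((n div a) * (m div a))))"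
      using fin by (intro sum.mono_neutral_cong_right) auto
    also have "\<dots> = (\<Sum>a | a dvd n \<and> a dvd m. of_nat n * (chi N (int a) / of_nat a * fps_nth g ((n div a) * (m div a))))"
    proof (intro sum.cong refl)
      fix a assume "a \<in> {a. a dvd n \<and> a dvd m}"
      then have a: "a dvd n" by simp
      have "of_nat (n div a) = (of_nat n / of_nat a :: complex)"
        using a dpos(2)[OF a] by (auto elim!: dvdE)
      then show "chi N (int a) * (of_nat (n div a) * fps_nth g ((n div a) * (m div a))) =
        of_nat n * (chi N (int a) / of_nat a * fps_nth g ((n div a) * (m div a)))" by simp
    qed
    finally show ?thesis by (simp only: sum_distrib_left)
  qed
  ultimately have "of_nat n * (\<Sum>a | a dvd n \<and> a dvd m. chi N (int a) / of_nat a * fps_nth g ((n div a) * (m div a))) =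
      of_nat n * (chi N (int n) * fps_nth g' m)" by (simp add: C_def mult.assoc)
  then have "(\<Sum>a | a dvd n \<and> a dvd m. chi N (int a) / of_nat a * fps_nth g ((n div a) * (m div a))) = chi N (int n) * fps_nth g' m"
    using n by simp
  then show ?thesis by (simp flip: mult.assoc)
qed

section \<open>Comparison of index pairs with equal product and gcd\<close>

lemma pm1_coprime:
  assumes "pm1 N a" shows "coprime a (int N)"
proof -
  have "coprime a (int N) \<longleftrightarrow> coprime b (int N)" if "[a = b] (mod int N)" for b
    using that cong_imp_coprime cong_sym by metis
  then show ?thesis using assms unfolding pm1_def by fastforce
qed

lemma coprime_level_iff:
  fixes N p x :: nat
  assumes "N \<in> {5, 8}" "p = (if N = 5 then 5 else 2)"
  shows "coprime x N \<longleftrightarrow> \<not> p dvd x"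
proof -
  have p: "prime p" using assms by auto
  have "\<exists>e>0. N = p ^ e" using assms by (cases "N = 5") (auto intro: exI[of _ 1] exI[of _ 3])
  then obtain e where "e > 0" "N = p ^ e" by blast
  then have "coprime x N \<longleftrightarrow> coprime x p" by simp
  also have "\<dots> \<longleftrightarrow> \<not> p dvd x" using p by (metis coprime_commute prime_imp_coprime coprime_absorb_left not_prime_unit)
  finally show ?thesis .
qed

theorem theorem4:
  fixes N p k a b c d :: nat and t t0 :: "complex \<Rightarrow> complex"
  assumes "N \<in> {5, 8}" and "p = (if N = 5 then 5 else 2)"
    and "is_hauptmodul (Gamma1 N) t" and "is_hauptmodul (Gamma0 N) t0"
    and "a > 0" "b > 0" "c > 0" "d > 0"
    and "a * b = c * d" and "gcd a b = gcd c d"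
    and "p ^ k dvd gcd a b" and "\<not> p ^ Suc k dvd gcd a b"
  shows "psi N p k a b * (2 * faber_coeff t a b - faber_coeff t0 a b) =
         psi N p k c d * (2 * faber_coeff t c d - faber_coeff t0 c d)"
proof -
  note N = assms(1)
  have p: "p > 1" "prime p" using assms(1,2) by auto
  have pk: "p ^ k > 0" using p by simp
  define H where "H = (\<lambda>m n. 2 * faber_coeff t m n - faber_coeff t0 m n)"
  \<comment> \<open>The sum in \<open>hecke_relation\<close> for M = p^k sees m and n only through s
    = m n and their gcd, because (n / e)(m / e) = s / e^2.\<close>
  define K where "K = (\<lambda>s \<gamma>. \<Sum>e | e dvd \<gamma>. chi N (int e) / of_nat e * H (p ^ k * (s div (e * e))) (p ^ k))"
  have H_sym: "H m n = H n m" if "m > 0" "n > 0" for m n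
    using hauptmodul_faber(2)[OF assms(3) that] hauptmodul_faber(2)[OF assms(4) that] by (simp add: H_def)
  have cop: "coprime x N \<longleftrightarrow> \<not> p dvd x" for x by (rule coprime_level_iff[OF assms(1,2)])
  have H_K: "H (p ^ k * m) (p ^ k * n) = chi N (int n) * K (m * n) (gcd m n)"
    if m: "m > 0" and n: "n > 0" "\<not> p dvd n" for m n
  proof -
    obtain f g where f: "anti_invariant N f" "faber_like f (p ^ k) g" "\<forall>m>0. fps_nth g m = H m (p ^ k)"
      using hauptmodul_anti_invariant[OF assms(1,3,4)] unfolding H_def by blast
    obtain f' g' where f': "anti_invariant N f'" "faber_like f' (p ^ k * n) g'" "\<forall>m>0. fps_nth g' m = H m (p ^ k * n)"
      using hauptmodul_anti_invariant[OF assms(1,3,4)] unfolding H_def by blast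
    have nN: "coprime n N" using n cop by simp
    have np: "coprime n (p ^ k)"
      using n p by (metis coprime_commute coprime_power_left_iff prime_imp_coprime)
    have "H (p ^ k * m) (p ^ k * n) = chi N (int n) *
      (\<Sum>e | e dvd n \<and> e dvd p ^ k * m. chi N (int e) / of_nat e * fps_nth g ((n div e) * (p ^ k * m div e)))"
      using hecke_relation[OF N f(1,2) f'(1,2) n(1) nN pk np] f'(3) m pk by simp
    also have "(\<Sum>e | e dvd n \<and> e dvd p ^ k * m. chi N (int e) / of_nat e * fps_nth g ((n div e) * (p ^ k * m div e))) =
      K (m * n) (gcd m n)"
      unfolding K_def
    proof (intro sum.cong)
      \<comment> \<open>A divisor of \<open>n\<close> is prime to p, so the factor p^k adds no
        common divisors.\<close>
      have "e dvd p ^ k * m \<longleftrightarrow> e dvd m" if "e dvd n" for e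
      proof -
        have "coprime e (p ^ k)" using np that by (meson coprime_divisors dvd_refl)
        then show ?thesis by (rule coprime_dvd_mult_right_iff)
      qed
      then show "{e. e dvd n \<and> e dvd p ^ k * m} = {e. e dvd gcd m n}" by auto
    next
      fix e assume "e \<in> {e. e dvd gcd m n}"
      then obtain m' n' where e: "m = e * m'" "n = e * n'" by (auto elim!: dvdE)
      have e0: "e > 0" "m' > 0" "n' > 0" using e m n by (auto intro: Nat.gr0I)
      have "(n div e) * (p ^ k * m div e) = p ^ k * (m' * n')"
        using e e0 by (simp add: mult.left_commute[of "p ^ k" e])
      moreover have "m * n div (e * e) = m' * n'" using e e0 by (simp add: mult_ac)
      moreover have "fps_nth g (p ^ k * (m' * n')) = H (p ^ k * (m' * n')) (p ^ k)"
        using f(3) e0 pk by simp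
      ultimately show "chi N (int e) / of_nat e * fps_nth g ((n div e) * (p ^ k * m div e)) =
          chi N (int e) / of_nat e * H (p ^ k * (m * n div (e * e))) (p ^ k)" by simp
    qed
    finally show ?thesis .
  qed
  have psi: "psi N p k x y = (if pm1 N (int (x div p ^ k)) \<or> pm1 N (int (y div p ^ k)) then 1 else -1)" for x y
    unfolding psi_def pm1_def by simp
  have key1: "psi N p k (p ^ k * m) (p ^ k * n) * H (p ^ k * m) (p ^ k * n) = K (m * n) (gcd m n)"
    if mn: "m > 0" "n > 0" "\<not> p dvd n" for m n
  proof -
    have ps: "psi N p k (p ^ k * m) (p ^ k * n) = (if pm1 N (int m) \<or> pm1 N (int n) then 1 else -1)"
      using pk by (simp add: psi)
    show ?thesis
    proof (cases "p dvd m")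
      case True
      \<comment> \<open>A multiple of p is not a unit modulo N, let alone +-1, so \<open>psi\<close>
        reduces to \<open>chi\<close> of \<open>n\<close>.\<close>
      then have "\<not> pm1 N (int m)" using pm1_coprime[of N "int m"] cop[of m] by auto
      then have "psi N p k (p ^ k * m) (p ^ k * n) = chi N (int n)" by (simp add: ps chi_def)
      then show ?thesis using H_K[OF mn] by (simp flip: mult.assoc)
    next
      case False
      have "H (p ^ k * m) (p ^ k * n) = H (p ^ k * n) (p ^ k * m)" using mn pk by (intro H_sym) auto
      also have "\<dots> = chi N (int m) * K (m * n) (gcd m n)"
        using H_K[OF mn(2,1) False] by (simp only: mult.commute[of n m] gcd.commute[of n m])
      \<comment> \<open>Different characters force \<open>K\<close> to vanish; equal ones make
        \<open>psi\<close> their common value.\<close>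
      finally have "chi N (int m) * K (m * n) (gcd m n) = chi N (int n) * K (m * n) (gcd m n)"
        using H_K[OF mn] by (simp only:)
      then show ?thesis unfolding H_K[OF mn] ps chi_def by (auto split: if_splits)
    qed
  qed
  have key: "psi N p k (p ^ k * m) (p ^ k * n) * H (p ^ k * m) (p ^ k * n) = K (m * n) (gcd m n)"
    if mn: "m > 0" "n > 0" "\<not> p dvd gcd m n" for m n
  proof (cases "p dvd n")
    case False
    then show ?thesis using key1 mn by blast
  next
    case True
    \<comment> \<open>p does not divide both cofactors, and \<open>psi\<close>, \<open>H\<close> and
      the arguments of \<open>K\<close> are symmetric, so the two may be exchanged.\<close>
    then have "\<not> p dvd m" using mn(3) by simp
    from key1[OF mn(2,1) this]
    have "psi N p k (p ^ k * n) (p ^ k * m) * H (p ^ k * n) (p ^ k * m) = K (m * n) (gcd m n)"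
      by (simp only: mult.commute[of n m] gcd.commute[of n m])
    moreover have "psi N p k (p ^ k * m) (p ^ k * n) = psi N p k (p ^ k * n) (p ^ k * m)"
      unfolding psi by (simp only: disj_commute)
    moreover have "H (p ^ k * m) (p ^ k * n) = H (p ^ k * n) (p ^ k * m)"
      using mn pk by (intro H_sym) auto
    ultimately show ?thesis by (simp only:)
  qed
  have main: "\<exists>m n. x = p ^ k * m \<and> y = p ^ k * n \<and> m > 0 \<and> n > 0 \<and> \<not> p dvd gcd m n \<and> gcd x y = p ^ k * gcd m n"
    if xy: "x > 0" "y > 0" "p ^ k dvd gcd x y" "\<not> p ^ Suc k dvd gcd x y" for x y
  proof -
    obtain m n where m: "x = p ^ k * m" and n: "y = p ^ k * n" using xy(3) by (auto elim!: dvdE)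
    have g: "gcd x y = p ^ k * gcd m n" unfolding m n by (simp only: gcd_mult_distrib_nat)
    have "\<not> p dvd gcd m n"
    proof
      assume "p dvd gcd m n"
      then have "p ^ k * p dvd gcd x y" unfolding g by (rule mult_dvd_mono[OF dvd_refl])
      then show False using xy(4) by (simp add: mult.commute)
    qed
    then show ?thesis using m n g xy by auto
  qed
  obtain a' b' where ab: "a = p ^ k * a'" "b = p ^ k * b'" "a' > 0" "b' > 0" "\<not> p dvd gcd a' b'"
    "gcd a b = p ^ k * gcd a' b'" using main[OF assms(5,6,11,12)] by blast
  have "p ^ k dvd gcd c d" "\<not> p ^ Suc k dvd gcd c d" using assms(10-12) by simp_all
  from main[OF assms(7,8) this] obtain c' d' where cd: "c = p ^ k * c'" "d = p ^ k * d'" "c' > 0" "d' > 0"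
    "\<not> p dvd gcd c' d'" "gcd c d = p ^ k * gcd c' d'" by blast
  have "gcd a' b' = gcd c' d'" using assms(10) ab(6) cd(6) p(1) by simp
  moreover have "a' * b' = c' * d'" using assms(9) p(1) unfolding ab(1,2) cd(1,2)
    by (simp add: mult.left_commute mult.assoc)
  ultimately have "psi N p k a b * H a b = psi N p k c d * H c d"
    using key[OF ab(3-5)] key[OF cd(3-5)] ab(1,2) cd(1,2) by simp
  then show ?thesis by (simp add: H_def)
qed

end
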